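(* Assume that the following holds: for every dimension $d\ge 1$ and every $\sigma$ with $\sigma>4/d$ and, if $d>4$, also $\sigma<\frac{4}{d-4}$, there exist $\tilde\kappa>0$ and $\tilde S\not\equiv 0$ such that $(\tilde S,\tilde\kappa)$ solves the profile problem $\mathrm{(P)}$ of the context with $\nu=1$ and $\kappa=\tilde\kappa$. Let $d,\sigma$ be in this range, let $\nu\in\mathbb{R}$, $\kappa>0$, let $S(\rho)$ be a nontrivial solution of the profile problem $\mathrm{(P)}$ with parameters $\nu,\kappa$, and let $T_c>0$. Then $$\psi_S(t,r)=\frac{1}{L^{2/\sigma}(t)}\,S\!\left(\frac{r}{L(t)}\right)e^{\,i\nu\int_0^{t}\frac{1}{L^4(s)}\,ds},\qquad L(t)=\kappa\,(T_c-t)^{1/4},\qquad r=|\mathbf{x}|,$$ is an explicit solution of $$i\psi_t(t,\mathbf{x})-\Delta^2\psi+|\psi|^{2\sigma}\psi=0,\qquad \mathbf{x}\in\mathbb{R}^d,$$ that becomes singular in $L^{2+2\sigma}$ as $t\to T_c$; that is, $\psi_S(t,\cdot)\in L^{2+2\sigma}(\mathbb{R}^d)$ for $0\le t<T_c$ and $$\lim_{t\to T_c}\|\psi_S(t,\cdot)\|_{2+2\sigma}=\infty .$$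
   Context: $\Delta^2$ is the biharmonic operator on $\mathbb{R}^d$. On radial functions it acts as $$\Delta_\rho^2=\partial_\rho^4+\frac{2(d-1)}{\rho}\partial_\rho^3+\frac{(d-1)(d-3)}{\rho^2}\partial_\rho^2-\frac{(d-1)(d-3)}{\rho^3}\partial_\rho .$$ Profile problem $\mathrm{(P)}$ with parameters $\nu\in\mathbb{R}$, $\kappa>0$: a complex-valued function $S(\rho)$, $\rho\ge 0$, satisfying $$-\nu S(\rho)+i\frac{\kappa^4}{4}\left(\frac{2}{\sigma}S+\rho S'\right)-\Delta_\rho^2S+|S|^{2\sigma}S=0,$$ $$S'(0)=S'''(0)=0,\qquad S(\infty):=\lim_{\rho\to\infty}S(\rho)=0.$$ Solutions are understood in the classical sense. *)

theory Defs
  imports "HOL-Analysis.Analysis"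
begin

section \<open>Partial derivatives and the biharmonic operator\<close>

definition partial :: "'a::euclidean_space \<Rightarrow> ('a \<Rightarrow> complex) \<Rightarrow> 'a \<Rightarrow> complex" where
  "partial b f x = vector_derivative (\<lambda>h. f (x + h *\<^sub>R b)) (at 0)"

definition laplacian :: "('a::euclidean_space \<Rightarrow> complex) \<Rightarrow> 'a \<Rightarrow> complex" where
  "laplacian f x = (\<Sum>b\<in>Basis. partial b (partial b f) x)"

definition biharmonic :: "('a::euclidean_space \<Rightarrow> complex) \<Rightarrow> 'a \<Rightarrow> complex" where
  "biharmonic f = laplacian (laplacian f)"

text \<open>All iterated spatial partial derivatives up to order \<open>k\<close> exist and are jointly
  continuous in time and space; there is no differentiability requirement in time.\<close>

primrec space_Ck_on :: "nat \<Rightarrow> real set \<Rightarrow> (real \<Rightarrow> 'a::euclidean_space \<Rightarrow> complex) \<Rightarrow> bool" where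
  "space_Ck_on 0 I u \<longleftrightarrow> continuous_on (I \<times> UNIV) (\<lambda>(t, x). u t x)"
| "space_Ck_on (Suc k) I u \<longleftrightarrow>
     continuous_on (I \<times> UNIV) (\<lambda>(t, x). u t x) \<and>
     (\<forall>b\<in>Basis.
        (\<forall>t\<in>I. \<forall>x. (\<lambda>h. u t (x + h *\<^sub>R b)) differentiable (at 0)) \<and>
        space_Ck_on k I (\<lambda>t. partial b (u t)))"

section \<open>The biharmonic nonlinear Schroedinger equation\<close>

definition time_deriv :: "real set \<Rightarrow> (real \<Rightarrow> 'a \<Rightarrow> complex) \<Rightarrow> real \<Rightarrow> 'a \<Rightarrow> complex" where
  "time_deriv I \<psi> t x = vector_derivative (\<lambda>s. \<psi> s x) (at t within I)"

text \<open>Classical solution on a time interval \<open>I\<close>. The time derivative is one-sided at an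
  endpoint that belongs to \<open>I\<close>. Since \<open>0 powr a = 0\<close>, the nonlinearity vanishes where \<open>\<psi>\<close> does.\<close>

definition bnls_classical_solution_on ::
    "real \<Rightarrow> real set \<Rightarrow> (real \<Rightarrow> 'a::euclidean_space \<Rightarrow> complex) \<Rightarrow> bool" where
  "bnls_classical_solution_on \<sigma> I \<psi> \<longleftrightarrow>
     space_Ck_on 4 I \<psi> \<and>
     (\<forall>t\<in>I. \<forall>x. (\<lambda>s. \<psi> s x) differentiable (at t within I)) \<and>
     continuous_on (I \<times> UNIV) (\<lambda>(t, x). time_deriv I \<psi> t x) \<and>
     (\<forall>t\<in>I. \<forall>x.
        \<i> * time_deriv I \<psi> t x - biharmonic (\<psi> t) x
          + of_real (norm (\<psi> t x) powr (2 * \<sigma>)) * \<psi> t x = 0)"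

section \<open>The radial profile problem\<close>

text \<open>Profiles live on the half-line \<open>{0..}\<close>; derivatives at \<open>0\<close> are one-sided, and the
  values of a profile at negative arguments are irrelevant.\<close>

definition hl_deriv :: "(real \<Rightarrow> complex) \<Rightarrow> real \<Rightarrow> complex" where
  "hl_deriv S \<rho> = vector_derivative S (at \<rho> within {0..})"

abbreviation hl_derivs :: "nat \<Rightarrow> (real \<Rightarrow> complex) \<Rightarrow> real \<Rightarrow> complex" where
  "hl_derivs k S \<equiv> (hl_deriv ^^ k) S"

definition hl_Ck :: "nat \<Rightarrow> (real \<Rightarrow> complex) \<Rightarrow> bool" where
  "hl_Ck k S \<longleftrightarrow>
     (\<forall>j<k. \<forall>\<rho>\<ge>0. hl_derivs j S differentiable (at \<rho> within {0..})) \<and>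
     continuous_on {0..} (hl_derivs k S)"

definition radial_biharmonic :: "nat \<Rightarrow> (real \<Rightarrow> complex) \<Rightarrow> real \<Rightarrow> complex" where
  "radial_biharmonic d S \<rho> =
     hl_derivs 4 S \<rho>
     + of_real (2 * (real d - 1) / \<rho>) * hl_derivs 3 S \<rho>
     + of_real ((real d - 1) * (real d - 3) / \<rho>^2) * hl_derivs 2 S \<rho>
     - of_real ((real d - 1) * (real d - 3) / \<rho>^3) * hl_derivs 1 S \<rho>"

text \<open>The equation is imposed for \<open>\<rho> > 0\<close>, where the coefficients of the radial operator
  are defined.\<close>

definition profile_solution ::
    "nat \<Rightarrow> real \<Rightarrow> real \<Rightarrow> real \<Rightarrow> (real \<Rightarrow> complex) \<Rightarrow> bool" where
  "profile_solution d \<sigma> \<nu> \<kappa> S \<longleftrightarrow>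
     hl_Ck 4 S \<and>
     (\<forall>\<rho>>0.
        - of_real \<nu> * S \<rho>
        + \<i> * of_real (\<kappa>^4 / 4) * (of_real (2 / \<sigma>) * S \<rho> + of_real \<rho> * hl_derivs 1 S \<rho>)
        - radial_biharmonic d S \<rho>
        + of_real (norm (S \<rho>) powr (2 * \<sigma>)) * S \<rho> = 0) \<and>
     hl_derivs 1 S 0 = 0 \<and> hl_derivs 3 S 0 = 0 \<and>
     (S \<longlongrightarrow> 0) at_top"

definition nontrivial_profile :: "(real \<Rightarrow> complex) \<Rightarrow> bool" where
  "nontrivial_profile S \<longleftrightarrow> (\<exists>\<rho>\<ge>0. S \<rho> \<noteq> 0)"

definition admissible :: "nat \<Rightarrow> real \<Rightarrow> bool" where
  "admissible d \<sigma> \<longleftrightarrow> d \<ge> 1 \<and> \<sigma> > 4 / real d \<and> (d > 4 \<longrightarrow> \<sigma> < 4 / (real d - 4))"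

section \<open>The self-similar solution\<close>

definition blowup_width :: "real \<Rightarrow> real \<Rightarrow> real \<Rightarrow> real" where
  "blowup_width \<kappa> T\<^sub>c t = \<kappa> * (T\<^sub>c - t) powr (1 / 4)"

definition psi_S ::
    "real \<Rightarrow> real \<Rightarrow> real \<Rightarrow> real \<Rightarrow> (real \<Rightarrow> complex) \<Rightarrow> real \<Rightarrow> 'a::euclidean_space \<Rightarrow> complex" where
  "psi_S \<sigma> \<nu> \<kappa> T\<^sub>c S t x =
     (let L = blowup_width \<kappa> T\<^sub>c in
        of_real (1 / L t powr (2 / \<sigma>)) * S (norm x / L t)
        * exp (\<i> * of_real (\<nu> * integral {0..t} (\<lambda>s. 1 / L s ^ 4))))"

section \<open>Lebesgue spaces\<close>

definition in_Lp :: "real \<Rightarrow> ('a::euclidean_space \<Rightarrow> complex) \<Rightarrow> bool" where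
  "in_Lp p f \<longleftrightarrow> f \<in> borel_measurable lborel \<and> integrable lborel (\<lambda>x. norm (f x) powr p)"

definition Lp_norm :: "real \<Rightarrow> ('a::euclidean_space \<Rightarrow> complex) \<Rightarrow> real" where
  "Lp_norm p f = (\<integral>x. norm (f x) powr p \<partial>lborel) powr (1 / p)"

end

theory Submission
  imports Defs
begin

text \<open>
  The profile equation is exactly what remains of the PDE after the self-similar substitution, and
  the \<open>L\<^sup>p\<close> norm scales like a negative power of \<open>T\<^sub>c - t\<close>. Two points need an
  argument: \<open>S(|x|)\<close> must be \<open>C\<^sup>4\<close> across the origin, and \<open>S\<close> must lie in \<open>L\<^sup>p\<close>,
  \<open>p = 2 + 2\<sigma>\<close>, although the profile problem only provides \<open>S(\<infinity>) = 0\<close>.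

  For the first, subtract the Taylor polynomial \<open>a + b r\<^sup>2 + c r\<^sup>4\<close>. It gives a smooth
  function, and every \<open>j\<close>-th partial derivative of the rest is \<open>o(|x|\<^bsup>4-j\<^esup>)\<close>.

  For the second, treat the equation at infinity as a system. With \<open>a = \<kappa>\<^sup>4/4\<close> its WKB modes
  are \<open>S \<sim> \<rho>\<^bsup>-2/\<sigma>\<^esup>\<close> and three modes \<open>exp(\<integral> w (a\<rho>)\<^bsup>1/3\<^esup>)\<close>, \<open>w\<^sup>3 = i\<close>: one
  oscillating with amplitude \<open>\<rho>\<^bsup>(2/\<sigma> - 2d)/3\<^esup>\<close>, one decaying and one growing exponentially. The
  nonlinear potential \<open>|S|\<^bsup>2\<sigma>\<^esup>\<close> tends to \<open>0\<close>, hence costs only an arbitrarily small loss in the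
  exponents. A cone argument shows that either the growing mode eventually dominates, which
  contradicts \<open>S(\<infinity>) = 0\<close>, or \<open>S = O(\<rho>\<^bsup>-\<gamma>\<^esup>)\<close> for each \<open>\<gamma>\<close> below both rates. The bounds
  on \<open>\<sigma>\<close> leave room for such a \<open>\<gamma>\<close> with \<open>\<gamma>p > d\<close>.
\<close>

section \<open>Differential inequalities with a growing direction\<close>

text \<open>The obstacle at infinity is that two modes, \<open>P\<close> and
  \<open>W (- \<i>)\<close>, neither grow nor decay exponentially. Terms of relative size 1/r
  therefore shift their powers of r, and a crude bound on them would lose the exponent needed for
  integrability. Hence both diagonal 1/r coefficients are computed exactly and one of the two mutual
  couplings is removed. The neutral pair is then triangular up to o(1/r), and its rates can be read
  off the diagonal. The factor |S|^(2\<sigma>) enters only as a coefficient tending to 0, so no rate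
  for S has to be known beforehand. The room for \<gamma> is d/p < min (2/\<sigma>) ((2d -
  2/\<sigma>)/3). The first comparison says \<sigma>(d - 4) < 4, the second follows from \<sigma> d
  > 4. The first is also the positivity of 4/\<sigma> + 4 - d, the power of 1/L in the p-th power of
  the norm, so integrability and blowup share one bound. At the origin the radial equation is
  singular and given only for \<rho> > 0. The C^4 regularity makes the bilaplacian continuous there,
  which carries the equation over to x = 0.\<close>

lemma power_gronwall:
  fixes f f' :: "real \<Rightarrow> real"
  assumes "0 < a" and "a \<le> r"
    and der: "\<And>x. x \<ge> a \<Longrightarrow> (f has_real_derivative f' x) (at x)"
    and le: "\<And>x. x \<ge> a \<Longrightarrow> c / x * f x \<le> f' x"
  shows "f a * (r / a) powr c \<le> f r"
proof -
  let ?h = "\<lambda>x. f x * x powr (- c)"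
  have "?h a \<le> ?h r"
  proof (rule DERIV_nonneg_imp_nondecreasing[OF \<open>a \<le> r\<close>], intro exI conjI)
    fix x assume x: "a \<le> x" "x \<le> r"
    then have "x > 0" using \<open>0 < a\<close> by simp
    show "(?h has_real_derivative f' x * x powr (- c) + f x * (- c * x powr (- c - 1))) (at x)"
      using x \<open>x > 0\<close> by (auto intro!: derivative_eq_intros der)
    have "f' x * x powr (- c) + f x * (- c * x powr (- c - 1)) = x powr (- c) * (f' x - c / x * f x)"
      using \<open>x > 0\<close> by (simp add: powr_diff field_simps)
    also have "\<dots> \<ge> 0"
      using le[OF x(1)] by simp
    finally show "0 \<le> f' x * x powr (- c) + f x * (- c * x powr (- c - 1))" .
  qed
  then show ?thesis
    using assms(1,2) by (simp add: powr_minus powr_divide field_simps)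
qed

text \<open>The cone G > \<epsilon> N is forward invariant: \<open>H = G - \<epsilon> * N\<close>
  satisfies H' \<ge> (2b/r) H whatever its sign. So either H is never positive past
  \<open>r0\<close>, or it stays positive from some point on and grows at least quadratically. Every
  \<open>M\<close> is allowed in \<open>leG\<close> because an exponential mode outgrows every
  power.\<close>

lemma cone_dichotomy:
  fixes N G N' G' :: "real \<Rightarrow> real"
  assumes dN: "\<forall>\<^sub>F r in at_top. (N has_real_derivative N' r) (at r)"
    and dG: "\<forall>\<^sub>F r in at_top. (G has_real_derivative G' r) (at r)"
    and N0: "\<And>r. 0 \<le> N r" and G0: "\<And>r. 0 \<le> G r"
    and A: "0 \<le> A" and B: "0 \<le> B" and \<epsilon>: "0 < \<epsilon>" and \<theta>: "0 \<le> \<theta>"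
    and leN: "\<forall>\<^sub>F r in at_top. N' r \<le> 2 / r * (A * N r + B * G r)"
    and leG: "\<And>M. \<forall>\<^sub>F r in at_top. 2 / r * (M * G r - N r) \<le> G' r"
  shows "(\<exists>c>0. \<forall>\<^sub>F r in at_top. c * r\<^sup>2 \<le> G r \<and> \<theta> * N r \<le> G r) \<or>
         (\<forall>\<^sub>F r in at_top. G r \<le> \<epsilon> * N r)"
proof -
  \<comment> \<open>This makes the coefficient of N in the inequality for H equal to
    \<open>\<epsilon> * b - 1 - \<epsilon> * A = \<epsilon>\<close>, and \<open>1 \<le> b\<close>
    gives growth like r^2.\<close>
  define b where "b = 1 + 1 / \<epsilon> + A"
  \<comment> \<open>The part \<open>\<epsilon> * B + b\<close> serves the inequality for
    \<open>H\<close>. The terms \<open>1 / \<epsilon> + 2 * \<theta> * (A / \<epsilon> + B)\<close>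
    make \<open>R\<close> below nondecreasing.\<close>
  define M where "M = \<epsilon> * B + b + \<epsilon> + 1 / \<epsilon> + 2 * \<theta> * (A / \<epsilon> + B)"
  have "\<forall>\<^sub>F r in at_top. (0::real) < r" by (rule eventually_gt_at_top)
  from this dN dG leN leG[of M] have
    "\<forall>\<^sub>F r in at_top. r > 0 \<and> (N has_real_derivative N' r) (at r) \<and> (G has_real_derivative G' r) (at r)
       \<and> N' r \<le> 2 / r * (A * N r + B * G r) \<and> 2 / r * (M * G r - N r) \<le> G' r"
    by eventually_elim blast
  then obtain r0 where r0: "\<And>r. r \<ge> r0 \<Longrightarrow> r > 0 \<and> (N has_real_derivative N' r) (at r) \<and> (G has_real_derivative G' r) (at r)
       \<and> N' r \<le> 2 / r * (A * N r + B * G r) \<and> 2 / r * (M * G r - N r) \<le> G' r"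
    by (auto simp: eventually_at_top_linorder)
  show ?thesis
  proof (cases "\<forall>r\<ge>r0. G r \<le> \<epsilon> * N r")
    case True
    then show ?thesis by (auto simp: eventually_at_top_linorder)
  next
    case False
    then obtain r1 where r1: "r1 \<ge> r0" "\<epsilon> * N r1 < G r1" by force
    then have r1pos: "r1 > 0" using r0 by blast
    define H where "H = (\<lambda>r. G r - \<epsilon> * N r)"
    have Hgrow: "H r1 * (r / r1) powr (2 * b) \<le> H r" if "r \<ge> r1" for r
    proof (rule power_gronwall[OF r1pos that, where f' = "\<lambda>r. G' r - \<epsilon> * N' r"])
      fix x assume "r1 \<le> x"
      with r1 have x: "x \<ge> r0" by simp
      note X = r0[OF x]
      show "(H has_real_derivative G' x - \<epsilon> * N' x) (at x)"
        unfolding H_def using X by (auto intro!: derivative_eq_intros)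
      have "b * H x \<le> M * G x - N x - \<epsilon> * (A * N x + B * G x)"
      proof -
        have "M * G x - N x - \<epsilon> * (A * N x + B * G x) - b * H x =
          (M - \<epsilon> * B - b) * G x + (\<epsilon> * b - 1 - \<epsilon> * A) * N x"
          by (simp add: H_def algebra_simps)
        moreover have "\<epsilon> * b - 1 - \<epsilon> * A = \<epsilon>" using \<epsilon> by (simp add: b_def field_simps)
        moreover have "M - \<epsilon> * B - b \<ge> 0" using \<epsilon> \<theta> A B by (simp add: M_def)
        ultimately show ?thesis using N0[of x] G0[of x] \<epsilon>
          by (smt (verit) mult_nonneg_nonneg)
      qed
      then have "2 / x * (b * H x) \<le> 2 / x * (M * G x - N x - \<epsilon> * (A * N x + B * G x))"
        using X by (intro mult_left_mono) auto
      also have "\<dots> = 2 / x * (M * G x - N x) - \<epsilon> * (2 / x * (A * N x + B * G x))"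
        by (simp add: algebra_simps)
      also have "\<dots> \<le> G' x - \<epsilon> * N' x"
        using X \<epsilon> by (intro diff_mono mult_left_mono) auto
      finally show "2 * b / x * H x \<le> G' x - \<epsilon> * N' x" by simp
    qed
    have H1: "H r1 > 0" using r1 by (simp add: H_def)
    define c where "c = H r1 / r1\<^sup>2"
    have c: "c > 0" using H1 r1pos by (simp add: c_def)
    have Hc: "c * r\<^sup>2 \<le> H r" if "r \<ge> r1" for r
    proof -
      have "(r / r1) powr 2 \<le> (r / r1) powr (2 * b)"
        using that r1pos \<epsilon> A by (intro powr_mono) (auto simp: b_def)
      then have "H r1 * (r / r1) powr 2 \<le> H r1 * (r / r1) powr (2 * b)" using H1 by simp
      also have "\<dots> \<le> H r" using Hgrow[OF that] .
      finally show ?thesis using that r1pos by (simp add: c_def power_divide)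
    qed
    have Gc: "c * r\<^sup>2 \<le> G r" if "r \<ge> r1" for r
      using Hc[OF that] N0[of r] \<epsilon> unfolding H_def by (smt (verit) mult_nonneg_nonneg)
    have NG: "N r \<le> G r / \<epsilon>" if "r \<ge> r1" for r
    proof -
      have "0 \<le> c * r\<^sup>2" using c by simp
      with Hc[OF that] have "0 \<le> H r" by linarith
      then show ?thesis using \<epsilon> by (simp add: H_def field_simps)
    qed
    \<comment> \<open>Inside the cone G only dominates N with the factor \<epsilon>. Monotonicity of
      \<open>R\<close> improves this to the factor \<theta>: only half of G is spent, and the other
      half absorbs the possibly negative constant \<open>R r1\<close>, since G tends to
      infinity.\<close>
    define R where "R = (\<lambda>r. G r / 2 - \<theta> * N r)"
    have R: "R r1 \<le> R r" if "r \<ge> r1" for r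
    proof (rule DERIV_nonneg_imp_nondecreasing[OF that], intro exI conjI)
      fix x assume "r1 \<le> x"
      with r1 have x: "x \<ge> r0" by simp
      note X = r0[OF x]
      show "(R has_real_derivative G' x / 2 - \<theta> * N' x) (at x)"
        unfolding R_def using X by (auto intro!: derivative_eq_intros)
      have nn: "(1 / 2 + \<theta> * A) * N x \<le> (1 / 2 + \<theta> * A) * (G x / \<epsilon>)"
        using NG[OF \<open>r1 \<le> x\<close>] \<theta> A by (intro mult_left_mono) auto
      have "M / 2 - (1 / 2 + \<theta> * A) / \<epsilon> - \<theta> * B = (\<epsilon> * B + b + \<epsilon>) / 2"
        using \<epsilon> by (simp add: M_def field_simps)
      also have "\<dots> \<ge> 0" using \<epsilon> A B by (simp add: b_def)
      finally have "0 \<le> (M / 2 - (1 / 2 + \<theta> * A) / \<epsilon> - \<theta> * B) * G x" using G0 by simp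
      moreover have "(M * G x - N x) / 2 - \<theta> * (A * N x + B * G x) =
          (M / 2 - (1 / 2 + \<theta> * A) / \<epsilon> - \<theta> * B) * G x
          + ((1 / 2 + \<theta> * A) * (G x / \<epsilon>) - (1 / 2 + \<theta> * A) * N x)"
        by (simp add: left_diff_distrib right_diff_distrib distrib_left distrib_right
            diff_divide_distrib add_divide_distrib mult_ac)
      ultimately have "0 \<le> (M * G x - N x) / 2 - \<theta> * (A * N x + B * G x)"
        using nn by linarith
      then have "0 \<le> 2 / x * ((M * G x - N x) / 2 - \<theta> * (A * N x + B * G x))"
        using X by simp
      also have "\<dots> = 2 / x * (M * G x - N x) / 2 - \<theta> * (2 / x * (A * N x + B * G x))"
        using X by (simp add: algebra_simps)
      also have "\<dots> \<le> G' x / 2 - \<theta> * N' x"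
        using X \<theta> by (intro diff_mono mult_left_mono divide_right_mono) auto
      finally show "0 \<le> G' x / 2 - \<theta> * N' x" .
    qed
    have "filterlim (\<lambda>r::real. c * r\<^sup>2) at_top at_top"
      using c by (intro filterlim_tendsto_pos_mult_at_top[OF tendsto_const] filterlim_pow_at_top filterlim_ident) auto
    then have "\<forall>\<^sub>F r in at_top. - 2 * R r1 \<le> c * r\<^sup>2"
      by (auto simp: filterlim_at_top)
    moreover have "\<forall>\<^sub>F r in at_top. r \<ge> r1" by (rule eventually_ge_at_top)
    ultimately have "\<forall>\<^sub>F r in at_top. c * r\<^sup>2 \<le> G r \<and> \<theta> * N r \<le> G r"
    proof eventually_elim
      case (elim r)
      have "R r1 \<le> G r / 2 - \<theta> * N r" using R[OF elim(2)] by (simp only: R_def)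
      with elim(1) Gc[OF elim(2)] show ?case by (intro conjI; linarith)
    qed
    with c show ?thesis by blast
  qed
qed

section \<open>Energies of complex-valued modes\<close>

lemma has_real_derivative_norm_sq:
  fixes f :: "real \<Rightarrow> complex"
  assumes "(f has_vector_derivative f') (at r)"
  shows "((\<lambda>r. (norm (f r))\<^sup>2) has_real_derivative 2 * (f r \<bullet> f')) (at r)"
proof -
  have "((\<lambda>r. f r \<bullet> f r) has_derivative (\<lambda>h. f r \<bullet> (h *\<^sub>R f') + (h *\<^sub>R f') \<bullet> f r)) (at r)"
    using assms unfolding has_vector_derivative_def
    by (intro has_derivative_inner) auto
  moreover have "(\<lambda>h. f r \<bullet> (h *\<^sub>R f') + (h *\<^sub>R f') \<bullet> f r) = (*) (2 * (f r \<bullet> f'))"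
    by (simp add: fun_eq_iff inner_commute)
  ultimately show ?thesis
    by (simp add: has_field_derivative_def power2_norm_eq_inner)
qed

lemma inner_mult_self_complex: "(f::complex) \<bullet> (k * f) = Re k * (norm f)\<^sup>2"
  by (simp only: cmod_power2) (simp add: inner_complex_def power2_eq_square algebra_simps)

lemma inner_perturbed_le:
  fixes f f' k :: complex
  assumes "norm (f' - k * f) \<le> e"
  shows "f \<bullet> f' \<le> Re k * (norm f)\<^sup>2 + norm f * e"
    and "Re k * (norm f)\<^sup>2 - norm f * e \<le> f \<bullet> f'"
proof -
  have "f \<bullet> f' = Re k * (norm f)\<^sup>2 + f \<bullet> (f' - k * f)"
    by (simp add: inner_diff_right inner_mult_self_complex)
  moreover have "\<bar>f \<bullet> (f' - k * f)\<bar> \<le> norm f * e"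
    using Cauchy_Schwarz_ineq2[of f "f' - k * f"] mult_left_mono[OF assms norm_ge_zero[of f]]
    by linarith
  ultimately show "f \<bullet> f' \<le> Re k * (norm f)\<^sup>2 + norm f * e"
    and "Re k * (norm f)\<^sup>2 - norm f * e \<le> f \<bullet> f'" by auto
qed

lemma mult_le_weighted_squares:
  fixes x y :: real
  assumes "0 < \<eta>"
  shows "C * x * y \<le> \<eta> * x\<^sup>2 + C\<^sup>2 / \<eta> * y\<^sup>2"
proof -
  have "0 \<le> (\<eta> * x - C * y)\<^sup>2 + (\<eta> * x)\<^sup>2 + (C * y)\<^sup>2" by simp
  then have "C * x * y * \<eta> \<le> (\<eta> * x\<^sup>2 + C\<^sup>2 / \<eta> * y\<^sup>2) * \<eta>"
    using assms by (simp add: power2_eq_square algebra_simps)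
  then show ?thesis using assms by simp
qed

text \<open>
  The weight \<open>K\<^sup>2\<close> makes the coupling of \<open>u\<close> to \<open>p\<close> small; the coupling of \<open>p\<close> to the
  others is small anyway, and everything involving \<open>v\<close> is absorbed by its damping.
\<close>

lemma energy_quadratic_bound:
  fixes p u v g \<mu> \<eta> C K :: real
  assumes nn: "0 \<le> p" "0 \<le> u" "0 \<le> v" "0 \<le> g" and \<eta>: "0 < \<eta>" and C: "0 \<le> C"
    and K: "1 \<le> K" "C \<le> \<eta> / 8 * K"
    and \<Lambda>: "C + \<bar>\<mu>\<bar> + 40 * C\<^sup>2 / \<eta> \<le> \<Lambda>"
    and B: "\<eta> + 8 * C\<^sup>2 / \<eta> \<le> B"
    and X: "X = p + u + v + g"
  shows "K\<^sup>2 * (\<mu> * p\<^sup>2 + p * (\<eta> / (16 * K\<^sup>2) * X))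
         + (\<mu> * u\<^sup>2 + u * (\<eta> / 16 * X + C * (p + v + g)))
         + (- \<Lambda> * v\<^sup>2 + v * (C * X))
       \<le> (\<mu> + \<eta>) * (K\<^sup>2 * p\<^sup>2 + u\<^sup>2 + v\<^sup>2) + B * g\<^sup>2"
proof -
  have K2: "1 \<le> K\<^sup>2" using K by simp
  define q where "q = K\<^sup>2 * p\<^sup>2"
  have pq: "p\<^sup>2 \<le> q" unfolding q_def using mult_right_mono[OF K2, of "p\<^sup>2"] by simp
  have sq: "x * y \<le> (x\<^sup>2 + y\<^sup>2) / 2" for x y :: real
    using sum_squares_bound[of x y] by simp
  have pX: "p * X \<le> (5 * p\<^sup>2 + u\<^sup>2 + v\<^sup>2 + g\<^sup>2) / 2"
    using sq[of p u] sq[of p v] sq[of p g] by (simp add: X algebra_simps power2_eq_square)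
  have uX: "u * X \<le> (5 * u\<^sup>2 + p\<^sup>2 + v\<^sup>2 + g\<^sup>2) / 2"
    using sq[of u p] sq[of u v] sq[of u g] by (simp add: X algebra_simps power2_eq_square)
  have "C * (u * p) \<le> \<eta> / 8 * K * (u * p)" using K nn by (intro mult_right_mono) auto
  also have "\<dots> = \<eta> / 8 * (u * (K * p))" by simp
  also have "\<dots> \<le> \<eta> / 8 * ((u\<^sup>2 + (K * p)\<^sup>2) / 2)"
    using \<eta> by (intro mult_left_mono sq) auto
  finally have up: "C * (u * p) \<le> \<eta> / 16 * (u\<^sup>2 + q)"
    by (simp add: q_def power_mult_distrib)
  have \<eta>8: "\<eta> / 8 > 0" using \<eta> by simp
  define e where "e = C\<^sup>2 / \<eta>"
  have w: "C * (x * y) \<le> \<eta> * x\<^sup>2 / 8 + 8 * (e * y\<^sup>2)" for x y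
    using mult_le_weighted_squares[OF \<eta>8, of C x y] by (simp add: mult_ac e_def)
  have 1: "K\<^sup>2 * (\<mu> * p\<^sup>2 + p * (\<eta> / (16 * K\<^sup>2) * X)) = \<mu> * q + \<eta> / 16 * (p * X)"
    using K by (simp add: q_def field_simps)
  have "\<eta> / 16 * (p * X) \<le> \<eta> / 16 * ((5 * q + u\<^sup>2 + v\<^sup>2 + g\<^sup>2) / 2)"
    using pX pq \<eta> by (intro mult_left_mono) auto
  also have "\<dots> = 5 / 32 * (\<eta> * q) + 1 / 32 * (\<eta> * u\<^sup>2) + 1 / 32 * (\<eta> * v\<^sup>2) + 1 / 32 * (\<eta> * g\<^sup>2)"
    by (simp add: algebra_simps)
  finally have 2: "\<eta> / 16 * (p * X) \<le> 5 / 32 * (\<eta> * q) + 1 / 32 * (\<eta> * u\<^sup>2) + 1 / 32 * (\<eta> * v\<^sup>2) + 1 / 32 * (\<eta> * g\<^sup>2)" .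
  have 3: "u * (\<eta> / 16 * X + C * (p + v + g)) =
      \<eta> / 16 * (u * X) + C * (u * p) + C * (u * v) + C * (u * g)"
    by (simp add: algebra_simps)
  have "\<eta> / 16 * (u * X) \<le> \<eta> / 16 * ((5 * u\<^sup>2 + q + v\<^sup>2 + g\<^sup>2) / 2)"
    using uX pq \<eta> by (intro mult_left_mono) auto
  also have "\<dots> = 5 / 32 * (\<eta> * u\<^sup>2) + 1 / 32 * (\<eta> * q) + 1 / 32 * (\<eta> * v\<^sup>2) + 1 / 32 * (\<eta> * g\<^sup>2)"
    by (simp add: algebra_simps)
  finally have 4: "\<eta> / 16 * (u * X) \<le> 5 / 32 * (\<eta> * u\<^sup>2) + 1 / 32 * (\<eta> * q) + 1 / 32 * (\<eta> * v\<^sup>2) + 1 / 32 * (\<eta> * g\<^sup>2)" .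
  have 5: "v * (C * X) = C * v\<^sup>2 + C * (p * v) + C * (u * v) + C * (g * v)"
    by (simp add: X algebra_simps power2_eq_square)
  have 6: "C * v\<^sup>2 + \<bar>\<mu>\<bar> * v\<^sup>2 + 40 * (e * v\<^sup>2) \<le> \<Lambda> * v\<^sup>2"
    using mult_right_mono[OF \<Lambda>, of "v\<^sup>2"] by (simp add: algebra_simps e_def)
  have 7: "0 \<le> \<mu> * v\<^sup>2 + \<bar>\<mu>\<bar> * v\<^sup>2" by (simp flip: distrib_right)
  have 8: "\<eta> * g\<^sup>2 + 8 * (e * g\<^sup>2) \<le> B * g\<^sup>2"
    using mult_right_mono[OF B, of "g\<^sup>2"] by (simp add: algebra_simps e_def)
  have 9: "0 \<le> \<eta> * u\<^sup>2" "0 \<le> \<eta> * v\<^sup>2" "0 \<le> \<eta> * g\<^sup>2" "0 \<le> \<eta> * q" "0 \<le> e * v\<^sup>2" "\<eta> * p\<^sup>2 \<le> \<eta> * q"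
    using \<eta> pq by (auto simp: q_def e_def)
  have 10: "(\<mu> + \<eta>) * (q + u\<^sup>2 + v\<^sup>2) =
      \<mu> * q + \<mu> * u\<^sup>2 + \<mu> * v\<^sup>2 + \<eta> * q + \<eta> * u\<^sup>2 + \<eta> * v\<^sup>2"
    by (simp add: algebra_simps)
  have 11: "C * (u * p) \<le> 1 / 16 * (\<eta> * u\<^sup>2) + 1 / 16 * (\<eta> * q)"
    using up by (simp add: algebra_simps)
  \<comment> \<open>The fractions form a budget. Over the three rows, \<eta> u^2 is charged 1/32 +
    3/4 + 1/8 < 1 and \<eta> q is charged 5/32 + 1/8 + 1/8 < 1. The charge on
    \<open>e * v\<^sup>2\<close> is 8 + 24 = 32, covered by the 40 in \<Lambda>, and the one on
    \<open>e * g\<^sup>2\<close> is the 8 in \<open>B\<close>.\<close>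
  have 12: "\<eta> / 16 * (u * X) + C * (u * p) + C * (u * v) + C * (u * g) \<le>
      3 / 4 * (\<eta> * u\<^sup>2) + 1 / 8 * (\<eta> * q) + 1 / 32 * (\<eta> * v\<^sup>2) + 1 / 32 * (\<eta> * g\<^sup>2)
      + 8 * (e * v\<^sup>2) + 8 * (e * g\<^sup>2)"
    using 4 11 9(1,4) w[of u v] w[of u g] by linarith
  have 13: "C * (p * v) + C * (u * v) + C * (g * v) \<le>
      1 / 8 * (\<eta> * q) + 1 / 8 * (\<eta> * u\<^sup>2) + 1 / 8 * (\<eta> * g\<^sup>2) + 24 * (e * v\<^sup>2)"
    using 9(6) w[of p v] w[of u v] w[of g v] by linarith
  have 14: "- (\<Lambda> * v\<^sup>2) + C * v\<^sup>2 + 32 * (e * v\<^sup>2) \<le> \<mu> * v\<^sup>2"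
    using 6 7 9(5) by linarith
  show ?thesis
    unfolding q_def[symmetric] 1 3 5 10 mult_minus_left
    using 2 12 13 14 8 9(1-4) by linarith
qed

text \<open>Here \<open>p\<close> and \<open>u\<close> are the neutral modes, \<open>v\<close> is
  damped and \<open>g\<close> grows, the last two faster than any power. Since \<open>p\<close>
  feels the rest only at o(1/r), the neutral pair is asymptotically triangular and its growth
  exceeds \<mu> by an arbitrarily small amount. The factor \<theta> in the first alternative is
  there to exclude cancellation when the modes are recombined.\<close>

lemma dichotomy_system_decay:
  fixes p u v g p' u' v' g' :: "real \<Rightarrow> complex" and ku kv kg :: "real \<Rightarrow> complex"
    and \<mu> \<mu>' C \<theta> :: real
  defines "X \<equiv> \<lambda>r. norm (p r) + norm (u r) + norm (v r) + norm (g r)"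
  assumes dp: "\<forall>\<^sub>F r in at_top. (p has_vector_derivative p' r) (at r)"
    and du: "\<forall>\<^sub>F r in at_top. (u has_vector_derivative u' r) (at r)"
    and dv: "\<forall>\<^sub>F r in at_top. (v has_vector_derivative v' r) (at r)"
    and dg: "\<forall>\<^sub>F r in at_top. (g has_vector_derivative g' r) (at r)"
    and p': "\<And>\<delta>. 0 < \<delta> \<Longrightarrow> \<forall>\<^sub>F r in at_top. norm (p' r - kp r * p r) \<le> \<delta> * X r / r"
    and u': "\<And>\<delta>. 0 < \<delta> \<Longrightarrow> \<forall>\<^sub>F r in at_top. norm (u' r - ku r * u r)
               \<le> (\<delta> * X r + C * (norm (p r) + norm (v r) + norm (g r))) / r"
    and v': "\<forall>\<^sub>F r in at_top. norm (v' r - kv r * v r) \<le> C * X r / r"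
    and g': "\<forall>\<^sub>F r in at_top. norm (g' r - kg r * g r) \<le> C * X r / r"
    and kp: "\<forall>\<^sub>F r in at_top. Re (kp r) \<le> \<mu> / r"
    and ku: "\<forall>\<^sub>F r in at_top. Re (ku r) \<le> \<mu> / r"
    and kv: "\<And>\<Lambda>. \<forall>\<^sub>F r in at_top. Re (kv r) \<le> - \<Lambda> / r"
    and kg: "\<And>\<Lambda>. \<forall>\<^sub>F r in at_top. \<Lambda> / r \<le> Re (kg r)"
    and "\<mu> < \<mu>'" and C: "0 \<le> C" and \<theta>: "0 \<le> \<theta>"
  shows "(\<exists>c>0. \<forall>\<^sub>F r in at_top. c * r \<le> norm (g r) \<and>
            \<theta> * norm (p r) \<le> norm (g r) \<and> \<theta> * norm (u r) \<le> norm (g r) \<and> \<theta> * norm (v r) \<le> norm (g r)) \<or>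
         (\<exists>D. \<forall>\<^sub>F r in at_top. X r \<le> D * r powr \<mu>')"
proof -
  \<comment> \<open>Half of the gap pays for the couplings in the energy estimate, the other half
    for the term \<open>B * G r\<close> in the decaying case.\<close>
  define \<eta> where "\<eta> = (\<mu>' - \<mu>) / 2"
  have \<eta>: "0 < \<eta>" using \<open>\<mu> < \<mu>'\<close> by (simp add: \<eta>_def)
  define K where "K = max 1 (8 * C / \<eta>)"
  have K: "1 \<le> K" "C \<le> \<eta> / 8 * K"
    using \<eta> by (auto simp: K_def max_def field_simps)
  define \<Lambda> where "\<Lambda> = C + \<bar>\<mu>\<bar> + 40 * C\<^sup>2 / \<eta>"
  define B where "B = \<eta> + 8 * C\<^sup>2 / \<eta>"
  have B: "0 \<le> B" using \<eta> by (simp add: B_def)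
  define A where "A = \<bar>\<mu>\<bar> + \<eta>"
  define N where "N = (\<lambda>r. K\<^sup>2 * (norm (p r))\<^sup>2 + (norm (u r))\<^sup>2 + (norm (v r))\<^sup>2)"
  define G where "G = (\<lambda>r. (norm (g r))\<^sup>2)"
  define N' where "N' = (\<lambda>r. K\<^sup>2 * (2 * (p r \<bullet> p' r)) + 2 * (u r \<bullet> u' r) + 2 * (v r \<bullet> v' r))"
  define G' where "G' = (\<lambda>r. 2 * (g r \<bullet> g' r))"
  have pos: "\<forall>\<^sub>F r in at_top. (0::real) < r" by (rule eventually_gt_at_top)
  have N0: "0 \<le> N r" and G0: "0 \<le> G r" for r by (simp_all add: N_def G_def)
  have dN: "\<forall>\<^sub>F r in at_top. (N has_real_derivative N' r) (at r)"
    using dp du dv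
  proof eventually_elim
    case (elim r)
    then show ?case unfolding N_def N'_def
      by (intro DERIV_add DERIV_cmult has_real_derivative_norm_sq)
  qed
  have dG: "\<forall>\<^sub>F r in at_top. (G has_real_derivative G' r) (at r)"
    using dg by eventually_elim (unfold G_def G'_def, rule has_real_derivative_norm_sq)
  have \<delta>1: "0 < \<eta> / (16 * K\<^sup>2)" and \<delta>2: "0 < \<eta> / 16" using \<eta> K by auto
  have Nle: "\<forall>\<^sub>F r in at_top. N' r \<le> 2 / r * ((\<mu> + \<eta>) * N r + B * G r)"
    using pos p'[OF \<delta>1] u'[OF \<delta>2] v' kp ku kv[of \<Lambda>]
  proof eventually_elim
    case (elim r)
    have scale: "\<mu> / r * x\<^sup>2 + x * (e / r) = (\<mu> * x\<^sup>2 + x * e) / r" for x e \<mu> :: real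
      by (simp add: add_divide_distrib)
    have "p r \<bullet> p' r \<le> Re (kp r) * (norm (p r))\<^sup>2 + norm (p r) * (\<eta> / (16 * K\<^sup>2) * X r / r)"
      by (rule inner_perturbed_le(1)[OF elim(2)])
    also have "\<dots> \<le> \<mu> / r * (norm (p r))\<^sup>2 + norm (p r) * (\<eta> / (16 * K\<^sup>2) * X r / r)"
      using elim by (intro add_right_mono mult_right_mono) auto
    finally have 1: "p r \<bullet> p' r \<le> (\<mu> * (norm (p r))\<^sup>2 + norm (p r) * (\<eta> / (16 * K\<^sup>2) * X r)) / r"
      by (simp only: scale)
    let ?e = "\<eta> / 16 * X r + C * (norm (p r) + norm (v r) + norm (g r))"
    have "u r \<bullet> u' r \<le> Re (ku r) * (norm (u r))\<^sup>2 + norm (u r) * (?e / r)"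
      by (rule inner_perturbed_le(1)[OF elim(3)])
    also have "\<dots> \<le> \<mu> / r * (norm (u r))\<^sup>2 + norm (u r) * (?e / r)"
      using elim by (intro add_right_mono mult_right_mono) auto
    finally have 2: "u r \<bullet> u' r \<le> (\<mu> * (norm (u r))\<^sup>2 + norm (u r) * ?e) / r"
      by (simp only: scale)
    have "v r \<bullet> v' r \<le> Re (kv r) * (norm (v r))\<^sup>2 + norm (v r) * (C * X r / r)"
      by (rule inner_perturbed_le(1)[OF elim(4)])
    also have "\<dots> \<le> - \<Lambda> / r * (norm (v r))\<^sup>2 + norm (v r) * (C * X r / r)"
      using elim by (intro add_right_mono mult_right_mono) auto
    finally have 3: "v r \<bullet> v' r \<le> (- \<Lambda> * (norm (v r))\<^sup>2 + norm (v r) * (C * X r)) / r"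
      by (simp only: scale)
    have "N' r = 2 * (K\<^sup>2 * (p r \<bullet> p' r) + u r \<bullet> u' r + v r \<bullet> v' r)"
      by (simp add: N'_def)
    also have "\<dots> \<le> 2 * (K\<^sup>2 * ((\<mu> * (norm (p r))\<^sup>2 + norm (p r) * (\<eta> / (16 * K\<^sup>2) * X r)) / r)
       + (\<mu> * (norm (u r))\<^sup>2 + norm (u r) * ?e) / r
       + (- \<Lambda> * (norm (v r))\<^sup>2 + norm (v r) * (C * X r)) / r)"
      using 1 2 3 by (intro mult_left_mono add_mono) auto
    also have "\<dots> = 2 / r * (K\<^sup>2 * (\<mu> * (norm (p r))\<^sup>2 + norm (p r) * (\<eta> / (16 * K\<^sup>2) * X r))
       + (\<mu> * (norm (u r))\<^sup>2 + norm (u r) * ?e)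
       + (- \<Lambda> * (norm (v r))\<^sup>2 + norm (v r) * (C * X r)))"
      by (simp add: add_divide_distrib diff_divide_distrib ring_distribs mult.assoc)
    also have "\<dots> \<le> 2 / r * ((\<mu> + \<eta>) * N r + B * G r)"
      unfolding N_def G_def using elim(1) \<eta> C K
      by (intro mult_left_mono energy_quadratic_bound) (auto simp: \<Lambda>_def B_def X_def)
    finally show ?case .
  qed
  \<comment> \<open>The cone argument asks for a nonnegative coefficient, so it receives this weaker
    form. The sharp one, with a possibly negative \<open>\<mu> + \<eta>\<close>, is kept for the
    rate in the decaying case.\<close>
  have NleA: "\<forall>\<^sub>F r in at_top. N' r \<le> 2 / r * (A * N r + B * G r)"
    using pos Nle
  proof eventually_elim
    case (elim r)
    have "(\<mu> + \<eta>) * N r \<le> A * N r" unfolding A_def by (intro mult_right_mono N0) auto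
    then have "2 / r * ((\<mu> + \<eta>) * N r + B * G r) \<le> 2 / r * (A * N r + B * G r)"
      using elim by (intro mult_left_mono) auto
    with elim show ?case by linarith
  qed
  have Gge: "\<forall>\<^sub>F r in at_top. 2 / r * (M * G r - N r) \<le> G' r" for M
    using pos g' kg[of "M + C + 3 * C\<^sup>2"]
  proof eventually_elim
    case (elim r)
    define \<Lambda>' where "\<Lambda>' = M + C + 3 * C\<^sup>2"
    have w: "C * (norm (g r) * y) \<le> C\<^sup>2 * (norm (g r))\<^sup>2 + y\<^sup>2" for y
      using mult_le_weighted_squares[of 1 C y "norm (g r)"] by (simp add: mult_ac)
    have K2: "1 \<le> K\<^sup>2" using K by simp
    have pN: "(norm (p r))\<^sup>2 \<le> K\<^sup>2 * (norm (p r))\<^sup>2"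
      using mult_right_mono[OF K2, of "(norm (p r))\<^sup>2"] by simp
    have "M * G r - N r \<le> \<Lambda>' * (norm (g r))\<^sup>2 - norm (g r) * (C * X r)"
      using w[of "norm (p r)"] w[of "norm (u r)"] w[of "norm (v r)"] pN
      by (simp add: \<Lambda>'_def G_def N_def X_def algebra_simps power2_eq_square)
    then have "2 / r * (M * G r - N r) \<le> 2 / r * (\<Lambda>' * (norm (g r))\<^sup>2 - norm (g r) * (C * X r))"
      using elim(1) by (intro mult_left_mono) auto
    also have "\<dots> = 2 * (\<Lambda>' / r * (norm (g r))\<^sup>2 - norm (g r) * (C * X r / r))"
      by (simp add: right_diff_distrib diff_divide_distrib mult_ac)
    also have "\<dots> \<le> 2 * (Re (kg r) * (norm (g r))\<^sup>2 - norm (g r) * (C * X r / r))"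
      using elim(3) unfolding \<Lambda>'_def by (intro mult_left_mono diff_right_mono mult_right_mono) auto
    also have "\<dots> \<le> G' r"
      unfolding G'_def using inner_perturbed_le(2)[OF elim(2)] by simp
    finally show ?case .
  qed
  \<comment> \<open>Chosen so that outside the cone \<open>B * G r\<close> is at most
    \<open>\<eta> * N r\<close>, which makes the total rate \<mu> + 2 \<eta> =
    \<open>\<mu>'\<close>.\<close>
  define \<epsilon> where "\<epsilon> = \<eta> / (B + 1)"
  have \<epsilon>: "0 < \<epsilon>" "B * \<epsilon> \<le> \<eta>" using \<eta> B by (auto simp: \<epsilon>_def field_simps)
  have "0 \<le> A" using \<eta> by (simp add: A_def)
  from cone_dichotomy[OF dN dG N0 G0 \<open>0 \<le> A\<close> B \<epsilon>(1) zero_le_power2[of \<theta>] NleA Gge]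
  consider (grow) c where "c > 0" "\<forall>\<^sub>F r in at_top. c * r\<^sup>2 \<le> G r \<and> \<theta>\<^sup>2 * N r \<le> G r"
    | (decay) "\<forall>\<^sub>F r in at_top. G r \<le> \<epsilon> * N r" by blast
  then show ?thesis
  proof cases
    case grow
    have "\<forall>\<^sub>F r in at_top. sqrt c * r \<le> norm (g r) \<and>
            \<theta> * norm (p r) \<le> norm (g r) \<and> \<theta> * norm (u r) \<le> norm (g r) \<and> \<theta> * norm (v r) \<le> norm (g r)"
      using grow(2) pos
    proof eventually_elim
      case (elim r)
      have N: "(norm (p r))\<^sup>2 \<le> N r" "(norm (u r))\<^sup>2 \<le> N r" "(norm (v r))\<^sup>2 \<le> N r"
      proof -
        have K2: "1 \<le> K\<^sup>2" using K by simp
        have pN: "(norm (p r))\<^sup>2 \<le> K\<^sup>2 * (norm (p r))\<^sup>2"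
          using mult_right_mono[OF K2, of "(norm (p r))\<^sup>2"] by simp
        then show "(norm (p r))\<^sup>2 \<le> N r" "(norm (u r))\<^sup>2 \<le> N r" "(norm (v r))\<^sup>2 \<le> N r"
          unfolding N_def using zero_le_power2[of "norm (u r)"] zero_le_power2[of "norm (v r)"]
            zero_le_power2[of "norm (p r)"] by linarith+
      qed
      have "\<theta> * x \<le> norm (g r)" if "x\<^sup>2 \<le> N r" for x
      proof (rule power2_le_imp_le)
        have "(\<theta> * x)\<^sup>2 \<le> \<theta>\<^sup>2 * N r" using that by (simp add: power_mult_distrib mult_left_mono)
        with elim show "(\<theta> * x)\<^sup>2 \<le> (norm (g r))\<^sup>2" by (simp add: G_def)
      qed simp
      moreover have "sqrt c * r \<le> norm (g r)"
      proof (rule power2_le_imp_le)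
        show "(sqrt c * r)\<^sup>2 \<le> (norm (g r))\<^sup>2"
          using elim(1) grow(1) by (simp add: power_mult_distrib G_def)
      qed simp
      ultimately show ?case using N by blast
    qed
    then show ?thesis using grow(1) real_sqrt_gt_0_iff by blast
  next
    case decay
    have "\<forall>\<^sub>F r in at_top. r > 0 \<and> (N has_real_derivative N' r) (at r) \<and> N' r \<le> 2 * \<mu>' / r * N r \<and> G r \<le> \<epsilon> * N r"
      using pos dN Nle decay
    proof eventually_elim
      case (elim r)
      have "B * G r \<le> B * (\<epsilon> * N r)" using elim B by (intro mult_left_mono) auto
      also have "\<dots> \<le> \<eta> * N r" using \<epsilon>(2) N0[of r] by (simp add: mult_right_mono flip: mult.assoc)
      finally have "(\<mu> + \<eta>) * N r + B * G r \<le> \<mu>' * N r" by (simp add: \<eta>_def field_simps)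
      then have "2 / r * ((\<mu> + \<eta>) * N r + B * G r) \<le> 2 / r * (\<mu>' * N r)"
        using elim by (intro mult_left_mono) auto
      with elim show ?case by simp
    qed
    then obtain a where a: "\<And>r. r \<ge> a \<Longrightarrow> r > 0 \<and> (N has_real_derivative N' r) (at r) \<and>
        N' r \<le> 2 * \<mu>' / r * N r \<and> G r \<le> \<epsilon> * N r"
      by (auto simp: eventually_at_top_linorder)
    define E where "E = N a * a powr (- 2 * \<mu>')"
    have E0: "0 \<le> E" by (simp add: E_def N0)
    have NE: "N r \<le> E * r powr (2 * \<mu>')" if "r \<ge> a" for r
    proof -
      \<comment> \<open>The comparison lemma bounds from below and imposes no sign on its function,
        so applying it to -N bounds N from above.\<close>
      have "- N a * (r / a) powr (2 * \<mu>') \<le> - N r"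
        using that a by (intro power_gronwall[where f' = "\<lambda>r. - N' r"]) (auto intro: DERIV_minus)
      then show ?thesis using a[of a] a[OF that]
        by (simp add: E_def powr_divide powr_minus field_simps)
    qed
    define F where "F = sqrt E * (3 + sqrt \<epsilon>)"
    have "X r \<le> F * r powr \<mu>'" if "r \<ge> a" for r
    proof -
      have r: "r > 0" using a that by blast
      have sN: "sqrt (N r) \<le> sqrt E * r powr \<mu>'"
      proof -
        have "sqrt (N r) \<le> sqrt (E * r powr (2 * \<mu>'))" using NE[OF that] by simp
        also have "\<dots> = sqrt E * sqrt ((r powr \<mu>')\<^sup>2)"
          using r by (simp add: real_sqrt_mult power2_eq_square flip: powr_add)
        finally show ?thesis by simp
      qed
      have K2: "1 \<le> K\<^sup>2" using K by simp
      have pN: "(norm (p r))\<^sup>2 \<le> K\<^sup>2 * (norm (p r))\<^sup>2"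
        using mult_right_mono[OF K2, of "(norm (p r))\<^sup>2"] by simp
      then have "(norm (p r))\<^sup>2 \<le> N r" "(norm (u r))\<^sup>2 \<le> N r" "(norm (v r))\<^sup>2 \<le> N r"
        unfolding N_def using zero_le_power2[of "norm (u r)"] zero_le_power2[of "norm (v r)"]
            zero_le_power2[of "norm (p r)"] by linarith+
      then have "norm (p r) \<le> sqrt (N r)" "norm (u r) \<le> sqrt (N r)" "norm (v r) \<le> sqrt (N r)"
        by (simp_all add: real_le_rsqrt)
      moreover have "norm (g r) \<le> sqrt (\<epsilon> * N r)"
        using a[OF that] by (simp add: real_le_rsqrt G_def)
      ultimately have "X r \<le> sqrt (N r) * (3 + sqrt \<epsilon>)"
        by (simp add: X_def real_sqrt_mult algebra_simps)
      also have "\<dots> \<le> sqrt E * r powr \<mu>' * (3 + sqrt \<epsilon>)"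
        using sN \<epsilon> by (intro mult_right_mono) auto
      finally show ?thesis by (simp add: F_def mult_ac)
    qed
    then have "\<forall>\<^sub>F r in at_top. X r \<le> F * r powr \<mu>'"
      unfolding eventually_at_top_linorder by blast
    then show ?thesis by blast
  qed
qed

section \<open>Algebraic decay of profiles\<close>

lemma hl_derivs_has_vector_derivative:
  assumes "hl_Ck k S" "j < k" "0 \<le> r"
  shows "(hl_derivs j S has_vector_derivative hl_derivs (Suc j) S r) (at r within {0..})"
  using assms by (simp add: hl_Ck_def hl_deriv_def vector_derivative_works)

lemma hl_derivs_has_vector_derivative_at:
  assumes "hl_Ck k S" "j < k" "0 < r"
  shows "(hl_derivs j S has_vector_derivative hl_derivs (Suc j) S r) (at r)"
proof -
  have "at r within {0..} = at r" using assms(3) by (intro at_within_interior) (simp add: interior_Ici)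
  then show ?thesis using hl_derivs_has_vector_derivative[of k S j r] assms by simp
qed

text \<open>The third root is -\<i>, the oscillating mode. The two sum identities say that the three
  roots and their squares each add up to 0, which is what the inversion of the mode transformation
  needs.\<close>

lemma cube_roots_of_ii:
  obtains wg wv :: complex
  where "wg ^ 3 = \<i>" "wv ^ 3 = \<i>" "wg + wv = \<i>" "wg\<^sup>2 + wv\<^sup>2 = 1"
    "norm wg = 1" "norm wv = 1" "Re wg > 0" "Re wv < 0"
proof
  show "Complex (sqrt 3 / 2) (1 / 2) ^ 3 = \<i>" "Complex (- (sqrt 3 / 2)) (1 / 2) ^ 3 = \<i>"
    "Complex (sqrt 3 / 2) (1 / 2) + Complex (- (sqrt 3 / 2)) (1 / 2) = \<i>"
    "(Complex (sqrt 3 / 2) (1 / 2))\<^sup>2 + (Complex (- (sqrt 3 / 2)) (1 / 2))\<^sup>2 = 1"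
    by (simp_all add: complex_eq_iff power3_eq_cube power2_eq_square)
  show "norm (Complex (sqrt 3 / 2) (1 / 2)) = 1" "norm (Complex (- (sqrt 3 / 2)) (1 / 2)) = 1"
    by (simp_all add: cmod_def power_divide)
qed auto

text \<open>
  \<open>lam\<close> is the WKB frequency \<open>(a\<rho>)\<^bsup>1/3\<^esup>\<close>, and \<open>s0, \<dots>, s3\<close> are
  \<open>lam\<^sup>3 S, lam\<^sup>2 S', lam S'', S'''\<close>, which have the same size in an oscillating mode. \<open>W w\<close> is
  the left eigenvector for the mode \<open>w\<close>, and \<open>P\<close> the one for the eigenvalue \<open>0\<close>. The correction
  \<open>c q s2\<close> in \<open>P\<close> removes the coupling of \<open>P\<close> to \<open>W\<close> at order \<open>1/\<rho>\<close>. The numbers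
  \<open>Re m0\<close> and \<open>Re m1\<close> are the algebraic growth rates of \<open>P\<close> and \<open>W (-\<i>)\<close>.
\<close>

locale decaying_profile =
  fixes d :: nat and \<sigma> \<nu> \<kappa> :: real and S :: "real \<Rightarrow> complex"
  assumes sol: "profile_solution d \<sigma> \<nu> \<kappa> S" and \<kappa>: "0 < \<kappa>" and \<sigma>: "0 < \<sigma>"
begin

definition a :: real where "a = \<kappa> ^ 4 / 4"
definition lam :: "real \<Rightarrow> real" where "lam r = (a * r) powr (1 / 3)"
definition q :: "real \<Rightarrow> real" where "q r = 1 / (r * lam r)"
definition e :: real where "e = (real d - 1) * (real d - 3)"
definition m0 :: complex where "m0 = of_real (1 - 2 / \<sigma>) - \<i> * of_real (\<nu> / a)"
definition c :: complex where "c = m0 + of_real (2 * (real d - 1))"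
definition m1 :: complex where "m1 = (of_real (4 - 2 * real d) - m0) / 3"

definition s0 :: "real \<Rightarrow> complex" where "s0 r = of_real (a * r) * S r"
definition s1 :: "real \<Rightarrow> complex" where "s1 r = of_real ((lam r)\<^sup>2) * hl_derivs 1 S r"
definition s2 :: "real \<Rightarrow> complex" where "s2 r = of_real (lam r) * hl_derivs 2 S r"
definition s3 :: "real \<Rightarrow> complex" where "s3 r = hl_derivs 3 S r"
definition W :: "complex \<Rightarrow> real \<Rightarrow> complex" where "W w r = w\<^sup>2 * s1 r + w * s2 r + s3 r"
definition P :: "real \<Rightarrow> complex" where "P r = s3 r - \<i> * s0 r + c * of_real (q r) * s2 r"
definition E :: "real \<Rightarrow> complex" where
  "E r = of_real (norm (S r) powr (2 * \<sigma>) / a) * s0 r - of_real (e * q r) * s2 r + of_real (e * (q r)\<^sup>2) * s1 r"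

lemma a: "0 < a" using \<kappa> by (simp add: a_def)

lemma lam_pos: "0 < r \<Longrightarrow> 0 < lam r" using a by (simp add: lam_def)

lemma lam_cubed: "0 < r \<Longrightarrow> lam r ^ 3 = a * r"
  using a by (simp add: lam_def powr_power)

lemma lam_deriv: "0 < r \<Longrightarrow> (lam has_real_derivative lam r / (3 * r)) (at r)"
proof -
  assume r: "0 < r"
  have "(lam has_real_derivative 1 / 3 * (a * r) powr (1 / 3 - 1) * a) (at r)"
    unfolding lam_def[abs_def] using a r by (auto intro!: derivative_eq_intros)
  also have "1 / 3 * (a * r) powr (1 / 3 - 1) * a = lam r / (3 * r)"
  proof -
    have "(a * r) powr (1 / 3 - 1) = (a * r) powr (1 / 3) / (a * r)"
      using a r by (subst powr_diff) simp
    then show ?thesis using a r by (simp add: lam_def field_simps)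
  qed
  finally show ?thesis .
qed

lemma rlam_at_top: "filterlim (\<lambda>r. r * lam r) at_top at_top"
proof -
  have "filterlim (\<lambda>r::real. r powr (1 / 3)) at_top at_top"
    by (rule real_powr_at_top) simp
  then have "filterlim (\<lambda>r. a powr (1 / 3) * r powr (1 / 3)) at_top at_top"
    using a by (intro filterlim_tendsto_pos_mult_at_top[OF tendsto_const]) auto
  moreover have "\<forall>\<^sub>F r in at_top. a powr (1 / 3) * r powr (1 / 3) = lam r"
    using eventually_ge_at_top[of 0] by eventually_elim (use a in \<open>simp add: lam_def powr_mult\<close>)
  ultimately have "filterlim lam at_top at_top"
    by (rule filterlim_cong[THEN iffD1, OF refl refl, rotated])
  then show ?thesis by (intro filterlim_at_top_mult_at_top filterlim_ident)
qed

lemma q_tendsto: "(q \<longlongrightarrow> 0) at_top"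
  unfolding q_def[abs_def]
  by (rule tendsto_divide_0[OF tendsto_const filterlim_at_top_imp_at_infinity[OF rlam_at_top]])

lemma q_pos: "0 < r \<Longrightarrow> 0 < q r" using lam_pos by (simp add: q_def)

lemma derivs:
  assumes "0 < r"
  shows "(S has_vector_derivative hl_derivs 1 S r) (at r)"
    "(hl_derivs 1 S has_vector_derivative hl_derivs 2 S r) (at r)"
    "(hl_derivs 2 S has_vector_derivative hl_derivs 3 S r) (at r)"
    "(hl_derivs 3 S has_vector_derivative hl_derivs 4 S r) (at r)"
proof -
  have "hl_Ck 4 S" using sol by (simp add: profile_solution_def)
  from hl_derivs_has_vector_derivative_at[OF this _ assms]
  show "(S has_vector_derivative hl_derivs 1 S r) (at r)"
    "(hl_derivs 1 S has_vector_derivative hl_derivs 2 S r) (at r)"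
    "(hl_derivs 2 S has_vector_derivative hl_derivs 3 S r) (at r)"
    "(hl_derivs 3 S has_vector_derivative hl_derivs 4 S r) (at r)"
    by (force simp: numeral_eq_Suc)+
qed

text \<open>This is the profile equation times \<rho>, with the leading balance S'''' ~ \<i> lam^3
  S' moved to the left. The number \<open>m0\<close> is chosen so that
  \<open>\<i> * (1 - m0) * a\<close> is the full coefficient \<i> a 2/\<sigma> - \<nu> of S. All
  terms with vanishing relative weight are collected in \<open>E\<close>.\<close>

lemma fourth_derivative:
  assumes r: "0 < r"
  shows "of_real r * (hl_derivs 4 S r - \<i> * of_real (lam r ^ 3) * hl_derivs 1 S r) =
    \<i> * (1 - m0) * s0 r - of_real (2 * (real d - 1)) * s3 r + E r"
proof -
  define V where "V = norm (S r) powr (2 * \<sigma>)"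
  define D where "D = real d - 1"
  define S1 where "S1 = hl_derivs 1 S r"
  define S2 where "S2 = hl_derivs 2 S r"
  define S3 where "S3 = hl_derivs 3 S r"
  define S4 where "S4 = hl_derivs 4 S r"
  define R where "R = complex_of_real r"
  have R: "R \<noteq> 0" using r by (simp add: R_def)
  have ode: "S4 = - of_real \<nu> * S r + \<i> * of_real a * (of_real (2 / \<sigma>) * S r + R * S1)
      - of_real (2 * D) / R * S3 - of_real e / R\<^sup>2 * S2 + of_real e / R^3 * S1 + of_real V * S r"
    using sol r unfolding profile_solution_def radial_biharmonic_def V_def S1_def S2_def S3_def S4_def R_def a_def[symmetric] e_def[symmetric] D_def
    by (simp add: algebra_simps)
  have l: "lam r \<noteq> 0" using lam_pos[OF r] by simp
  have q2: "of_real (e * q r) * s2 r = of_real e / R * S2"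
    using r l by (simp add: q_def s2_def S2_def R_def field_simps)
  have q1: "of_real (e * (q r)\<^sup>2) * s1 r = of_real e / R\<^sup>2 * S1"
    using r l by (simp add: q_def s1_def S1_def R_def field_simps power2_eq_square)
  have q0: "of_real (V / a) * s0 r = of_real V * R * S r"
    using a by (simp add: s0_def R_def field_simps)
  have n: "\<i> * (1 - m0) * s0 r = (\<i> * of_real a * of_real (2 / \<sigma>) - of_real \<nu>) * R * S r"
    using a by (simp add: m0_def s0_def R_def field_simps)
  have "R * (S4 - \<i> * (of_real a * R) * S1) = (\<i> * of_real a * of_real (2 / \<sigma>) - of_real \<nu>) * R * S r
      - of_real (2 * D) * S3 + (of_real V * R * S r - of_real e / R * S2 + of_real e / R\<^sup>2 * S1)"
    unfolding ode using R by (simp add: field_simps power2_eq_square power3_eq_cube)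
  then show ?thesis
    unfolding E_def V_def[symmetric] q0 q1 q2 n s3_def lam_cubed[OF r]
    by (simp add: R_def D_def S1_def S3_def S4_def)
qed

section \<open>Equations of the modes and inversion of the mode transformation\<close>

definition P' :: "real \<Rightarrow> complex" where
  "P' r = m0 / of_real r * P r + (E r - (1 + m0) * c * of_real (q r) * s2 r) / of_real r"

definition W' :: "complex \<Rightarrow> real \<Rightarrow> complex" where
  "W' w r = w * of_real (lam r) * W w r + (2 / 3 * w\<^sup>2 * s1 r + 1 / 3 * w * s2 r
     + \<i> * (1 - m0) * s0 r - of_real (2 * (real d - 1)) * s3 r + E r) / of_real r"

lemma s0_eq: "s0 r = - \<i> * (s3 r - P r + c * of_real (q r) * s2 r)"
  by (simp add: P_def algebra_simps)

text \<open>By w^3 = \<i> the leading terms of the derivative recombine into w lam W. The fractions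
  2/3 and 1/3 come from differentiating the weights lam^2 and lam, as lam' = lam/(3r).\<close>

lemma W_deriv:
  assumes r: "0 < r" and w: "w ^ 3 = \<i>"
  shows "(W w has_vector_derivative W' w r) (at r)"
proof -
  note lv = lam_deriv[OF r]
  have l2: "((\<lambda>r. (lam r)\<^sup>2) has_real_derivative 2 * (lam r)\<^sup>2 / (3 * r)) (at r)"
    using DERIV_power[OF lam_deriv[OF r], of 2] r by (simp add: power2_eq_square mult_ac)
  define L where "L = complex_of_real (lam r)"
  define R where "R = complex_of_real r"
  have R: "R \<noteq> 0" using r by (simp add: R_def)
  define Z where "Z = \<i> * (1 - m0) * s0 r - of_real (2 * (real d - 1)) * s3 r + E r"
  have four: "hl_derivs 4 S r = \<i> * L ^ 3 * hl_derivs 1 S r + Z / R"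
    using fourth_derivative[OF r] R by (simp add: Z_def L_def R_def field_simps)
  have "(W w has_vector_derivative
      w\<^sup>2 * (of_real ((lam r)\<^sup>2) * hl_derivs 2 S r + of_real (2 * (lam r)\<^sup>2 / (3 * r)) * hl_derivs 1 S r)
      + w * (of_real (lam r) * hl_derivs 3 S r + of_real (lam r / (3 * r)) * hl_derivs 2 S r)
      + hl_derivs 4 S r) (at r)"
    unfolding W_def[abs_def] s1_def s2_def s3_def
    by (intro has_vector_derivative_add has_vector_derivative_mult_right has_vector_derivative_mult
        has_vector_derivative_of_real derivs[OF r] lv l2)
  also have "w\<^sup>2 * (of_real ((lam r)\<^sup>2) * hl_derivs 2 S r + of_real (2 * (lam r)\<^sup>2 / (3 * r)) * hl_derivs 1 S r)
      + w * (of_real (lam r) * hl_derivs 3 S r + of_real (lam r / (3 * r)) * hl_derivs 2 S r)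
      + hl_derivs 4 S r = W' w r"
  proof -
    have "W' w r = w * L * (w\<^sup>2 * (L\<^sup>2 * hl_derivs 1 S r) + w * (L * hl_derivs 2 S r) + hl_derivs 3 S r)
       + (2 / 3 * w\<^sup>2 * (L\<^sup>2 * hl_derivs 1 S r) + 1 / 3 * w * (L * hl_derivs 2 S r) + Z) / R"
      by (simp add: W'_def W_def Z_def L_def R_def s1_def s2_def s3_def algebra_simps)
    also have "\<dots> = w ^ 3 * L ^ 3 * hl_derivs 1 S r + w\<^sup>2 * L\<^sup>2 * hl_derivs 2 S r + w * L * hl_derivs 3 S r
       + 2 / 3 * w\<^sup>2 * L\<^sup>2 * hl_derivs 1 S r / R + 1 / 3 * w * L * hl_derivs 2 S r / R + Z / R"
      by (simp add: add_divide_distrib algebra_simps power2_eq_square power3_eq_cube)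
    finally show ?thesis
      unfolding four w by (simp add: L_def R_def algebra_simps add_divide_distrib)
  qed
  finally show ?thesis .
qed

text \<open>Without its correction the mode would satisfy r P' = m0 P - c \<open>s3\<close> + E, and
  \<open>s3\<close> contains the W modes at full size. Differentiating the correction c S''/r yields
  c S'''/r, which cancels this term. The rest carries a factor \<open>q\<close> or lies in
  \<open>E\<close>.\<close>

lemma P_deriv:
  assumes r: "0 < r"
  shows "(P has_vector_derivative P' r) (at r)"
proof -
  define R where "R = complex_of_real r"
  have R: "R \<noteq> 0" using r by (simp add: R_def)
  have dar: "((\<lambda>r. a * r) has_real_derivative a) (at r)" by (rule DERIV_cmult_Id)
  have dir: "((\<lambda>r::real. 1 / r) has_real_derivative - 1 / r\<^sup>2) (at r)"
    using DERIV_inverse[of r UNIV] r by (simp add: inverse_eq_divide power2_eq_square)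
  \<comment> \<open>Since \<open>q x * s2 x\<close> is S''/x, the correction can be differentiated
    without a derivative of \<open>lam\<close>.\<close>
  have PQ: "s3 x - \<i> * s0 x + c * (of_real (1 / x) * hl_derivs 2 S x) = P x" if "x > 0" for x
    using lam_pos[OF that] that by (simp add: P_def s2_def q_def)
  have "((\<lambda>r. s3 r - \<i> * s0 r + c * (of_real (1 / r) * hl_derivs 2 S r)) has_vector_derivative
      hl_derivs 4 S r - \<i> * (of_real (a * r) * hl_derivs 1 S r + of_real a * S r)
      + c * (of_real (1 / r) * hl_derivs 3 S r + of_real (- 1 / r\<^sup>2) * hl_derivs 2 S r)) (at r)"
    unfolding s0_def s3_def
    by (intro has_vector_derivative_add has_vector_derivative_diff has_vector_derivative_mult_right has_vector_derivative_mult
        has_vector_derivative_of_real derivs[OF r] dar dir)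
  then have "(P has_vector_derivative
      hl_derivs 4 S r - \<i> * (of_real (a * r) * hl_derivs 1 S r + of_real a * S r)
      + c * (of_real (1 / r) * hl_derivs 3 S r + of_real (- 1 / r\<^sup>2) * hl_derivs 2 S r)) (at r)"
    by (rule has_vector_derivative_transform_within_open[where S = "{0<..}"]) (use r PQ in auto)
  also have "hl_derivs 4 S r - \<i> * (of_real (a * r) * hl_derivs 1 S r + of_real a * S r)
      + c * (of_real (1 / r) * hl_derivs 3 S r + of_real (- 1 / r\<^sup>2) * hl_derivs 2 S r) = P' r" (is "?Y = _")
  proof -
    define Q where "Q = of_real (q r) * s2 r"
    have Q: "hl_derivs 2 S r / R = Q"
      using lam_pos[OF r] r by (simp add: Q_def q_def s2_def R_def)
    have "R * (hl_derivs 4 S r - \<i> * (of_real (a * r) * hl_derivs 1 S r + of_real a * S r)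
      + c * (of_real (1 / r) * hl_derivs 3 S r + of_real (- 1 / r\<^sup>2) * hl_derivs 2 S r))
      = R * (hl_derivs 4 S r - \<i> * of_real (lam r ^ 3) * hl_derivs 1 S r) - \<i> * s0 r + c * s3 r - c * (hl_derivs 2 S r / R)"
      using R unfolding lam_cubed[OF r] s0_def s3_def
      by (simp add: field_simps power2_eq_square R_def)
    also have "\<dots> = - \<i> * m0 * s0 r + m0 * s3 r + E r - c * Q"
      using fourth_derivative[OF r] by (simp add: R_def Q[unfolded R_def] c_def algebra_simps)
    also have "\<dots> = m0 * P r + (E r - (1 + m0) * c * of_real (q r) * s2 r)"
      by (simp add: s0_eq Q_def algebra_simps)
    finally have "R * ?Y = m0 * P r + (E r - (1 + m0) * c * of_real (q r) * s2 r)" .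
    then have "?Y = (m0 * P r + (E r - (1 + m0) * c * of_real (q r) * s2 r)) / R"
      using R by (metis nonzero_mult_div_cancel_left)
    then show ?thesis
      by (simp add: P'_def R_def add_divide_distrib)
  qed
  finally show ?thesis .
qed

text \<open>A discrete Fourier inversion over the cube roots of \<i>: the sum of w^k over the three
  roots vanishes unless 3 divides k, and the sum of w^3 is 3\<i>.\<close>

lemma mode_inversion:
  assumes wg: "wg ^ 3 = \<i>" and wv: "wv ^ 3 = \<i>" and s: "wg + wv = \<i>" and ss: "wg\<^sup>2 + wv\<^sup>2 = 1"
  shows "s1 r = - \<i> / 3 * (- \<i> * W (- \<i>) r + wg * W wg r + wv * W wv r)"
    and "s2 r = - \<i> / 3 * (- W (- \<i>) r + wg\<^sup>2 * W wg r + wv\<^sup>2 * W wv r)"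
    and "s3 r = (W (- \<i>) r + W wg r + W wv r) / 3"
proof -
  have 4: "wg ^ 4 + wv ^ 4 = -1"
  proof -
    have "wg ^ 4 + wv ^ 4 = wg ^ 3 * wg + wv ^ 3 * wv" by (simp add: eval_nat_numeral)
    also have "\<dots> = \<i> * (wg + wv)" by (simp add: wg wv distrib_left)
    finally show ?thesis by (simp add: s)
  qed
  have "- \<i> * W (- \<i>) r + wg * W wg r + wv * W wv r =
      (\<i> + wg ^ 3 + wv ^ 3) * s1 r + (wg\<^sup>2 + wv\<^sup>2 - 1) * s2 r + (wg + wv - \<i>) * s3 r"
    by (simp add: W_def power2_eq_square power3_eq_cube algebra_simps)
  then show "s1 r = - \<i> / 3 * (- \<i> * W (- \<i>) r + wg * W wg r + wv * W wv r)"
    by (simp add: wg wv s ss)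
  have "- W (- \<i>) r + wg\<^sup>2 * W wg r + wv\<^sup>2 * W wv r =
      (wg ^ 4 + wv ^ 4 + 1) * s1 r + (wg ^ 3 + wv ^ 3 + \<i>) * s2 r + (wg\<^sup>2 + wv\<^sup>2 - 1) * s3 r"
    by (simp add: W_def eval_nat_numeral algebra_simps)
  then show "s2 r = - \<i> / 3 * (- W (- \<i>) r + wg\<^sup>2 * W wg r + wv\<^sup>2 * W wv r)"
    by (simp add: wg wv 4 ss)
  have "W (- \<i>) r + W wg r + W wv r = (wg\<^sup>2 + wv\<^sup>2 - 1) * s1 r + (wg + wv - \<i>) * s2 r + 3 * s3 r"
    by (simp add: W_def power2_eq_square algebra_simps)
  then show "s3 r = (W (- \<i>) r + W wg r + W wv r) / 3"
    by (simp add: s ss)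
qed

text \<open>The upper bounds turn decay of the modes into decay of S. The lower bound on
  \<open>s0\<close> serves the opposite case: a dominant growing mode shows up in \<open>s3\<close>,
  hence in \<open>s0\<close>, hence in S itself.\<close>

lemma component_bounds:
  assumes wg: "wg ^ 3 = \<i>" "norm wg = 1" and wv: "wv ^ 3 = \<i>" "norm wv = 1" and s: "wg + wv = \<i>" and ss: "wg\<^sup>2 + wv\<^sup>2 = 1"
  shows "3 * norm (s1 r) \<le> norm (W (- \<i>) r) + norm (W wv r) + norm (W wg r)"
    and "3 * norm (s2 r) \<le> norm (W (- \<i>) r) + norm (W wv r) + norm (W wg r)"
    and "3 * norm (s3 r) \<le> norm (W (- \<i>) r) + norm (W wv r) + norm (W wg r)"
    and "norm (s0 r) \<le> norm (s3 r) + norm (P r) + norm c * \<bar>q r\<bar> * norm (s2 r)"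
    and "norm (s3 r) - norm (P r) - norm c * \<bar>q r\<bar> * norm (s2 r) \<le> norm (s0 r)"
proof -
  note inv = mode_inversion[OF wg(1) wv(1) s ss, of r]
  have tri: "norm (x + y + z) \<le> norm x + norm y + norm z" for x y z :: complex
    by (meson add_right_mono norm_triangle_ineq order_trans)
  show "3 * norm (s1 r) \<le> norm (W (- \<i>) r) + norm (W wv r) + norm (W wg r)"
    using tri[of "- \<i> * W (- \<i>) r" "wg * W wg r" "wv * W wv r"] wg wv
    by (simp add: inv(1) norm_mult norm_divide)
  show "3 * norm (s2 r) \<le> norm (W (- \<i>) r) + norm (W wv r) + norm (W wg r)"
    using tri[of "- W (- \<i>) r" "wg\<^sup>2 * W wg r" "wv\<^sup>2 * W wv r"] wg wv
    by (simp add: inv(2) norm_mult norm_divide norm_power)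
  show "3 * norm (s3 r) \<le> norm (W (- \<i>) r) + norm (W wv r) + norm (W wg r)"
    using tri[of "W (- \<i>) r" "W wg r" "W wv r"]
    by (simp add: inv(3) norm_divide)
  have n0: "norm (s0 r) = norm (s3 r - P r + c * of_real (q r) * s2 r)"
    by (simp add: s0_eq norm_mult)
  have nq: "norm (c * of_real (q r) * s2 r) = norm c * \<bar>q r\<bar> * norm (s2 r)"
    by (simp add: norm_mult)
  show "norm (s0 r) \<le> norm (s3 r) + norm (P r) + norm c * \<bar>q r\<bar> * norm (s2 r)"
    using tri[of "s3 r" "- P r" "c * of_real (q r) * s2 r"] unfolding n0 nq[symmetric] by simp
  show "norm (s3 r) - norm (P r) - norm c * \<bar>q r\<bar> * norm (s2 r) \<le> norm (s0 r)"
    using norm_triangle_ineq2[of "s3 r" "P r"] norm_diff_ineq[of "s3 r - P r" "c * of_real (q r) * s2 r"]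
    unfolding n0 nq[symmetric] by linarith
qed

text \<open>The right-hand side contains \<open>W (- \<i>)\<close> only through small terms, so
  \<open>m1\<close> has to be the exact diagonal coefficient. Expressing s1, s2, s3 by the modes,
  the derivatives of the weights contribute 2/9 + 1/9, and the remaining terms contribute (1 - m0)/3
  - 2(d - 1)/3. The coupling to \<open>P\<close> stays of order 1/r; the triangular structure allows
  it.\<close>

lemma oscillating_mode_remainder:
  assumes wg: "wg ^ 3 = \<i>" "norm wg = 1" and wv: "wv ^ 3 = \<i>" "norm wv = 1" and s: "wg + wv = \<i>" and ss: "wg\<^sup>2 + wv\<^sup>2 = 1"
    and r: "0 < r"
  shows "norm (W' (- \<i>) r - (- \<i> * of_real (lam r) + m1 / of_real r) * W (- \<i>) r)
    \<le> (norm (E r) + norm ((1 - m0) * c) * q r * norm (s2 r)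
        + (1 + norm (1 - m0) + norm (1 - m0 - of_real (2 * (real d - 1)))) * (norm (P r) + norm (W wv r) + norm (W wg r))) / r"
proof -
  note inv = mode_inversion[OF wg(1) wv(1) s ss, of r]
  define u where "u = W (- \<i>) r"
  define g where "g = W wg r"
  define v where "v = W wv r"
  define Q where "Q = (1 - m0) * c * of_real (q r) * s2 r"
  define k where "k = (1 - m0 - of_real (2 * (real d - 1))) / 3"
  have k3: "3 * k = 1 - m0 - of_real (2 * (real d - 1))" by (simp add: k_def)
  have m1k: "m1 = k + 1 / 3" by (simp add: m1_def k_def field_simps)
  have "W' (- \<i>) r - (- \<i> * of_real (lam r) + m1 / of_real r) * W (- \<i>) r =
      (- 2 / 3 * s1 r - 1 / 3 * \<i> * s2 r + \<i> * (1 - m0) * s0 r - of_real (2 * (real d - 1)) * s3 r + E r - m1 * u) / of_real r"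
    by (simp add: W'_def u_def algebra_simps add_divide_distrib diff_divide_distrib)
  also have "- 2 / 3 * s1 r - 1 / 3 * \<i> * s2 r + \<i> * (1 - m0) * s0 r - of_real (2 * (real d - 1)) * s3 r + E r - m1 * u
      = - 2 / 3 * s1 r - 1 / 3 * \<i> * s2 r + 3 * k * s3 r - m1 * u - (1 - m0) * P r + Q + E r"
    by (simp only: s0_eq k3 Q_def) (simp add: algebra_simps)
  also have "\<dots> = (2 / 9 * \<i> * wg - 1 / 9 * wg\<^sup>2 + k) * g + (2 / 9 * \<i> * wv - 1 / 9 * wv\<^sup>2 + k) * v
      - (1 - m0) * P r + Q + E r"
    unfolding inv m1k u_def[symmetric] g_def[symmetric] v_def[symmetric]
    by (simp add: algebra_simps)
  finally have eq: "W' (- \<i>) r - (- \<i> * of_real (lam r) + m1 / of_real r) * W (- \<i>) r = \<dots> / of_real r" .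
  define A where "A = 1 + norm (1 - m0) + 3 * norm k"
  have coef: "norm (2 / 9 * \<i> * w - 1 / 9 * w\<^sup>2 + k) \<le> A" if "norm w = 1" for w
  proof -
    have "norm (2 / 9 * \<i> * w - 1 / 9 * w\<^sup>2 + k) \<le> norm (2 / 9 * \<i> * w) + norm (1 / 9 * w\<^sup>2) + norm k"
      by (meson add_right_mono norm_triangle_ineq norm_triangle_ineq4 order_trans)
    also have "\<dots> \<le> A" using that by (simp add: A_def norm_mult norm_power)
    finally show ?thesis .
  qed
  have 1: "norm ((2 / 9 * \<i> * wg - 1 / 9 * wg\<^sup>2 + k) * g) \<le> A * norm g"
    "norm ((2 / 9 * \<i> * wv - 1 / 9 * wv\<^sup>2 + k) * v) \<le> A * norm v"
    "norm ((1 - m0) * P r) \<le> A * norm (P r)"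
    unfolding norm_mult using coef[OF wg(2)] coef[OF wv(2)]
    by (auto intro!: mult_right_mono simp: A_def)
  have 2: "norm Q = norm ((1 - m0) * c) * q r * norm (s2 r)"
    using q_pos[OF r] by (simp add: Q_def norm_mult)
  have tri5: "norm (x1 + x2 - x3 + x4 + x5) \<le> norm x1 + norm x2 + norm x3 + norm x4 + norm x5" for x1 x2 x3 x4 x5 :: complex
    using norm_triangle_ineq[of x1 x2] norm_triangle_ineq4[of "x1 + x2" x3] norm_triangle_ineq[of "x1 + x2 - x3" x4]
      norm_triangle_ineq[of "x1 + x2 - x3 + x4" x5] by linarith
  have "norm ((2 / 9 * \<i> * wg - 1 / 9 * wg\<^sup>2 + k) * g + (2 / 9 * \<i> * wv - 1 / 9 * wv\<^sup>2 + k) * v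
      - (1 - m0) * P r + Q + E r)
    \<le> A * norm g + A * norm v + A * norm (P r) + norm ((1 - m0) * c) * q r * norm (s2 r) + norm (E r)"
    by (rule order_trans[OF tri5]) (use 1 2 in linarith)
  also have "\<dots> = norm (E r) + norm ((1 - m0) * c) * q r * norm (s2 r) + A * (norm (P r) + norm v + norm g)"
    by (simp add: algebra_simps)
  also have "A = 1 + norm (1 - m0) + norm (1 - m0 - of_real (2 * (real d - 1)))"
    by (simp add: A_def k_def norm_divide)
  finally show ?thesis
    unfolding eq norm_divide using r by (simp add: divide_right_mono v_def g_def)
qed

section \<open>Smallness of the remainders and the decay estimate\<close>

lemma E_le: "norm (E r) \<le> (norm (S r) powr (2 * \<sigma>) / a + \<bar>e\<bar> * \<bar>q r\<bar> + \<bar>e\<bar> * (q r)\<^sup>2) * (norm (s0 r) + norm (s1 r) + norm (s2 r))"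
proof -
  have "norm (E r) \<le> norm (of_real (norm (S r) powr (2 * \<sigma>) / a) * s0 r) + norm (of_real (e * q r) * s2 r)
      + norm (of_real (e * (q r)\<^sup>2) * s1 r)"
    unfolding E_def by (meson add_right_mono norm_triangle_ineq norm_triangle_ineq4 order_trans)
  also have "\<dots> = norm (S r) powr (2 * \<sigma>) / a * norm (s0 r) + \<bar>e\<bar> * \<bar>q r\<bar> * norm (s2 r)
      + \<bar>e\<bar> * (q r)\<^sup>2 * norm (s1 r)"
    unfolding norm_mult norm_of_real using a by (simp add: abs_mult)
  also have "\<dots> \<le> (norm (S r) powr (2 * \<sigma>) / a + \<bar>e\<bar> * \<bar>q r\<bar> + \<bar>e\<bar> * (q r)\<^sup>2) * (norm (s0 r) + norm (s1 r) + norm (s2 r))"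
  proof -
    have dom: "x * A + y * B + z * C \<le> (x + y + z) * (A + C + B)" if "0 \<le> x" "0 \<le> y" "0 \<le> z" "0 \<le> A" "0 \<le> B" "0 \<le> C"
      for x y z A B C :: real
      using that by (simp add: algebra_simps)
    show ?thesis by (rule dom) (use a in auto)
  qed
  finally show ?thesis .
qed

lemma potential_tendsto: "((\<lambda>r. norm (S r) powr (2 * \<sigma>)) \<longlongrightarrow> 0) at_top"
proof -
  have "((\<lambda>r. norm (S r)) \<longlongrightarrow> 0) at_top"
    using sol by (auto simp: profile_solution_def intro: tendsto_norm_zero)
  then show ?thesis
    using \<sigma> by (intro tendsto_zero_powrI[where b = "2 * \<sigma>"]) auto
qed

lemma algebraic_decay:
  assumes \<gamma>1: "\<gamma> < 2 / \<sigma>" and \<gamma>2: "\<gamma> < (2 * real d - 2 / \<sigma>) / 3"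
  shows "\<exists>D. \<forall>\<^sub>F r in at_top. norm (S r) \<le> D * r powr (- \<gamma>)"
proof -
  obtain wg wv where wg: "wg ^ 3 = \<i>" "norm wg = 1" and wv: "wv ^ 3 = \<i>" "norm wv = 1"
    and s: "wg + wv = \<i>" and ss: "wg\<^sup>2 + wv\<^sup>2 = 1" and Rew: "Re wg > 0" "Re wv < 0"
    by (rule cube_roots_of_ii) auto
  define X where "X = (\<lambda>r. norm (P r) + norm (W (- \<i>) r) + norm (W wv r) + norm (W wg r))"
  have X_eq: "X r = norm (P r) + norm (W (- \<i>) r) + norm (W wv r) + norm (W wg r)" for r
    by (simp add: X_def)
  note comp = component_bounds[OF wg wv s ss]
  \<comment> \<open>One vanishing function for both neutral modes: the remainder of \<open>P\<close>
    carries the factor 1 + m0 and that of \<open>W (- \<i>)\<close> the factor 1 - m0, so both norms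
    are included.\<close>
  define h where "h = (\<lambda>r. (norm (S r) powr (2 * \<sigma>) / a + \<bar>e\<bar> * \<bar>q r\<bar> + \<bar>e\<bar> * (q r)\<^sup>2) * (4 + norm c)
      + (norm (1 - m0) + norm (1 + m0)) * norm c * q r)"
  have h: "(h \<longlongrightarrow> 0) at_top"
    unfolding h_def
    by (rule tendsto_eq_intros potential_tendsto q_tendsto a[THEN less_imp_neq, symmetric] refl | simp add: a[THEN less_imp_neq, symmetric])+
  have ev: "\<forall>\<^sub>F r in at_top. 0 < r \<and> 0 < q r \<and> q r \<le> 1 \<and> norm (s0 r) \<le> (2 + norm c) * X r \<and>
      norm (E r) + (norm (1 - m0) + norm (1 + m0)) * norm c * q r * norm (s2 r) \<le> h r * X r \<and>
      norm (s1 r) \<le> X r \<and> norm (s2 r) \<le> X r \<and> norm (s3 r) \<le> X r"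
    using eventually_gt_at_top[of 0] order_tendstoD(2)[OF q_tendsto zero_less_one]
  proof eventually_elim
    case (elim r)
    have q: "0 < q r" by (rule q_pos[OF elim(1)])
    have s: "norm (s1 r) \<le> X r" "norm (s2 r) \<le> X r" "norm (s3 r) + norm (P r) \<le> X r + X r" "norm (s3 r) \<le> X r"
      using comp(1,2,3)[of r] norm_ge_zero[of "P r"] norm_ge_zero[of "W (- \<i>) r"] norm_ge_zero[of "W wv r"]
        norm_ge_zero[of "W wg r"] unfolding X_def by linarith+
    have X0: "0 \<le> X r" by (simp add: X_def)
    have "norm c * \<bar>q r\<bar> * norm (s2 r) \<le> norm c * 1 * X r"
      using elim q s X0 by (intro mult_mono) auto
    then have s0: "norm (s0 r) \<le> (2 + norm c) * X r"
      using comp(4)[of r] s by (simp add: algebra_simps)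
    have "norm (E r) \<le> (norm (S r) powr (2 * \<sigma>) / a + \<bar>e\<bar> * \<bar>q r\<bar> + \<bar>e\<bar> * (q r)\<^sup>2) * ((4 + norm c) * X r)"
    proof (rule order_trans[OF E_le mult_left_mono])
      show "norm (s0 r) + norm (s1 r) + norm (s2 r) \<le> (4 + norm c) * X r"
        using s0 s by (simp add: algebra_simps)
      show "0 \<le> norm (S r) powr (2 * \<sigma>) / a + \<bar>e\<bar> * \<bar>q r\<bar> + \<bar>e\<bar> * (q r)\<^sup>2"
        using a by simp
    qed
    moreover have "(norm (1 - m0) + norm (1 + m0)) * norm c * q r * norm (s2 r) \<le> (norm (1 - m0) + norm (1 + m0)) * norm c * q r * X r"
      using q s by (intro mult_left_mono) auto
    ultimately have "norm (E r) + (norm (1 - m0) + norm (1 + m0)) * norm c * q r * norm (s2 r) \<le> h r * X r"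
      unfolding h_def by (simp add: distrib_right mult.assoc)
    with elim q s0 s show ?case by simp
  qed
  \<comment> \<open>These are the real parts of \<open>m0\<close> and \<open>m1\<close>. The modes
    have the size of \<open>s0 = a r S\<close>, so growth rates of modes are one larger than those
    of S, and the target exponent is 1 - \<gamma>.\<close>
  define \<mu> where "\<mu> = max (1 - 2 / \<sigma>) ((3 - 2 * real d + 2 / \<sigma>) / 3)"
  define C where "C = (1 + norm (1 - m0) + norm (1 - m0 - of_real (2 * (real d - 1))))
      + (2 + norm (1 - m0) * (2 + norm c) + \<bar>2 * (real d - 1)\<bar>)"
  have hev: "\<forall>\<^sub>F r in at_top. h r \<le> \<delta>" if "0 < \<delta>" for \<delta>
    using order_tendstoD(2)[OF h that] by eventually_elim simp
  have pos: "\<forall>\<^sub>F r in at_top. (0::real) < r" by (rule eventually_gt_at_top)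
  have Wrem: "\<forall>\<^sub>F r in at_top. norm (W' w r - w * of_real (lam r) * W w r) \<le> C * X r / r" if "norm w = 1" for w
    using ev hev[OF zero_less_one]
  proof eventually_elim
    case (elim r)
    have "norm (2 / 3 * w\<^sup>2 * s1 r + 1 / 3 * w * s2 r + \<i> * (1 - m0) * s0 r - of_real (2 * (real d - 1)) * s3 r + E r)
      \<le> norm (2 / 3 * w\<^sup>2 * s1 r) + norm (1 / 3 * w * s2 r) + norm (\<i> * (1 - m0) * s0 r) + norm (of_real (2 * (real d - 1)) * s3 r) + norm (E r)"
      by (meson add_right_mono norm_triangle_ineq norm_triangle_ineq4 order_trans)
    also have "\<dots> = 2 / 3 * norm (s1 r) + 1 / 3 * norm (s2 r) + norm (1 - m0) * norm (s0 r) + \<bar>2 * (real d - 1)\<bar> * norm (s3 r) + norm (E r)"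
      unfolding norm_mult norm_power that norm_of_real by (simp add: abs_mult)
    also have "\<dots> \<le> 2 / 3 * X r + 1 / 3 * X r + norm (1 - m0) * ((2 + norm c) * X r) + \<bar>2 * (real d - 1)\<bar> * X r + X r"
    proof (intro add_mono mult_left_mono)
      have X0: "0 \<le> X r" by (simp add: X_def)
      have "0 \<le> (norm (1 - m0) + norm (1 + m0)) * norm c * q r * norm (s2 r)" using elim by simp
      then have "norm (E r) \<le> h r * X r" using elim by linarith
      also have "\<dots> \<le> 1 * X r" using elim X0 by (intro mult_right_mono)
      finally show "norm (E r) \<le> X r" by simp
    qed (use elim in auto)
    also have "\<dots> = (2 + norm (1 - m0) * (2 + norm c) + \<bar>2 * (real d - 1)\<bar>) * X r" by (simp add: algebra_simps)
    also have "\<dots> \<le> C * X r" by (intro mult_right_mono) (simp_all add: C_def X_def)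
    finally show ?case
      using elim by (simp add: W'_def norm_divide divide_right_mono)
  qed
  have "(\<exists>k>0. \<forall>\<^sub>F r in at_top. k * r \<le> norm (W wg r) \<and>
            10 * norm (P r) \<le> norm (W wg r) \<and> 10 * norm (W (- \<i>) r) \<le> norm (W wg r) \<and> 10 * norm (W wv r) \<le> norm (W wg r)) \<or>
         (\<exists>D. \<forall>\<^sub>F r in at_top. norm (P r) + norm (W (- \<i>) r) + norm (W wv r) + norm (W wg r) \<le> D * r powr (1 - \<gamma>))"
  proof (rule dichotomy_system_decay[where p' = P' and u' = "W' (- \<i>)" and v' = "W' wv" and g' = "W' wg" and \<mu> = \<mu> and C = C
      and kp = "\<lambda>r. m0 / of_real r" and ku = "\<lambda>r. - \<i> * of_real (lam r) + m1 / of_real r"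
      and kv = "\<lambda>r. wv * of_real (lam r)" and kg = "\<lambda>r. wg * of_real (lam r)"]; (fold X_eq)?)
    show "\<forall>\<^sub>F r in at_top. (P has_vector_derivative P' r) (at r)"
      using pos by eventually_elim (rule P_deriv)
    show "\<forall>\<^sub>F r in at_top. (W (- \<i>) has_vector_derivative W' (- \<i>) r) (at r)"
      using pos by eventually_elim (rule W_deriv; simp add: power3_eq_cube)
    show "\<forall>\<^sub>F r in at_top. (W wv has_vector_derivative W' wv r) (at r)"
      using pos by eventually_elim (rule W_deriv; simp add: wv)
    show "\<forall>\<^sub>F r in at_top. (W wg has_vector_derivative W' wg r) (at r)"
      using pos by eventually_elim (rule W_deriv; simp add: wg)
    show "\<forall>\<^sub>F r in at_top. norm (P' r - m0 / of_real r * P r) \<le> \<delta> * X r / r" if "0 < \<delta>" for \<delta>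
      using ev hev[OF that]
    proof eventually_elim
      case (elim r)
      have X0: "0 \<le> X r" by (simp add: X_def)
      have "norm (E r - (1 + m0) * c * of_real (q r) * s2 r) \<le> norm (E r) + norm ((1 + m0) * c * of_real (q r) * s2 r)"
        by (rule norm_triangle_ineq4)
      also have "norm ((1 + m0) * c * of_real (q r) * s2 r) = norm (1 + m0) * norm c * q r * norm (s2 r)"
        using elim by (simp add: norm_mult)
      also have "norm (E r) + \<dots> \<le> norm (E r) + (norm (1 - m0) + norm (1 + m0)) * norm c * q r * norm (s2 r)"
        using elim by (intro add_left_mono mult_right_mono) auto
      also have "\<dots> \<le> h r * X r" using elim by simp
      also have "\<dots> \<le> \<delta> * X r" using elim X0 by (intro mult_right_mono)
      finally show ?case using elim by (simp add: P'_def norm_divide divide_right_mono)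
    qed
    show "\<forall>\<^sub>F r in at_top. norm (W' (- \<i>) r - (- \<i> * of_real (lam r) + m1 / of_real r) * W (- \<i>) r)
        \<le> (\<delta> * X r + C * (norm (P r) + norm (W wv r) + norm (W wg r))) / r" if "0 < \<delta>" for \<delta>
      using ev hev[OF that]
    proof eventually_elim
      case (elim r)
      have X0: "0 \<le> X r" by (simp add: X_def)
      have r: "0 < r" using elim by simp
      have "norm (E r) + norm ((1 - m0) * c) * q r * norm (s2 r) \<le> norm (E r) + (norm (1 - m0) + norm (1 + m0)) * norm c * q r * norm (s2 r)"
        using elim unfolding norm_mult by (intro add_left_mono mult_right_mono) auto
      also have "\<dots> \<le> h r * X r" using elim by simp
      also have "\<dots> \<le> \<delta> * X r" using elim X0 by (intro mult_right_mono)
      finally have "norm (E r) + norm ((1 - m0) * c) * q r * norm (s2 r) \<le> \<delta> * X r" .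
      then show ?case
        by (intro order_trans[OF oscillating_mode_remainder[OF wg wv s ss r]] divide_right_mono add_mono mult_right_mono)
          (use r in \<open>auto simp: C_def\<close>)
    qed
    show "\<forall>\<^sub>F r in at_top. norm (W' wv r - wv * of_real (lam r) * W wv r) \<le> C * X r / r"
      by (rule Wrem[OF wv(2)])
    show "\<forall>\<^sub>F r in at_top. norm (W' wg r - wg * of_real (lam r) * W wg r) \<le> C * X r / r"
      by (rule Wrem[OF wg(2)])
    show "\<forall>\<^sub>F r in at_top. Re (m0 / of_real r) \<le> \<mu> / r"
      using pos by eventually_elim (auto simp: m0_def \<mu>_def intro!: divide_right_mono)
    show "\<forall>\<^sub>F r in at_top. Re (- \<i> * of_real (lam r) + m1 / of_real r) \<le> \<mu> / r"
    proof -
      have "Re m1 = (3 - 2 * real d + 2 / \<sigma>) / 3" by (simp add: m1_def m0_def)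
      also have "\<dots> \<le> \<mu>" unfolding \<mu>_def by (rule max.cobounded2)
      finally have "Re m1 \<le> \<mu>" .
      then show ?thesis
        using pos by (elim eventually_mono) (auto intro!: divide_right_mono)
    qed
    have lamge: "\<forall>\<^sub>F r in at_top. \<Lambda> / r \<le> x * lam r" if "0 < x" for \<Lambda> x
      using pos rlam_at_top[unfolded filterlim_at_top, rule_format, of "\<Lambda> / x"]
      by eventually_elim (use that in \<open>simp add: field_simps\<close>)
    show "\<forall>\<^sub>F r in at_top. Re (wv * of_real (lam r)) \<le> - \<Lambda> / r" for \<Lambda>
      using lamge[of "- Re wv" \<Lambda>] Rew by simp (elim eventually_mono, simp)
    show "\<forall>\<^sub>F r in at_top. \<Lambda> / r \<le> Re (wg * of_real (lam r))" for \<Lambda>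
      using lamge[of "Re wg" \<Lambda>] Rew by simp
    show "\<mu> < 1 - \<gamma>" unfolding \<mu>_def max_less_iff_conj using \<gamma>1 \<gamma>2 by simp
    show "0 \<le> C" by (simp add: C_def)
  qed simp
  then consider (grow) k where "k > 0" "\<forall>\<^sub>F r in at_top. k * r \<le> norm (W wg r) \<and>
            10 * norm (P r) \<le> norm (W wg r) \<and> 10 * norm (W (- \<i>) r) \<le> norm (W wg r) \<and> 10 * norm (W wv r) \<le> norm (W wg r)"
    | (decay) D where "\<forall>\<^sub>F r in at_top. X r \<le> D * r powr (1 - \<gamma>)"
    unfolding X_def by blast
  then show ?thesis
  proof cases
    case grow
    have "((\<lambda>r. norm c * q r) \<longlongrightarrow> norm c * 0) at_top" by (intro tendsto_intros q_tendsto)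
    from order_tendstoD(2)[OF this, of "1 / 10"] have cq: "\<forall>\<^sub>F r in at_top. norm c * q r < 1 / 10" by simp
    have "(S \<longlongrightarrow> 0) at_top" using sol by (simp add: profile_solution_def)
    then have "\<forall>\<^sub>F r in at_top. norm (S r) < k / (10 * a)"
      using grow(1) a by (auto simp: tendsto_iff dist_norm)
    \<comment> \<open>The formula \<open>r \<noteq> r\<close> stands for falsity under the filter:
      every large r would give k r/10 < k r/10, because \<open>norm (S r)\<close> has dropped below
      k/(10 a).\<close>
    then have "\<forall>\<^sub>F r in at_top. r \<noteq> (r :: real)"
      using grow(2) cq ev
    proof eventually_elim
      case (elim r)
      have cs: "norm c * \<bar>q r\<bar> * norm (s2 r) \<le> 1 / 10 * norm (s2 r)"
        using elim by (intro mult_right_mono) auto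
      have W0: "W wg r = 3 * s3 r - W (- \<i>) r - W wv r"
        using mode_inversion(3)[OF wg(1) wv(1) s ss, of r] by (simp add: field_simps)
      have "norm (W wg r) \<le> norm (3 * s3 r) + norm (W (- \<i>) r) + norm (W wv r)"
        unfolding W0 by (meson add_right_mono norm_triangle_ineq4 order_trans)
      then have s3: "norm (W wg r) \<le> 3 * norm (s3 r) + norm (W (- \<i>) r) + norm (W wv r)"
        by (simp add: norm_mult)
      have g: "k * r \<le> norm (W wg r)" "10 * norm (P r) \<le> norm (W wg r)"
        "10 * norm (W (- \<i>) r) \<le> norm (W wg r)" "10 * norm (W wv r) \<le> norm (W wg r)"
        using elim by auto
      \<comment> \<open>This is where the factor 10 matters. Relative to the norm of
        \<open>W wg r\<close>, \<open>s3\<close> is at least (1 - 2/10)/3 = 4/15, \<open>P\<close>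
        is at most 1/10, and \<open>s2\<close> is at most 2/5, so the correction is at most 1/25.
        Finally 4/15 - 1/10 - 1/25 > 1/10.\<close>
      then have "1 / 10 * norm (W wg r) \<le> norm (s0 r)"
        using comp(2,5)[of r] s3 cs norm_ge_zero[of "W wg r"] by linarith
      with g(1) have "k * r / 10 \<le> norm (s0 r)" by linarith
      also have "\<dots> = a * r * norm (S r)" using elim a by (simp add: s0_def norm_mult)
      also have "\<dots> < a * r * (k / (10 * a))" using elim a by (intro mult_strict_left_mono) auto
      also have "\<dots> = k * r / 10" using a by simp
      finally show ?case by simp
    qed
    then show ?thesis by simp
  next
    case decay
    have "\<forall>\<^sub>F r in at_top. norm (S r) \<le> (2 + norm c) * D / a * r powr (- \<gamma>)"
      using decay ev
    proof eventually_elim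
      case (elim r)
      have "a * r * norm (S r) = norm (s0 r)" using elim a by (simp add: s0_def norm_mult)
      also have "\<dots> \<le> (2 + norm c) * X r" using elim by simp
      also have "\<dots> \<le> (2 + norm c) * (D * r powr (1 - \<gamma>))" using elim by (intro mult_left_mono) auto
      also have "r powr (1 - \<gamma>) = r * r powr (- \<gamma>)" using elim by (simp add: powr_diff powr_minus divide_inverse)
      finally have "r * (a * norm (S r)) \<le> r * ((2 + norm c) * D * r powr (- \<gamma>))"
        by (simp add: mult_ac)
      then have "a * norm (S r) \<le> (2 + norm c) * D * r powr (- \<gamma>)"
        using elim by (simp only: mult_le_cancel_left_pos)
      then show ?case using a by (simp add: field_simps)
    qed
    then show ?thesis by blast
  qed
qed

end

section \<open>Regularity of radial functions\<close>

text \<open>The function \<open>partial\<close> returns a value even where no derivative exists. A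
  relation carries existence and value together through the calculus rules.\<close>

definition has_partial :: "'a::euclidean_space \<Rightarrow> ('a \<Rightarrow> complex) \<Rightarrow> complex \<Rightarrow> 'a \<Rightarrow> bool" where
  "has_partial b f f' x \<longleftrightarrow> ((\<lambda>h. f (x + h *\<^sub>R b)) has_vector_derivative f') (at 0)"

lemma partial_eqI: "has_partial b f f' x \<Longrightarrow> partial b f x = f'"
  by (simp add: has_partial_def partial_def vector_derivative_at)

lemma has_partial_differentiable:
  "has_partial b f f' x \<Longrightarrow> (\<lambda>h. f (x + h *\<^sub>R b)) differentiable (at 0)"
  by (auto simp: has_partial_def intro: differentiableI_vector)

lemma has_partial_const: "has_partial b (\<lambda>x. c) 0 x"
  by (simp add: has_partial_def)

lemma has_partial_add:
  "has_partial b f f' x \<Longrightarrow> has_partial b g g' x \<Longrightarrow> has_partial b (\<lambda>x. f x + g x) (f' + g') x"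
  by (auto simp: has_partial_def intro: has_vector_derivative_add)

lemma has_partial_mult:
  "has_partial b f f' x \<Longrightarrow> has_partial b g g' x \<Longrightarrow> has_partial b (\<lambda>x. f x * g x) (f x * g' + f' * g x) x"
  unfolding has_partial_def by (drule (1) has_vector_derivative_mult) simp

lemma has_partial_inner:
  "has_partial b (\<lambda>x. of_real (x \<bullet> c)) (of_real (b \<bullet> c)) x"
proof -
  have "((\<lambda>h. (x + h *\<^sub>R b) \<bullet> c) has_real_derivative b \<bullet> c) (at 0)"
    unfolding inner_add_left inner_scaleR_left by (auto intro!: derivative_eq_intros)
  then show ?thesis
    unfolding has_partial_def by (rule has_vector_derivative_of_real)
qed

text \<open>The derivative is written as a coordinate times the radial function \<Phi>'/r, so that
  the product rule and this lemma apply again to the next derivative.\<close>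

lemma has_partial_radial:
  assumes "x \<noteq> 0" and "(\<Phi> has_vector_derivative \<Phi>') (at (norm x))"
  shows "has_partial b (\<lambda>x. \<Phi> (norm x)) (of_real (x \<bullet> b) * (\<Phi>' / of_real (norm x))) x"
proof -
  have "((\<lambda>h. norm (x + h *\<^sub>R b)) has_derivative (\<lambda>h. (h *\<^sub>R b) \<bullet> sgn x)) (at 0)"
  proof -
    have "((\<lambda>h. x + h *\<^sub>R b) has_derivative (\<lambda>h. h *\<^sub>R b)) (at 0)"
      by (auto intro!: derivative_eq_intros)
    moreover have "(norm has_derivative (\<lambda>h. h \<bullet> sgn x)) (at (x + 0 *\<^sub>R b))"
      using assms(1) by (simp add: has_derivative_norm)
    ultimately show ?thesis
      using has_derivative_compose by blast
  qed
  then have "((\<lambda>h. norm (x + h *\<^sub>R b)) has_vector_derivative (b \<bullet> sgn x)) (at 0)"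
    by (simp add: has_vector_derivative_def)
  moreover have "(\<Phi> has_vector_derivative \<Phi>') (at (norm (x + 0 *\<^sub>R b)))"
    using assms(2) by simp
  ultimately have "((\<Phi> \<circ> (\<lambda>h. norm (x + h *\<^sub>R b))) has_vector_derivative (b \<bullet> sgn x) *\<^sub>R \<Phi>') (at 0)"
    by (rule vector_diff_chain_at)
  moreover have "(b \<bullet> sgn x) *\<^sub>R \<Phi>' = of_real (x \<bullet> b) * (\<Phi>' / of_real (norm x))"
    by (simp add: sgn_div_norm inner_commute scaleR_conv_of_real field_simps)
  ultimately show ?thesis by (simp add: has_partial_def o_def)
qed

lemma has_partial_transform:
  assumes "has_partial b f f' x" "open A" "x \<in> A" "\<And>y. y \<in> A \<Longrightarrow> f y = g y"
  shows "has_partial b g f' x"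
  unfolding has_partial_def
proof (rule has_vector_derivative_transform_within_open)
  show "((\<lambda>h. f (x + h *\<^sub>R b)) has_vector_derivative f') (at 0)"
    using assms(1) by (simp add: has_partial_def)
  show "open ((\<lambda>h. x + h *\<^sub>R b) -` A)"
    by (intro open_vimage assms(2) continuous_intros)
qed (use assms in auto)

lemma has_partial_scale:
  fixes L :: real
  assumes "has_partial b f f' (x /\<^sub>R L)"
  shows "has_partial b (\<lambda>x. c * f (x /\<^sub>R L)) (c / of_real L * f') x"
proof -
  have "((\<lambda>h. h / L) has_vector_derivative 1 / L) (at 0)"
    unfolding has_real_derivative_iff_has_vector_derivative[symmetric]
    by (rule DERIV_cdivide[OF DERIV_ident])
  moreover have "((\<lambda>h. f (x /\<^sub>R L + h *\<^sub>R b)) has_vector_derivative f') (at (0 / L))"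
    using assms by (simp add: has_partial_def)
  ultimately have "((\<lambda>h. f (x /\<^sub>R L + h *\<^sub>R b)) \<circ> (\<lambda>h. h / L) has_vector_derivative (1 / L) *\<^sub>R f') (at 0)"
    by (rule vector_diff_chain_at)
  then have "((\<lambda>h. c * f (x /\<^sub>R L + (h / L) *\<^sub>R b)) has_vector_derivative c * ((1 / L) *\<^sub>R f')) (at 0)"
    unfolding o_def by (rule has_vector_derivative_mult_right)
  moreover have "(\<lambda>h. c * f (x /\<^sub>R L + (h / L) *\<^sub>R b)) = (\<lambda>h. c * f ((x + h *\<^sub>R b) /\<^sub>R L))"
    by (simp add: scaleR_add_right divide_inverse mult.commute)
  ultimately show ?thesis
    by (simp add: has_partial_def scaleR_conv_of_real)
qed

section \<open>Functions of class C^k in space and their self-similar rescalings\<close>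

primrec Ck :: "nat \<Rightarrow> ('a::euclidean_space \<Rightarrow> complex) \<Rightarrow> bool" where
  "Ck 0 f \<longleftrightarrow> continuous_on UNIV f"
| "Ck (Suc k) f \<longleftrightarrow> continuous_on UNIV f \<and>
     (\<forall>b\<in>Basis. \<exists>g. (\<forall>x. has_partial b f (g x) x) \<and> Ck k g)"

lemma Ck_imp_continuous: "Ck k f \<Longrightarrow> continuous_on UNIV f"
  by (cases k) auto

lemma Ck_SucD: "Ck (Suc k) f \<Longrightarrow> Ck k f"
  by (induction k arbitrary: f) (auto, blast)

lemma Ck_partial:
  assumes "Ck (Suc k) f" "b \<in> Basis"
  shows "has_partial b f (partial b f x) x" "Ck k (partial b f)"
proof -
  obtain g where g: "\<And>x. has_partial b f (g x) x" "Ck k g" using assms by auto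
  then have "partial b f = g" by (intro ext partial_eqI)
  with g show "has_partial b f (partial b f x) x" "Ck k (partial b f)" by auto
qed

lemma Ck_const: "Ck k (\<lambda>x. c)"
proof (induction k arbitrary: c)
  case (Suc k)
  then show ?case using has_partial_const by fastforce
qed simp

lemma Ck_inner: "Ck k (\<lambda>x. of_real (x \<bullet> c))"
proof (cases k)
  case 0
  then show ?thesis by (auto intro!: continuous_intros)
next
  case (Suc j)
  have "\<exists>g. (\<forall>x. has_partial b (\<lambda>x. of_real (x \<bullet> c)) (g x) x) \<and> Ck j g" for b :: 'a
    by (rule exI[of _ "\<lambda>x. of_real (b \<bullet> c)"]) (simp add: has_partial_inner Ck_const)
  then show ?thesis by (auto simp: Suc intro!: continuous_intros)
qed

lemma Ck_add: "Ck k f \<Longrightarrow> Ck k g \<Longrightarrow> Ck k (\<lambda>x. f x + g x)"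
proof (induction k arbitrary: f g)
  case (Suc k)
  have "\<exists>h. (\<forall>x. has_partial b (\<lambda>x. f x + g x) (h x) x) \<and> Ck k h" if b: "b \<in> Basis" for b
  proof (intro exI conjI allI)
    show "has_partial b (\<lambda>x. f x + g x) (partial b f x + partial b g x) x" for x
      by (intro has_partial_add Ck_partial[OF Suc.prems(1) b] Ck_partial[OF Suc.prems(2) b])
    show "Ck k (\<lambda>x. partial b f x + partial b g x)"
      by (intro Suc.IH Ck_partial[OF Suc.prems(1) b] Ck_partial[OF Suc.prems(2) b])
  qed
  then show ?case using Suc.prems by (auto intro!: continuous_intros)
qed (auto intro!: continuous_intros)

lemma Ck_mult: "Ck k f \<Longrightarrow> Ck k g \<Longrightarrow> Ck k (\<lambda>x. f x * g x)"
proof (induction k arbitrary: f g)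
  case (Suc k)
  have "\<exists>h. (\<forall>x. has_partial b (\<lambda>x. f x * g x) (h x) x) \<and> Ck k h" if b: "b \<in> Basis" for b
  proof (intro exI conjI allI)
    show "has_partial b (\<lambda>x. f x * g x) (f x * partial b g x + partial b f x * g x) x" for x
      by (intro has_partial_mult Ck_partial[OF Suc.prems(1) b] Ck_partial[OF Suc.prems(2) b])
    show "Ck k (\<lambda>x. f x * partial b g x + partial b f x * g x)"
      by (intro Ck_add Suc.IH Ck_partial[OF Suc.prems(1) b] Ck_partial[OF Suc.prems(2) b] Ck_SucD[OF Suc.prems(1)] Ck_SucD[OF Suc.prems(2)])
  qed
  then show ?case using Suc.prems by (auto intro!: continuous_intros)
qed (auto intro!: continuous_intros)

lemma Ck_sum: "finite A \<Longrightarrow> (\<And>i. i \<in> A \<Longrightarrow> Ck k (f i)) \<Longrightarrow> Ck k (\<lambda>x. \<Sum>i\<in>A. f i x)"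
  by (induction A rule: finite_induct) (auto intro: Ck_const Ck_add)

lemma space_Ck_on_cong:
  "(\<And>t. t \<in> I \<Longrightarrow> u t = v t) \<Longrightarrow> space_Ck_on k I u = space_Ck_on k I v"
proof (induction k arbitrary: u v)
  case 0
  then show ?case by (auto intro!: continuous_on_cong)
next
  case (Suc k)
  have "space_Ck_on k I (\<lambda>t. partial b (u t)) = space_Ck_on k I (\<lambda>t. partial b (v t))" for b
    by (rule Suc.IH) (simp add: Suc.prems)
  moreover have "continuous_on (I \<times> UNIV) (\<lambda>(t, x). u t x) = continuous_on (I \<times> UNIV) (\<lambda>(t, x). v t x)"
    by (rule continuous_on_cong) (auto simp: Suc.prems)
  ultimately show ?case using Suc.prems by simp
qed

lemma continuous_on_time_space_scaled:
  fixes c :: "real \<Rightarrow> complex" and L :: "real \<Rightarrow> real" and f :: "'a::real_normed_vector \<Rightarrow> complex"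
  assumes f: "continuous_on UNIV f" and c: "continuous_on I c" and L: "continuous_on I L" "\<And>t. t \<in> I \<Longrightarrow> L t \<noteq> 0"
  shows "continuous_on (I \<times> UNIV) (\<lambda>(t, x). c t * f (x /\<^sub>R L t))"
proof -
  have cL: "continuous_on (I \<times> UNIV) (\<lambda>p::real \<times> 'a. c (fst p))" "continuous_on (I \<times> UNIV) (\<lambda>p::real \<times> 'a. L (fst p))"
    by (rule continuous_on_compose2[OF c continuous_on_fst[OF continuous_on_id]], auto)
      (rule continuous_on_compose2[OF L(1) continuous_on_fst[OF continuous_on_id]], auto)
  have "continuous_on (I \<times> UNIV) (\<lambda>p::real \<times> 'a. snd p /\<^sub>R L (fst p))"
    using L by (intro continuous_intros cL) auto
  then have "continuous_on (I \<times> UNIV) (\<lambda>p::real \<times> 'a. f (snd p /\<^sub>R L (fst p)))"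
    by (rule continuous_on_compose2[OF f]) simp
  then show ?thesis
    unfolding case_prod_unfold by (intro continuous_on_mult cL)
qed

text \<open>The form c(t) f(x/L(t)) is preserved by spatial derivatives: f becomes a partial
  derivative of f, and c becomes c/L. The induction therefore runs over all f and c at once.\<close>

lemma Ck_scaled_space_Ck_on:
  fixes c :: "real \<Rightarrow> complex" and L :: "real \<Rightarrow> real"
  assumes "Ck k f" "continuous_on I c" and L: "continuous_on I L" "\<And>t. t \<in> I \<Longrightarrow> L t \<noteq> 0"
  shows "space_Ck_on k I (\<lambda>t x. c t * f (x /\<^sub>R L t))"
  using assms(1,2)
proof (induction k arbitrary: f c)
  case 0
  then show ?case using continuous_on_time_space_scaled[OF _ _ L, of f c] by simp
next
  case (Suc k)
  have part: "has_partial b (\<lambda>x. c t * f (x /\<^sub>R L t)) (c t / of_real (L t) * partial b f (x /\<^sub>R L t)) x"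
    if "b \<in> Basis" for b t x
    by (intro has_partial_scale Ck_partial[OF Suc.prems(1) that])
  have "continuous_on (I \<times> UNIV) (\<lambda>(t, x). c t * f (x /\<^sub>R L t))"
    by (rule continuous_on_time_space_scaled[OF Ck_imp_continuous[OF Suc.prems(1)] Suc.prems(2) L])
  moreover have "space_Ck_on k I (\<lambda>t. partial b (\<lambda>x. c t * f (x /\<^sub>R L t)))" if b: "b \<in> Basis" for b
  proof -
    have "space_Ck_on k I (\<lambda>t x. c t / of_real (L t) * partial b f (x /\<^sub>R L t))"
      using L by (intro Suc.IH Ck_partial[OF Suc.prems(1) b] continuous_intros Suc.prems) auto
    moreover have "(\<lambda>t. partial b (\<lambda>x. c t * f (x /\<^sub>R L t))) = (\<lambda>t x. c t / of_real (L t) * partial b f (x /\<^sub>R L t))"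
      by (intro ext partial_eqI part b)
    ultimately show ?thesis by simp
  qed
  moreover have "(\<lambda>h. c t * f ((x + h *\<^sub>R b) /\<^sub>R L t)) differentiable (at 0)" if "b \<in> Basis" for b t x
    using has_partial_differentiable[OF part[OF that]] .
  ultimately show ?case
    unfolding space_Ck_on.simps by blast
qed


text \<open>
  \<open>flat k w f\<close>: away from the origin all partial derivatives of order \<open>j \<le> k\<close> exist and are
  \<open>o(|x|\<^bsup>w-j\<^esup>)\<close>. Orders \<open>w < k\<close> are needed because \<open>\<Phi>(|x|)\<close> is differentiated into
  \<open>x\<^sub>b (\<Phi>'/r)(|x|)\<close>, where the factor \<open>\<Phi>'/r\<close> is more singular.
\<close>

definition vanishes_to_order :: "int \<Rightarrow> ('a::euclidean_space \<Rightarrow> complex) \<Rightarrow> bool" where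
  "vanishes_to_order w f \<longleftrightarrow> continuous_on (- {0}) f \<and> ((\<lambda>x. f x / of_real (norm x powi w)) \<longlongrightarrow> 0) (at 0)"

primrec flat :: "nat \<Rightarrow> int \<Rightarrow> ('a::euclidean_space \<Rightarrow> complex) \<Rightarrow> bool" where
  "flat 0 w f \<longleftrightarrow> vanishes_to_order w f"
| "flat (Suc k) w f \<longleftrightarrow> vanishes_to_order w f \<and>
     (\<forall>b\<in>Basis. \<exists>g. (\<forall>x. x \<noteq> 0 \<longrightarrow> has_partial b f (g x) x) \<and> flat k (w - 1) g)"

lemma vanishes_to_order_add:
  "vanishes_to_order w f \<Longrightarrow> vanishes_to_order w g \<Longrightarrow> vanishes_to_order w (\<lambda>x. f x + g x)"
  unfolding vanishes_to_order_def add_divide_distrib by (auto intro!: continuous_intros tendsto_add_zero)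

lemma vanishes_to_order_cmult:
  "vanishes_to_order w f \<Longrightarrow> vanishes_to_order w (\<lambda>x. c * f x)"
  using tendsto_mult_right_zero[of "\<lambda>x. f x / of_real (norm x powi w)" "at 0" c]
  unfolding vanishes_to_order_def times_divide_eq_right by (auto intro!: continuous_intros)

lemma vanishes_to_order_inner:
  assumes "vanishes_to_order w f"
  shows "vanishes_to_order (w + 1) (\<lambda>x. of_real (x \<bullet> b) * f x)"
  unfolding vanishes_to_order_def
proof
  show "continuous_on (- {0}) (\<lambda>x. of_real (x \<bullet> b) * f x)"
    using assms by (auto simp: vanishes_to_order_def intro!: continuous_intros)
  have "((\<lambda>x. of_real (x \<bullet> b / norm x) * (f x / of_real (norm x powi w))) \<longlongrightarrow> 0) (at 0)"
  proof (rule Lim_null_comparison)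
    have "((\<lambda>x. norm b * norm (f x / of_real (norm x powi w))) \<longlongrightarrow> norm b * 0) (at 0)"
      using assms by (intro tendsto_intros tendsto_norm_zero) (simp add: vanishes_to_order_def)
    then show "((\<lambda>x. norm b * norm (f x / of_real (norm x powi w))) \<longlongrightarrow> 0) (at 0)" by simp
    have "norm (complex_of_real (x \<bullet> b / norm x)) \<le> norm b" for x
      using Cauchy_Schwarz_ineq2[of x b] by (cases "x = 0") (simp_all add: norm_divide field_simps)
    then show "\<forall>\<^sub>F x in at 0. norm (of_real (x \<bullet> b / norm x) * (f x / of_real (norm x powi w)))
        \<le> norm b * norm (f x / of_real (norm x powi w))"
      by (intro always_eventually allI) (simp only: norm_mult mult_right_mono norm_ge_zero)
  qed
  then show "((\<lambda>x. of_real (x \<bullet> b) * f x / of_real (norm x powi (w + 1))) \<longlongrightarrow> 0) (at 0)"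
    by (rule Lim_transform_eventually)
      (auto simp: eventually_at power_int_add intro!: exI[of _ 1])
qed

lemma flat_imp_vanishes: "flat k w f \<Longrightarrow> vanishes_to_order w f"
  by (cases k) auto

lemma flat_SucD: "flat (Suc k) w f \<Longrightarrow> flat k w f"
proof (induction k arbitrary: w f)
  case (Suc k)
  have "\<exists>g. (\<forall>x. x \<noteq> 0 \<longrightarrow> has_partial b f (g x) x) \<and> flat k (w - 1) g" if b: "b \<in> Basis" for b
  proof -
    obtain g where "\<forall>x. x \<noteq> 0 \<longrightarrow> has_partial b f (g x) x" "flat (Suc k) (w - 1) g"
      using Suc.prems b by (metis flat.simps(2))
    then show ?thesis using Suc.IH by blast
  qed
  then show ?case using flat_imp_vanishes[OF Suc.prems] by simp
qed simp

lemma flat_add: "flat k w f \<Longrightarrow> flat k w g \<Longrightarrow> flat k w (\<lambda>x. f x + g x)"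
proof (induction k arbitrary: w f g)
  case (Suc k)
  have "\<exists>h. (\<forall>x. x \<noteq> 0 \<longrightarrow> has_partial b (\<lambda>x. f x + g x) (h x) x) \<and> flat k (w - 1) h" if b: "b \<in> Basis" for b
  proof -
    obtain f' g' where "\<forall>x. x \<noteq> 0 \<longrightarrow> has_partial b f (f' x) x" "flat k (w - 1) f'"
      "\<forall>x. x \<noteq> 0 \<longrightarrow> has_partial b g (g' x) x" "flat k (w - 1) g'"
      using Suc.prems b by (metis flat.simps(2))
    then show ?thesis
      by (intro exI[of _ "\<lambda>x. f' x + g' x"]) (auto intro: has_partial_add Suc.IH)
  qed
  then show ?case using Suc.prems by (auto intro: vanishes_to_order_add)
qed (auto intro: vanishes_to_order_add)

lemma flat_cmult: "flat k w f \<Longrightarrow> flat k w (\<lambda>x. c * f x)"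
proof (induction k arbitrary: w f)
  case (Suc k)
  have "\<exists>h. (\<forall>x. x \<noteq> 0 \<longrightarrow> has_partial b (\<lambda>x. c * f x) (h x) x) \<and> flat k (w - 1) h" if b: "b \<in> Basis" for b
  proof -
    obtain f' where f': "\<forall>x. x \<noteq> 0 \<longrightarrow> has_partial b f (f' x) x" "flat k (w - 1) f'"
      using Suc.prems b by (metis flat.simps(2))
    have "has_partial b (\<lambda>x. c * f x) (c * f' x) x" if "x \<noteq> 0" for x
      using has_partial_mult[OF has_partial_const, of b f "f' x" x c] f' that by simp
    then show ?thesis
      by (intro exI[of _ "\<lambda>x. c * f' x"] conjI allI impI Suc.IH[OF f'(2)])
  qed
  then show ?case using Suc.prems by (auto intro: vanishes_to_order_cmult)
qed (auto intro: vanishes_to_order_cmult)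

lemma flat_inner: "flat k w f \<Longrightarrow> flat k (w + 1) (\<lambda>x. of_real (x \<bullet> c) * f x)"
proof (induction k arbitrary: w f)
  case (Suc k)
  have "\<exists>h. (\<forall>x. x \<noteq> 0 \<longrightarrow> has_partial b (\<lambda>x. of_real (x \<bullet> c) * f x) (h x) x) \<and> flat k (w + 1 - 1) h" if b: "b \<in> Basis" for b
  proof -
    obtain f' where f': "\<forall>x. x \<noteq> 0 \<longrightarrow> has_partial b f (f' x) x" "flat k (w - 1) f'"
      using Suc.prems b by (metis flat.simps(2))
    show ?thesis
    proof (intro exI conjI allI impI)
      show "has_partial b (\<lambda>x. of_real (x \<bullet> c) * f x) (of_real (x \<bullet> c) * f' x + of_real (b \<bullet> c) * f x) x"
        if "x \<noteq> 0" for x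
        using f' that by (intro has_partial_mult has_partial_inner) auto
      have "flat k (w - 1 + 1) (\<lambda>x. of_real (x \<bullet> c) * f' x)"
        using f' by (intro Suc.IH)
      moreover have "flat k w (\<lambda>x. of_real (b \<bullet> c) * f x)"
        by (intro flat_cmult flat_SucD[OF Suc.prems])
      ultimately show "flat k (w + 1 - 1) (\<lambda>x. of_real (x \<bullet> c) * f' x + of_real (b \<bullet> c) * f x)"
        by (simp add: flat_add)
    qed
  qed
  then show ?case using Suc.prems vanishes_to_order_inner[of w f c] by simp
qed (auto intro: vanishes_to_order_inner)

lemma vanishes_to_order_continuous:
  fixes f :: "'a::euclidean_space \<Rightarrow> complex"
  assumes "vanishes_to_order (int k) f" "f 0 = 0"
  shows "continuous_on UNIV f"
proof -
  have "((\<lambda>x. f x / of_real (norm x powi int k) * of_real (norm x ^ k)) \<longlongrightarrow> 0 * of_real (norm (0::'a) ^ k)) (at 0)"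
    using assms by (intro tendsto_intros) (simp add: vanishes_to_order_def)
  then have "((\<lambda>x. f x / of_real (norm x powi int k) * of_real (norm x ^ k)) \<longlongrightarrow> f 0) (at 0)"
    using assms by simp
  then have "(f \<longlongrightarrow> f 0) (at 0)"
    by (rule Lim_transform_eventually) (auto simp: eventually_at intro!: exI[of _ 1])
  then have "isCont f 0" by (simp add: isCont_def)
  then have "isCont f x" for x
    using assms continuous_on_eq_continuous_at[of "- {0}" f]
    by (cases "x = 0") (auto simp: vanishes_to_order_def)
  then show ?thesis by (simp add: continuous_on_eq_continuous_at)
qed

lemma vanishes_to_order_cong:
  assumes "\<And>x. x \<noteq> 0 \<Longrightarrow> f x = g x"
  shows "vanishes_to_order w f \<longleftrightarrow> vanishes_to_order w g"
proof -
  have "continuous_on (- {0}) f \<longleftrightarrow> continuous_on (- {0}) g"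
    by (rule continuous_on_cong) (auto simp: assms)
  moreover have "((\<lambda>x. f x / of_real (norm x powi w)) \<longlongrightarrow> 0) (at 0) \<longleftrightarrow> ((\<lambda>x. g x / of_real (norm x powi w)) \<longlongrightarrow> 0) (at 0)"
    by (rule filterlim_cong) (auto simp: eventually_at assms intro!: exI[of _ 1])
  ultimately show ?thesis by (simp add: vanishes_to_order_def)
qed

lemma has_partial_cong_nonzero:
  assumes "\<And>x. x \<noteq> 0 \<Longrightarrow> f x = g x" "x \<noteq> 0"
  shows "has_partial b f f' x \<longleftrightarrow> has_partial b g f' x"
  using has_partial_transform[of b f f' x "- {0}" g] has_partial_transform[of b g f' x "- {0}" f] assms by auto

lemma flat_cong:
  assumes "\<And>x. x \<noteq> 0 \<Longrightarrow> f x = g x"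
  shows "flat k w f \<longleftrightarrow> flat k w g"
  using assms by (cases k) (simp_all add: vanishes_to_order_cong[of f g] has_partial_cong_nonzero[of f g] cong: conj_cong)

text \<open>With weight equal to the order, all derivatives up to order k tend to 0 at the origin.
  The missing partial derivatives at 0 exist and vanish because the difference quotient of f along b
  is o(|t|^k); the induction then applies to the partial derivative extended by 0.\<close>

lemma flat_imp_Ck: "flat k (int k) f \<Longrightarrow> f 0 = 0 \<Longrightarrow> Ck k f"
proof (induction k arbitrary: f)
  case 0
  then show ?case using vanishes_to_order_continuous[of 0 f] by simp
next
  case (Suc k)
  have "\<exists>g. (\<forall>x. has_partial b f (g x) x) \<and> Ck k g" if b: "b \<in> Basis" for b
  proof -
    obtain g where g: "\<forall>x. x \<noteq> 0 \<longrightarrow> has_partial b f (g x) x" "flat k (int k) g"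
      using Suc.prems b by auto
    \<comment> \<open>The derivative supplied by \<open>flat\<close> is arbitrary at the origin and
      has to be reset there.\<close>
    define h where "h = g(0 := 0)"
    have "Ck k h"
    proof (rule Suc.IH)
      show "flat k (int k) h" using g(2) flat_cong[of g h k "int k"] by (simp add: h_def)
    qed (simp add: h_def)
    moreover have "has_partial b f (h x) x" for x
    proof (cases "x = 0")
      case True
      have "((\<lambda>x. f x / of_real (norm x powi int (Suc k))) \<longlongrightarrow> 0) (at 0)"
        using Suc.prems by (simp add: vanishes_to_order_def)
      moreover have "filterlim (\<lambda>t::real. t *\<^sub>R b) (at 0) (at 0)"
        using b by (auto simp: filterlim_at eventually_at nonzero_Basis intro!: exI[of _ 1] tendsto_eq_intros)
      ultimately have "((\<lambda>t::real. f (t *\<^sub>R b) / of_real (norm (t *\<^sub>R b) powi int (Suc k))) \<longlongrightarrow> 0) (at 0)"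
        by (rule filterlim_compose)
      then have "((\<lambda>t::real. f (t *\<^sub>R b) / of_real (norm (t *\<^sub>R b) ^ Suc k)) \<longlongrightarrow> 0) (at 0)"
        unfolding power_int_of_nat .
      then have "((\<lambda>t::real. f (t *\<^sub>R b) / of_real (norm (t *\<^sub>R b) ^ Suc k) * of_real (\<bar>t\<bar> ^ k)) \<longlongrightarrow> 0 * of_real (\<bar>0\<bar> ^ k)) (at 0)"
        by (intro tendsto_intros)
      then have "((\<lambda>t::real. norm (f (t *\<^sub>R b) / of_real (norm (t *\<^sub>R b) ^ Suc k) * of_real (\<bar>t\<bar> ^ k))) \<longlongrightarrow> 0) (at 0)"
        by (intro tendsto_norm_zero) simp
      then have "((\<lambda>t::real. norm (f (t *\<^sub>R b)) / norm t) \<longlongrightarrow> 0) (at 0)"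
        by (rule Lim_transform_eventually)
          (use b in \<open>auto simp: eventually_at norm_divide norm_mult norm_power intro!: exI[of _ 1]\<close>)
      then show ?thesis
        unfolding has_partial_def has_vector_derivative_def True
        by (simp add: has_derivative_at Suc.prems(2) h_def)
    next
      case False
      then show ?thesis using g by (simp add: h_def)
    qed
    ultimately show ?thesis by blast
  qed
  moreover have "continuous_on UNIV f"
    using Suc.prems by (intro vanishes_to_order_continuous[of "Suc k"]) auto
  ultimately show ?case by simp
qed

section \<open>Flatness in the radial variable\<close>

definition vanishes_at_right :: "int \<Rightarrow> (real \<Rightarrow> complex) \<Rightarrow> bool" where
  "vanishes_at_right w \<Phi> \<longleftrightarrow> continuous_on {0<..} \<Phi> \<and> ((\<lambda>r. \<Phi> r / of_real (r powi w)) \<longlongrightarrow> 0) (at_right 0)"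

primrec radially_flat :: "nat \<Rightarrow> int \<Rightarrow> (real \<Rightarrow> complex) \<Rightarrow> bool" where
  "radially_flat 0 w \<Phi> \<longleftrightarrow> vanishes_at_right w \<Phi>"
| "radially_flat (Suc k) w \<Phi> \<longleftrightarrow> vanishes_at_right w \<Phi> \<and>
     (\<exists>\<Psi>. (\<forall>r>0. (\<Phi> has_vector_derivative \<Psi> r) (at r)) \<and> radially_flat k (w - 1) \<Psi>)"

lemma radially_flat_imp_vanishes: "radially_flat k w \<Phi> \<Longrightarrow> vanishes_at_right w \<Phi>"
  by (cases k) auto

lemma radially_flat_SucD: "radially_flat (Suc k) w \<Phi> \<Longrightarrow> radially_flat k w \<Phi>"
proof (induction k arbitrary: w \<Phi>)
  case (Suc k)
  obtain \<Psi> where "\<forall>r>0. (\<Phi> has_vector_derivative \<Psi> r) (at r)" "radially_flat (Suc k) (w - 1) \<Psi>"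
    using Suc.prems by (metis radially_flat.simps(2))
  then have "\<exists>\<Psi>. (\<forall>r>0. (\<Phi> has_vector_derivative \<Psi> r) (at r)) \<and> radially_flat k (w - 1) \<Psi>"
    using Suc.IH by blast
  then show ?case using radially_flat_imp_vanishes[OF Suc.prems] by simp
qed simp

lemma vanishes_at_right_diff:
  "vanishes_at_right w f \<Longrightarrow> vanishes_at_right w g \<Longrightarrow> vanishes_at_right w (\<lambda>x. f x - g x)"
  using tendsto_diff[of "\<lambda>r. f r / of_real (r powi w)" 0 "at_right 0" "\<lambda>r. g r / of_real (r powi w)" 0]
  unfolding vanishes_at_right_def diff_divide_distrib by (auto intro!: continuous_intros)

lemma radially_flat_diff:
  "radially_flat k w f \<Longrightarrow> radially_flat k w g \<Longrightarrow> radially_flat k w (\<lambda>x. f x - g x)"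
proof (induction k arbitrary: w f g)
  case (Suc k)
  obtain f' g' where "\<forall>r>0. (f has_vector_derivative f' r) (at r)" "radially_flat k (w - 1) f'"
      "\<forall>r>0. (g has_vector_derivative g' r) (at r)" "radially_flat k (w - 1) g'"
    using Suc.prems by (metis radially_flat.simps(2))
  then have "\<exists>\<Psi>. (\<forall>r>0. ((\<lambda>x. f x - g x) has_vector_derivative \<Psi> r) (at r)) \<and> radially_flat k (w - 1) \<Psi>"
    by (intro exI[of _ "\<lambda>x. f' x - g' x"]) (auto intro: has_vector_derivative_diff Suc.IH)
  then show ?case using Suc.prems by (auto intro: vanishes_at_right_diff)
qed (auto intro: vanishes_at_right_diff)

lemma vanishes_at_right_div:
  assumes "vanishes_at_right w \<Phi>"
  shows "vanishes_at_right (w - 1) (\<lambda>r. \<Phi> r / of_real r)"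
proof -
  have "((\<lambda>r. \<Phi> r / of_real r / of_real (r powi (w - 1))) \<longlongrightarrow> 0) (at_right 0)"
    by (rule Lim_transform_eventually[of "\<lambda>r. \<Phi> r / of_real (r powi w)"])
      (use assms in \<open>auto simp: vanishes_at_right_def eventually_at_right_less power_int_diff eventually_at_filter\<close>)
  then show ?thesis using assms by (auto simp: vanishes_at_right_def intro!: continuous_intros)
qed

text \<open>In (\<Phi>/r)' = \<Phi>'/r - \<Phi>/r^2 the last term is \<Phi> divided twice, and
  \<Phi> itself is used with one derivative fewer. Both terms have weight w - 2.\<close>

lemma radially_flat_div: "radially_flat k w \<Phi> \<Longrightarrow> radially_flat k (w - 1) (\<lambda>r. \<Phi> r / of_real r)"
proof (induction k arbitrary: w \<Phi>)
  case (Suc k)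
  obtain \<Psi> where \<Psi>: "\<forall>r>0. (\<Phi> has_vector_derivative \<Psi> r) (at r)" "radially_flat k (w - 1) \<Psi>"
    using Suc.prems by (metis radially_flat.simps(2))
  have "((\<lambda>r. \<Phi> r / of_real r) has_vector_derivative \<Psi> r / of_real r - \<Phi> r / of_real r / of_real r) (at r)"
    if "r > 0" for r
  proof -
    have "((\<lambda>r. of_real (inverse r) * \<Phi> r) has_vector_derivative
        of_real (inverse r) * \<Psi> r + of_real (- (inverse r ^ Suc (Suc 0))) * \<Phi> r) (at r)"
      using \<Psi>(1) that
      by (intro has_vector_derivative_mult has_vector_derivative_of_real DERIV_inverse) auto
    then show ?thesis by (simp add: field_simps)
  qed
  moreover have "radially_flat k (w - 1 - 1) (\<lambda>r. \<Psi> r / of_real r - \<Phi> r / of_real r / of_real r)"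
    by (rule radially_flat_diff[OF Suc.IH[OF \<Psi>(2)] Suc.IH[OF Suc.IH[OF radially_flat_SucD[OF Suc.prems]]]])
  ultimately have "\<exists>\<Psi>'. (\<forall>r>0. ((\<lambda>r. \<Phi> r / of_real r) has_vector_derivative \<Psi>' r) (at r))
      \<and> radially_flat k (w - 1 - 1) \<Psi>'"
    by (intro exI[of _ "\<lambda>r. \<Psi> r / of_real r - \<Phi> r / of_real r / of_real r"]) simp
  then show ?case
    using vanishes_at_right_div[OF radially_flat_imp_vanishes[OF Suc.prems]] by simp
qed (simp add: vanishes_at_right_div)

text \<open>Each step replaces \<Phi> by \<Phi>'/r, losing one derivative and two orders, and the
  coordinate factor gives one order back. Starting from (k, w) = (4, 4), the radial factors pass
  through (3, 2), (2, 0), (1, -2) and (0, -4), which is why weights are integers.\<close>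

lemma flat_radial: "radially_flat k w \<Phi> \<Longrightarrow> flat k w (\<lambda>x. \<Phi> (norm x))"
proof -
  have base: "vanishes_to_order w (\<lambda>x::'a. \<Phi> (norm x))" if "vanishes_at_right w \<Phi>" for w \<Phi>
  proof -
    have 1: "filterlim norm (at_right 0) (at (0::'a))"
      by (auto simp: filterlim_at eventually_at intro!: exI[of _ 1] tendsto_eq_intros)
    have "((\<lambda>r. \<Phi> r / of_real (r powi w)) \<longlongrightarrow> 0) (at_right 0)"
      using that by (simp add: vanishes_at_right_def)
    then have "((\<lambda>x::'a. \<Phi> (norm x) / of_real (norm x powi w)) \<longlongrightarrow> 0) (at 0)"
      by (rule filterlim_compose[OF _ 1])
    moreover have "continuous_on (- {0}) (\<lambda>x::'a. \<Phi> (norm x))"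
    proof (rule continuous_on_compose2[OF _ continuous_on_norm[OF continuous_on_id]])
      show "continuous_on {0<..} \<Phi>" using that by (simp add: vanishes_at_right_def)
    qed auto
    ultimately show ?thesis by (simp add: vanishes_to_order_def)
  qed
  show "radially_flat k w \<Phi> \<Longrightarrow> flat k w (\<lambda>x::'a. \<Phi> (norm x))"
  proof (induction k arbitrary: w \<Phi>)
    case (Suc k)
    obtain \<Psi> where \<Psi>: "\<forall>r>0. (\<Phi> has_vector_derivative \<Psi> r) (at r)" "radially_flat k (w - 1) \<Psi>"
      using Suc.prems by (metis radially_flat.simps(2))
    have "has_partial b (\<lambda>x. \<Phi> (norm x)) (of_real (x \<bullet> b) * (\<Psi> (norm x) / of_real (norm x))) x"
      if "x \<noteq> 0" for x b :: 'a
      using that \<Psi>(1) by (intro has_partial_radial) auto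
    moreover have "flat k (w - 1) (\<lambda>x::'a. of_real (x \<bullet> b) * (\<Psi> (norm x) / of_real (norm x)))" for b
      using flat_inner[OF Suc.IH[OF radially_flat_div[OF \<Psi>(2)]], of b] by simp
    ultimately have "\<exists>g. (\<forall>x. x \<noteq> 0 \<longrightarrow> has_partial b (\<lambda>x. \<Phi> (norm x)) (g x) x) \<and> flat k (w - 1) g" for b :: 'a
      by (intro exI[of _ "\<lambda>x. of_real (x \<bullet> b) * (\<Psi> (norm x) / of_real (norm x))"] conjI) auto
    then show ?case using base[OF radially_flat_imp_vanishes[OF Suc.prems]] by simp
  qed (simp add: base)
qed

text \<open>Taylor's theorem with Peano remainder. The shifted chain gives \<open>D 1\<close> =
  o(r^k) by induction, and the mean value inequality, valid for complex values, turns this into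
  \<open>D 0\<close> = o(r^(k+1)).\<close>

lemma radially_flat_chain:
  fixes D :: "nat \<Rightarrow> real \<Rightarrow> complex"
  assumes "\<And>j r. j < k \<Longrightarrow> 0 \<le> r \<Longrightarrow> (D j has_vector_derivative D (Suc j) r) (at r within {0..})"
    and "continuous_on {0..} (D k)" and "\<And>j. j \<le> k \<Longrightarrow> D j 0 = 0"
  shows "radially_flat k (int k) (D 0)"
  using assms
proof (induction k arbitrary: D)
  case 0
  have "(D 0 \<longlongrightarrow> D 0 0) (at 0 within {0..})"
    using 0(2) by (simp add: continuous_on_def)
  then have "(D 0 \<longlongrightarrow> 0) (at_right 0)"
    using 0(3) by (auto intro: tendsto_within_subset)
  then show ?case
    using 0(2) by (auto simp: vanishes_at_right_def intro: continuous_on_subset)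
next
  case (Suc k)
  have IH: "radially_flat k (int k) (D (Suc 0))"
    using Suc.prems Suc.IH[of "\<lambda>j. D (Suc j)"] by simp
  have d0: "(D 0 has_vector_derivative D (Suc 0) r) (at r within {0..})" if "0 \<le> r" for r
    using Suc.prems(1)[of 0 r] that by simp
  have "((\<lambda>r. D 0 r / of_real (r powi int (Suc k))) \<longlongrightarrow> 0) (at_right 0)"
    unfolding power_int_of_nat
  proof (rule tendstoI)
    fix \<epsilon> :: real assume \<epsilon>: "0 < \<epsilon>"
    have "((\<lambda>r. D (Suc 0) r / of_real (r ^ k)) \<longlongrightarrow> 0) (at_right 0)"
      using radially_flat_imp_vanishes[OF IH] by (simp add: vanishes_at_right_def)
    then have "\<forall>\<^sub>F r in at_right 0. dist (D (Suc 0) r / of_real (r ^ k)) 0 < \<epsilon> / 2"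
      using \<epsilon> by (intro tendstoD) auto
    then obtain \<delta> where \<delta>: "\<delta> > 0" "\<And>r. 0 < r \<Longrightarrow> r < \<delta> \<Longrightarrow> norm (D (Suc 0) r / of_real (r ^ k)) < \<epsilon> / 2"
      by (auto simp: eventually_at_right_field)
    have le: "norm (D (Suc 0) s) \<le> \<epsilon> / 2 * r ^ k" if "0 \<le> s" "s \<le> r" "r < \<delta>" for s r
    proof (cases "s = 0")
      case True
      then show ?thesis using Suc.prems(3)[of "Suc 0"] that \<epsilon> by simp
    next
      case False
      then have s: "0 < s" "s < \<delta>" using that by auto
      have "norm (D (Suc 0) s) \<le> \<epsilon> / 2 * s ^ k"
        using \<delta>(2)[OF s] s by (simp add: norm_divide norm_power field_simps)
      also have "\<dots> \<le> \<epsilon> / 2 * r ^ k" using that \<epsilon> by (intro mult_left_mono power_mono) auto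
      finally show ?thesis .
    qed
    have main: "norm (D 0 r) \<le> \<epsilon> / 2 * r ^ k * r" if r: "0 < r" "r < \<delta>" for r
    proof -
      have "norm (D 0 r - D 0 0) \<le> \<epsilon> / 2 * r ^ k * norm (r - 0)"
      proof (rule differentiable_bound)
        show "convex {0..r}" by simp
        show "(D 0 has_derivative (\<lambda>h. h *\<^sub>R D (Suc 0) s)) (at s within {0..r})" if "s \<in> {0..r}" for s
          using d0[of s] that
          by (auto simp: has_vector_derivative_def intro: has_derivative_subset)
        show "onorm (\<lambda>h. h *\<^sub>R D (Suc 0) s) \<le> \<epsilon> / 2 * r ^ k" if "s \<in> {0..r}" for s
        proof (rule onorm_le)
          fix h :: real
          show "norm (h *\<^sub>R D (Suc 0) s) \<le> \<epsilon> / 2 * r ^ k * norm h"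
            using mult_right_mono[OF le[of s r], of "norm h"] that r by (simp add: mult.commute)
        qed
      qed (use r in auto)
      then show ?thesis using Suc.prems(3)[of 0] r by simp
    qed
    have "dist (D 0 r / of_real (r ^ Suc k)) 0 < \<epsilon>" if r: "0 < r" "r < \<delta>" for r
    proof -
      have "norm (D 0 r) \<le> \<epsilon> / 2 * r ^ Suc k" using main[OF r] by (simp add: mult_ac)
      also have "\<dots> < \<epsilon> * r ^ Suc k" using r \<epsilon> by (intro mult_strict_right_mono) auto
      finally have "norm (D 0 r) < \<epsilon> * r ^ Suc k" .
      then show ?thesis using r by (simp add: norm_divide norm_mult norm_power field_simps)
    qed
    then show "\<forall>\<^sub>F r in at_right 0. dist (D 0 r / of_real (r ^ Suc k)) 0 < \<epsilon>"
      using \<delta>(1) by (auto simp: eventually_at_right_field)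
  qed
  moreover have "(D 0 has_vector_derivative D (Suc 0) r) (at r)" if "0 < r" for r
  proof -
    have "at r within {0..} = at r" using that by (intro at_within_interior) (simp add: interior_Ici)
    then show ?thesis using d0[of r] that by simp
  qed
  moreover from this have "continuous_on {0<..} (D 0)"
    by (intro continuous_at_imp_continuous_on) (auto intro: has_vector_derivative_continuous)
  ultimately show ?case using IH by (auto simp: vanishes_at_right_def)
qed

lemma Ck_norm_sq: "Ck k (\<lambda>x::'a::euclidean_space. of_real ((norm x)\<^sup>2))"
proof -
  have "Ck k (\<lambda>x::'a. \<Sum>b\<in>Basis. of_real (x \<bullet> b) * of_real (x \<bullet> b))"
    by (intro Ck_sum Ck_mult Ck_inner) simp
  then show ?thesis
    by (simp add: power2_norm_eq_inner euclidean_inner[of x x for x])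
qed

text \<open>Because S' and S''' vanish at 0, the Taylor polynomial is even, hence a polynomial in
  |x|^2 and smooth; a term in |x| or |x|^3 would not be C^4. Each \<open>D j\<close> is the j-th
  derivative of the remainder.\<close>

lemma radial_profile_Ck:
  assumes S: "hl_Ck 4 S" and odd: "hl_derivs 1 S 0 = 0" "hl_derivs 3 S 0 = 0"
  shows "Ck 4 (\<lambda>x::'a::euclidean_space. S (norm x))"
proof -
  define a where "a = S 0"
  define b where "b = hl_derivs 2 S 0"
  define c where "c = hl_derivs 4 S 0"
  define D where "D = (\<lambda>j::nat. \<lambda>r. if j = 0 then S r - a - of_real (r\<^sup>2 / 2) * b - of_real (r ^ 4 / 24) * c
    else if j = 1 then hl_derivs 1 S r - of_real r * b - of_real (r ^ 3 / 6) * c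
    else if j = 2 then hl_derivs 2 S r - b - of_real (r\<^sup>2 / 2) * c
    else if j = 3 then hl_derivs 3 S r - of_real r * c
    else hl_derivs 4 S r - c)"
  have d: "(S has_vector_derivative hl_derivs 1 S r) (at r within {0..})"
    "(hl_derivs 1 S has_vector_derivative hl_derivs 2 S r) (at r within {0..})"
    "(hl_derivs 2 S has_vector_derivative hl_derivs 3 S r) (at r within {0..})"
    "(hl_derivs 3 S has_vector_derivative hl_derivs 4 S r) (at r within {0..})" if "0 \<le> r" for r
    using S that by (force simp: hl_Ck_def hl_deriv_def vector_derivative_works numeral_eq_Suc)+
  have m: "((\<lambda>r::real. r\<^sup>2 / 2) has_real_derivative r) (at r within A)"
    "((\<lambda>r::real. r ^ 3 / 6) has_real_derivative r\<^sup>2 / 2) (at r within A)"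
    "((\<lambda>r::real. r ^ 4 / 24) has_real_derivative r ^ 3 / 6) (at r within A)" for r A
    by (auto intro!: derivative_eq_intros)
  have mult: "((\<lambda>r. of_real (f r) * z) has_vector_derivative of_real f' * z) (at r within A)"
    if "(f has_real_derivative f') (at r within A)" for f f' r A and z :: complex
    using that by (intro has_vector_derivative_mult_left has_vector_derivative_of_real)
  have "radially_flat 4 (int 4) (D 0)"
  proof (rule radially_flat_chain)
    fix j :: nat and r :: real assume j: "j < 4" and r: "0 \<le> r"
    from j consider "j = 0" | "j = 1" | "j = 2" | "j = 3" by linarith
    then show "(D j has_vector_derivative D (Suc j) r) (at r within {0..})"
    proof cases
      case 1
      have "((\<lambda>r. S r - a - of_real (r\<^sup>2 / 2) * b - of_real (r ^ 4 / 24) * c) has_vector_derivative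
        hl_derivs 1 S r - 0 - of_real r * b - of_real (r ^ 3 / 6) * c) (at r within {0..})"
        by (intro has_vector_derivative_diff d r mult m has_vector_derivative_const)
      with 1 show ?thesis by (simp add: D_def)
    next
      case 2
      have "((\<lambda>r. hl_derivs 1 S r - of_real r * b - of_real (r ^ 3 / 6) * c) has_vector_derivative
        hl_derivs 2 S r - of_real 1 * b - of_real (r\<^sup>2 / 2) * c) (at r within {0..})"
        by (intro has_vector_derivative_diff d r mult m DERIV_ident)
      with 2 show ?thesis by (simp add: D_def numeral_2_eq_2)
    next
      case 3
      have "((\<lambda>r. hl_derivs 2 S r - b - of_real (r\<^sup>2 / 2) * c) has_vector_derivative
        hl_derivs 3 S r - 0 - of_real r * c) (at r within {0..})"
        by (intro has_vector_derivative_diff d r mult m has_vector_derivative_const)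
      with 3 show ?thesis by (simp add: D_def)
    next
      case 4
      have "((\<lambda>r. hl_derivs 3 S r - of_real r * c) has_vector_derivative
        hl_derivs 4 S r - of_real 1 * c) (at r within {0..})"
        by (intro has_vector_derivative_diff d r mult DERIV_ident)
      with 4 show ?thesis by (simp add: D_def)
    qed
  next
    have "continuous_on {0..} (hl_derivs 4 S)" using S by (simp add: hl_Ck_def)
    then have "continuous_on {0..} (\<lambda>r. hl_derivs 4 S r - c)" by (intro continuous_intros)
    then show "continuous_on {0..} (D 4)" by (simp add: D_def)
    show "D j 0 = 0" if "j \<le> 4" for j
      using odd by (simp add: D_def a_def b_def c_def)
  qed
  then have "Ck 4 (\<lambda>x::'a. D 0 (norm x))"
    by (intro flat_imp_Ck flat_radial) (auto simp: D_def a_def)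
  then have "Ck 4 (\<lambda>x::'a. D 0 (norm x) + (a + (of_real ((norm x)\<^sup>2) * (b / 2)
      + of_real ((norm x)\<^sup>2) * (of_real ((norm x)\<^sup>2) * (c / 24)))))"
    by (intro Ck_add Ck_mult Ck_norm_sq Ck_const)
  moreover have "D 0 (norm x) + (a + (of_real ((norm x)\<^sup>2) * (b / 2)
      + of_real ((norm x)\<^sup>2) * (of_real ((norm x)\<^sup>2) * (c / 24)))) = S (norm x)" for x :: 'a
    by (simp add: D_def power2_eq_square eval_nat_numeral)
  ultimately show ?thesis by simp
qed

section \<open>The equation in self-similar variables\<close>

text \<open>The radial form is required only away from the origin, so the lemma also applies to the
  Laplacian it produces, whose radial expression is singular at 0.\<close>

lemma laplacian_radial:
  fixes f :: "'a::euclidean_space \<Rightarrow> complex"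
  assumes f: "\<And>y. y \<noteq> 0 \<Longrightarrow> f y = \<Phi> (norm y)"
    and d1: "\<And>r. 0 < r \<Longrightarrow> (\<Phi> has_vector_derivative \<Phi>1 r) (at r)"
    and d2: "\<And>r. 0 < r \<Longrightarrow> (\<Phi>1 has_vector_derivative \<Phi>2 r) (at r)"
    and x: "x \<noteq> 0"
  shows "laplacian f x = \<Phi>2 (norm x) + of_real ((real DIM('a) - 1) / norm x) * \<Phi>1 (norm x)"
proof -
  define R where "R = complex_of_real (norm x)"
  have R: "R \<noteq> 0" using x by (simp add: R_def)
  have p1: "partial b f y = of_real (y \<bullet> b) * (\<Phi>1 (norm y) / of_real (norm y))" if "y \<noteq> 0" for y b
  proof (rule partial_eqI)
    show "has_partial b f (of_real (y \<bullet> b) * (\<Phi>1 (norm y) / of_real (norm y))) y"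
      using has_partial_radial[OF that d1] has_partial_cong_nonzero[of f "\<lambda>y. \<Phi> (norm y)" y b] f that by simp
  qed
  have d\<Psi>: "((\<lambda>r. \<Phi>1 r / of_real r) has_vector_derivative \<Phi>2 (norm x) / R - \<Phi>1 (norm x) / R\<^sup>2) (at (norm x))"
  proof -
    have "((\<lambda>r. of_real (inverse r) * \<Phi>1 r) has_vector_derivative
        of_real (inverse (norm x)) * \<Phi>2 (norm x) + of_real (- (inverse (norm x) ^ Suc (Suc 0))) * \<Phi>1 (norm x)) (at (norm x))"
      using d2[of "norm x"] x
      by (intro has_vector_derivative_mult has_vector_derivative_of_real DERIV_inverse) auto
    then show ?thesis by (simp add: R_def field_simps power2_eq_square)
  qed
  have p2: "partial b (partial b f) x = of_real ((x \<bullet> b)\<^sup>2) * ((\<Phi>2 (norm x) / R - \<Phi>1 (norm x) / R\<^sup>2) / R) + \<Phi>1 (norm x) / R"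
    if b: "b \<in> Basis" for b
  proof (rule partial_eqI)
    have "has_partial b (\<lambda>y. of_real (y \<bullet> b) * (\<Phi>1 (norm y) / of_real (norm y)))
      (of_real (x \<bullet> b) * (of_real (x \<bullet> b) * ((\<Phi>2 (norm x) / R - \<Phi>1 (norm x) / R\<^sup>2) / of_real (norm x)))
        + of_real (b \<bullet> b) * (\<Phi>1 (norm x) / of_real (norm x))) x"
      by (intro has_partial_mult has_partial_inner has_partial_radial[OF x d\<Psi>])
    then have "has_partial b (partial b f)
      (of_real (x \<bullet> b) * (of_real (x \<bullet> b) * ((\<Phi>2 (norm x) / R - \<Phi>1 (norm x) / R\<^sup>2) / of_real (norm x)))
        + of_real (b \<bullet> b) * (\<Phi>1 (norm x) / of_real (norm x))) x"
      using has_partial_cong_nonzero[OF p1 x] by simp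
    then show "has_partial b (partial b f)
      (of_real ((x \<bullet> b)\<^sup>2) * ((\<Phi>2 (norm x) / R - \<Phi>1 (norm x) / R\<^sup>2) / R) + \<Phi>1 (norm x) / R) x"
      using b by (simp add: R_def power2_eq_square mult.assoc)
  qed
  have "(\<Sum>b\<in>Basis. (x \<bullet> b)\<^sup>2) = (norm x)\<^sup>2"
    unfolding power2_norm_eq_inner by (subst (2) euclidean_inner) (simp add: power2_eq_square)
  then have n: "(\<Sum>b\<in>Basis. complex_of_real ((x \<bullet> b)\<^sup>2)) = R\<^sup>2"
    by (simp add: R_def flip: of_real_sum of_real_power)
  have "laplacian f x = (\<Sum>b\<in>Basis. of_real ((x \<bullet> b)\<^sup>2) * ((\<Phi>2 (norm x) / R - \<Phi>1 (norm x) / R\<^sup>2) / R) + \<Phi>1 (norm x) / R)"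
    unfolding laplacian_def by (rule sum.cong) (simp_all add: p2)
  also have "\<dots> = R\<^sup>2 * ((\<Phi>2 (norm x) / R - \<Phi>1 (norm x) / R\<^sup>2) / R) + of_nat DIM('a) * (\<Phi>1 (norm x) / R)"
    by (simp only: sum.distrib sum_distrib_right[symmetric] n sum_constant)
  also have "\<dots> = \<Phi>2 (norm x) + of_real ((real DIM('a) - 1) / norm x) * \<Phi>1 (norm x)"
    using R by (simp add: R_def field_simps power2_eq_square)
  finally show ?thesis .
qed

text \<open>Two applications of the radial Laplacian. With n = d - 1, the outer n/\<rho> gives n^2
  and the derivatives of the inner n/\<rho> give -2n, together n(n - 2) = (d - 1)(d - 3).\<close>

lemma biharmonic_radial:
  fixes x :: "'a::euclidean_space"
  assumes S: "hl_Ck 4 S" and x: "x \<noteq> 0"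
  shows "biharmonic (\<lambda>x::'a. S (norm x)) x = radial_biharmonic DIM('a) S (norm x)"
proof -
  define n where "n = real DIM('a) - 1"
  have d: "(S has_vector_derivative hl_derivs 1 S r) (at r)"
    "(hl_derivs 1 S has_vector_derivative hl_derivs 2 S r) (at r)"
    "(hl_derivs 2 S has_vector_derivative hl_derivs 3 S r) (at r)"
    "(hl_derivs 3 S has_vector_derivative hl_derivs 4 S r) (at r)" if "0 < r" for r
    using hl_derivs_has_vector_derivative_at[OF S _ that] by (force simp: numeral_eq_Suc)+
  define G where "G = (\<lambda>r. hl_derivs 2 S r + of_real (n * (1 / r)) * hl_derivs 1 S r)"
  define G1 where "G1 = (\<lambda>r. hl_derivs 3 S r + (of_real (n * (1 / r)) * hl_derivs 2 S r + of_real (n * (- 1 / r\<^sup>2)) * hl_derivs 1 S r))"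
  define G2 where "G2 = (\<lambda>r. hl_derivs 4 S r + ((of_real (n * (1 / r)) * hl_derivs 3 S r + of_real (n * (- 1 / r\<^sup>2)) * hl_derivs 2 S r)
      + (of_real (n * (- 1 / r\<^sup>2)) * hl_derivs 2 S r + of_real (n * (2 / r ^ 3)) * hl_derivs 1 S r)))"
  have i: "((\<lambda>r::real. n * (1 / r)) has_real_derivative n * (- 1 / r\<^sup>2)) (at r)"
    "((\<lambda>r::real. n * (- 1 / r\<^sup>2)) has_real_derivative n * (2 / r ^ 3)) (at r)" if "0 < r" for r
    using that by (auto intro!: derivative_eq_intros simp: field_simps power2_eq_square power3_eq_cube)
  have "laplacian (\<lambda>x::'a. S (norm x)) y = G (norm y)" if "y \<noteq> 0" for y
    using laplacian_radial[of "\<lambda>x::'a. S (norm x)" S, OF _ d(1,2) that] by (simp add: G_def n_def)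
  moreover have "(G has_vector_derivative G1 r) (at r)" if "0 < r" for r
    unfolding G_def G1_def
    by (intro has_vector_derivative_add has_vector_derivative_mult has_vector_derivative_of_real d i that)
  moreover have "(G1 has_vector_derivative G2 r) (at r)" if "0 < r" for r
    unfolding G1_def G2_def
    by (intro has_vector_derivative_add has_vector_derivative_mult has_vector_derivative_of_real d i that)
  ultimately have "biharmonic (\<lambda>x::'a. S (norm x)) x = G2 (norm x) + of_real (n / norm x) * G1 (norm x)"
    unfolding biharmonic_def n_def using x by (intro laplacian_radial)
  also have "\<dots> = radial_biharmonic DIM('a) S (norm x)"
  proof -
    have nd: "real DIM('a) = n + 1" by (simp add: n_def)
    define \<rho> where "\<rho> = norm x"
    have \<rho>: "\<rho> \<noteq> 0" using x by (simp add: \<rho>_def)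
    show ?thesis
      unfolding G1_def G2_def radial_biharmonic_def nd \<rho>_def[symmetric]
      using \<rho> by (simp add: field_simps power2_eq_square power3_eq_cube)
  qed
  finally show ?thesis .
qed

lemma Ck_laplacian: "Ck (Suc (Suc k)) f \<Longrightarrow> Ck k (laplacian f)"
proof -
  assume f: "Ck (Suc (Suc k)) f"
  have "Ck k (\<lambda>x. \<Sum>b\<in>Basis. partial b (partial b f) x)"
    by (intro Ck_sum) (auto intro: Ck_partial(2)[OF Ck_partial(2)[OF f]])
  then show ?thesis unfolding laplacian_def[abs_def] .
qed

lemma laplacian_scale:
  assumes f: "Ck (Suc (Suc k)) f"
  shows "laplacian (\<lambda>x. c * f (x /\<^sub>R L)) = (\<lambda>x. c / of_real (L\<^sup>2) * laplacian f (x /\<^sub>R L))"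
proof
  fix x :: 'a
  have "partial b (partial b (\<lambda>x. c * f (x /\<^sub>R L))) x = c / of_real (L\<^sup>2) * partial b (partial b f) (x /\<^sub>R L)"
    if b: "b \<in> Basis" for b
  proof -
    have "partial b (\<lambda>x. c * f (x /\<^sub>R L)) = (\<lambda>x. c / of_real L * partial b f (x /\<^sub>R L))"
      by (intro ext partial_eqI has_partial_scale Ck_partial[OF f b])
    moreover have "partial b (\<lambda>x. c / of_real L * partial b f (x /\<^sub>R L)) x =
        c / of_real L / of_real L * partial b (partial b f) (x /\<^sub>R L)"
      by (intro partial_eqI has_partial_scale Ck_partial(1)[OF Ck_partial(2)[OF f b] b])
    ultimately show ?thesis by (simp add: power2_eq_square)
  qed
  then show "laplacian (\<lambda>x. c * f (x /\<^sub>R L)) x = c / of_real (L\<^sup>2) * laplacian f (x /\<^sub>R L)"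
    by (simp add: laplacian_def sum_distrib_left)
qed

lemma biharmonic_scale:
  assumes f: "Ck 4 f"
  shows "biharmonic (\<lambda>x. c * f (x /\<^sub>R L)) x = c / of_real (L ^ 4) * biharmonic f (x /\<^sub>R L)"
proof -
  have f': "Ck (Suc (Suc (Suc (Suc 0)))) f" using f by (simp add: numeral_eq_Suc)
  show ?thesis
    unfolding biharmonic_def laplacian_scale[OF f'] laplacian_scale[OF Ck_laplacian[OF f']]
    by (simp add: eval_nat_numeral)
qed

text \<open>For y \<noteq> 0 this is the radial equation. All terms are continuous on the whole
  space, the bilaplacian because the profile is C^4 across the origin, and the punctured space is
  dense, so the identity extends to y = 0.\<close>

lemma profile_equation_in_space:
  fixes y :: "'a::euclidean_space"
  assumes sol: "profile_solution DIM('a) \<sigma> \<nu> \<kappa> S" and \<sigma>: "0 < \<sigma>"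
  shows "- of_real \<nu> * S (norm y)
        + \<i> * of_real (\<kappa>^4 / 4) * (of_real (2 / \<sigma>) * S (norm y) + of_real (norm y) * hl_derivs 1 S (norm y))
        - biharmonic (\<lambda>x::'a. S (norm x)) y
        + of_real (norm (S (norm y)) powr (2 * \<sigma>)) * S (norm y) = 0" (is "?F y = 0")
proof (rule continuous_constant_on_closure[where S = "- {0}" and f = ?F])
  have S: "hl_Ck 4 S" "hl_derivs 1 S 0 = 0" "hl_derivs 3 S 0 = 0"
    using sol by (auto simp: profile_solution_def)
  have Ck: "Ck 4 (\<lambda>x::'a. S (norm x))" by (rule radial_profile_Ck[OF S])
  have c0: "continuous_on UNIV (\<lambda>y::'a. S (norm y))" by (rule Ck_imp_continuous[OF Ck])
  have "continuous_on {0..} (hl_derivs 1 S)"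
    unfolding continuous_on_eq_continuous_within
    using hl_derivs_has_vector_derivative[OF S(1), of 1] by (auto intro: has_vector_derivative_continuous)
  then have c1: "continuous_on UNIV (\<lambda>y::'a. hl_derivs 1 S (norm y))"
    by (rule continuous_on_compose2[OF _ continuous_on_norm[OF continuous_on_id]]) auto
  have "Ck 0 (laplacian (laplacian (\<lambda>x::'a. S (norm x))))"
    using Ck by (intro Ck_laplacian) (simp add: numeral_eq_Suc)
  then have c4: "continuous_on UNIV (biharmonic (\<lambda>x::'a. S (norm x)))"
    by (simp add: biharmonic_def)
  have cp: "continuous_on UNIV (\<lambda>y::'a. norm (S (norm y)) powr (2 * \<sigma>))"
    using \<sigma> by (intro continuous_on_powr' continuous_on_norm c0 continuous_on_const) auto
  have "continuous_on UNIV ?F"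
    by (intro continuous_intros c0 c1 c4 cp)
  then show "continuous_on (closure (- {0})) ?F"
    by (rule continuous_on_subset) simp
  show "?F x = 0" if "x \<in> - {0}" for x
    using sol that by (simp add: profile_solution_def biharmonic_radial[OF S(1)])
  show "y \<in> closure (- {0})" by (simp add: closure_complement)
qed


section \<open>The ansatz as a function of time\<close>

lemma blowup_width_power4: "t < T \<Longrightarrow> blowup_width \<kappa> T t ^ 4 = \<kappa> ^ 4 * (T - t)"
  by (simp add: blowup_width_def power_mult_distrib powr_power)

lemma blowup_width_pos: "0 < \<kappa> \<Longrightarrow> t < T \<Longrightarrow> 0 < blowup_width \<kappa> T t"
  by (simp add: blowup_width_def)

lemma blowup_width_deriv:
  assumes "t < T"
  shows "(blowup_width \<kappa> T has_real_derivative - blowup_width \<kappa> T t / (4 * (T - t))) (at t)"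
proof -
  have "((\<lambda>t. \<kappa> * (T - t) powr (1 / 4)) has_real_derivative \<kappa> * (1 / 4 * (T - t) powr (1 / 4 - 1) * (- 1))) (at t)"
    using assms by (auto intro!: derivative_eq_intros)
  moreover have "(T - t) powr (1 / 4 - 1) = (T - t) powr (1 / 4) / (T - t)"
    using assms by (subst powr_diff) simp
  moreover have "\<kappa> * (1 / 4 * (p / s) * (- 1)) = - (\<kappa> * p) / (4 * s)" for p s :: real
    by simp
  ultimately show ?thesis by (simp only: blowup_width_def[abs_def])
qed

lemma phase_integral:
  assumes \<kappa>: "0 < \<kappa>" and t: "0 \<le> t" "t < T"
  shows "integral {0..t} (\<lambda>s. 1 / blowup_width \<kappa> T s ^ 4) = (ln T - ln (T - t)) / \<kappa> ^ 4"
proof -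
  have "((\<lambda>s. 1 / blowup_width \<kappa> T s ^ 4) has_integral - ln (T - t) / \<kappa> ^ 4 - - ln (T - 0) / \<kappa> ^ 4) {0..t}"
  proof (rule fundamental_theorem_of_calculus)
    fix s assume s: "s \<in> {0..t}"
    then have "((\<lambda>s. - ln (T - s) / \<kappa> ^ 4) has_real_derivative 1 / blowup_width \<kappa> T s ^ 4) (at s within {0..t})"
      using t \<kappa> by (auto intro!: derivative_eq_intros simp: blowup_width_power4 field_simps)
    then show "((\<lambda>s. - ln (T - s) / \<kappa> ^ 4) has_vector_derivative 1 / blowup_width \<kappa> T s ^ 4) (at s within {0..t})"
      by (simp add: has_real_derivative_iff_has_vector_derivative)
  qed (use t in simp)
  from integral_unique[OF this] show ?thesis by (simp add: diff_divide_distrib)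
qed

text \<open>The phase integral is replaced by its closed form, which is differentiable from both
  sides at every t < T, including t = 0. Agreement with the ansatz is needed only for 0 \<le>
  t.\<close>

definition amplitude :: "real \<Rightarrow> real \<Rightarrow> real \<Rightarrow> real \<Rightarrow> real \<Rightarrow> complex" where
  "amplitude \<sigma> \<nu> \<kappa> T t = of_real (1 / blowup_width \<kappa> T t powr (2 / \<sigma>)) * exp (\<i> * of_real (\<nu> * ((ln T - ln (T - t)) / \<kappa> ^ 4)))"

lemma psi_S_eq:
  assumes "0 < \<kappa>" "0 \<le> t" "t < T"
  shows "psi_S \<sigma> \<nu> \<kappa> T S t x = amplitude \<sigma> \<nu> \<kappa> T t * S (norm (x /\<^sub>R blowup_width \<kappa> T t))"
proof -
  have "norm (x /\<^sub>R blowup_width \<kappa> T t) = norm x / blowup_width \<kappa> T t"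
    using blowup_width_pos[OF assms(1,3)] by (simp add: divide_inverse mult.commute)
  then show ?thesis
    by (simp add: psi_S_def Let_def phase_integral[OF assms] amplitude_def)
qed

lemma norm_amplitude: "norm (amplitude \<sigma> \<nu> \<kappa> T t) = blowup_width \<kappa> T t powr (- (2 / \<sigma>))"
  unfolding amplitude_def norm_mult norm_exp_i_times by (simp add: norm_divide powr_minus_divide)

lemma amplitude_deriv:
  assumes \<kappa>: "0 < \<kappa>" and \<sigma>: "0 < \<sigma>" and t: "t < T"
  shows "(amplitude \<sigma> \<nu> \<kappa> T has_vector_derivative
      amplitude \<sigma> \<nu> \<kappa> T t * (of_real (1 / (2 * \<sigma> * (T - t))) + \<i> * of_real (\<nu> / (\<kappa> ^ 4 * (T - t))))) (at t)"
proof -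
  let ?L = "blowup_width \<kappa> T"
  have L: "0 < ?L t" by (rule blowup_width_pos[OF \<kappa> t])
  have "((\<lambda>t. 1 / ?L t powr (2 / \<sigma>)) has_real_derivative 1 / (2 * \<sigma> * (T - t)) * (1 / ?L t powr (2 / \<sigma>))) (at t)"
  proof -
    have "((\<lambda>t. ?L t powr (- (2 / \<sigma>))) has_real_derivative
        (- (2 / \<sigma>)) * ?L t powr (- (2 / \<sigma>) - 1) * (- ?L t / (4 * (T - t)))) (at t)"
      by (rule DERIV_chain2[OF has_real_derivative_powr[OF L] blowup_width_deriv[OF t]])
    moreover have "?L t powr (- (2 / \<sigma>) - 1) = ?L t powr (- (2 / \<sigma>)) / ?L t"
      using L by (subst powr_diff) simp
    ultimately have "((\<lambda>t. ?L t powr (- (2 / \<sigma>))) has_real_derivative 1 / (2 * \<sigma> * (T - t)) * ?L t powr (- (2 / \<sigma>))) (at t)"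
    proof (elim DERIV_cong)
      assume eq: "?L t powr (- (2 / \<sigma>) - 1) = ?L t powr (- (2 / \<sigma>)) / ?L t"
      have alg: "- (2 / \<sigma>) * (p / l) * (- l / (4 * s)) = 1 / (2 * \<sigma> * s) * p" if "l \<noteq> 0" for p l s :: real
        using that by simp
      show "- (2 / \<sigma>) * ?L t powr (- (2 / \<sigma>) - 1) * (- ?L t / (4 * (T - t))) = 1 / (2 * \<sigma> * (T - t)) * ?L t powr (- (2 / \<sigma>))"
        unfolding eq by (rule alg) (use L in simp)
    qed
    then show ?thesis by (simp only: powr_minus_divide)
  qed
  note 1 = has_vector_derivative_of_real[OF this]
  have "((\<lambda>t. \<nu> * ((ln T - ln (T - t)) / \<kappa> ^ 4)) has_real_derivative \<nu> / (\<kappa> ^ 4 * (T - t))) (at t)"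
    using t \<kappa> by (auto intro!: derivative_eq_intros simp: field_simps)
  then have "((\<lambda>t. \<i> * of_real (\<nu> * ((ln T - ln (T - t)) / \<kappa> ^ 4))) has_vector_derivative \<i> * of_real (\<nu> / (\<kappa> ^ 4 * (T - t)))) (at t)"
    by (intro has_vector_derivative_mult_right has_vector_derivative_of_real)
  from field_vector_diff_chain_at[OF this DERIV_exp]
  have 2: "((\<lambda>t. exp (\<i> * of_real (\<nu> * ((ln T - ln (T - t)) / \<kappa> ^ 4)))) has_vector_derivative
     \<i> * of_real (\<nu> / (\<kappa> ^ 4 * (T - t))) * exp (\<i> * of_real (\<nu> * ((ln T - ln (T - t)) / \<kappa> ^ 4)))) (at t)"
    by (simp add: o_def)
  from has_vector_derivative_mult[OF 1 2] show ?thesis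
    unfolding amplitude_def[abs_def] by (rule has_vector_derivative_eq_rhs) (simp add: algebra_simps)
qed

text \<open>Everything comes from L'/L = -1/(4(T - t)): the power -2/\<sigma> of L gives
  1/(2\<sigma>(T - t)), and the argument |x|/L gives \<xi>/(4(T - t)).\<close>

lemma psi_S_time_deriv:
  fixes x :: "'a::euclidean_space"
  assumes S: "hl_Ck 4 S" and \<kappa>: "0 < \<kappa>" and \<sigma>: "0 < \<sigma>" and t: "0 \<le> t" "t < T"
  defines "\<xi> \<equiv> norm (x /\<^sub>R blowup_width \<kappa> T t)"
  shows "((\<lambda>s. psi_S \<sigma> \<nu> \<kappa> T S s x) has_vector_derivative
     amplitude \<sigma> \<nu> \<kappa> T t * ((of_real (1 / (2 * \<sigma> * (T - t))) + \<i> * of_real (\<nu> / (\<kappa> ^ 4 * (T - t)))) * S \<xi>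
       + of_real (\<xi> / (4 * (T - t))) * hl_derivs 1 S \<xi>)) (at t within {0..<T})"
proof -
  let ?L = "blowup_width \<kappa> T"
  let ?I = "{0..<T}"
  have L: "0 < ?L t" by (rule blowup_width_pos[OF \<kappa> t(2)])
  have \<xi>: "\<xi> = norm x / ?L t" using L by (simp add: \<xi>_def divide_inverse mult.commute)
  have "((\<lambda>s. norm x / ?L s) has_real_derivative \<xi> / (4 * (T - t))) (at t within ?I)"
  proof -
    have "((\<lambda>s. norm x / ?L s) has_real_derivative (0 * ?L t - norm x * (- ?L t / (4 * (T - t)))) / (?L t * ?L t)) (at t)"
      by (rule DERIV_divide[OF DERIV_const blowup_width_deriv[OF t(2)]]) (use L in simp)
    moreover have "(0 * ?L t - norm x * (- ?L t / (4 * (T - t)))) / (?L t * ?L t) = \<xi> / (4 * (T - t))"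
    proof -
      have alg: "(0 * l - n * (- l / (4 * s))) / (l * l) = n / l / (4 * s)" if "l \<noteq> 0" for l n s :: real
        using that by simp
      show ?thesis unfolding \<xi> by (rule alg) (use L in simp)
    qed
    ultimately show ?thesis
      by (metis has_field_derivative_at_within)
  qed
  then have 1: "((\<lambda>s. norm x / ?L s) has_vector_derivative \<xi> / (4 * (T - t))) (at t within ?I)"
    by (simp add: has_real_derivative_iff_has_vector_derivative)
  have "(S has_vector_derivative hl_derivs 1 S (norm x / ?L t)) (at (norm x / ?L t) within {0..})"
    using hl_derivs_has_vector_derivative[OF S, of 0] L by simp
  \<comment> \<open>The profile is differentiable at 0 only within the half-line, and for x = 0 the
    argument sits at that endpoint. The chain rule is therefore applied within the image, which
    stays in the half-line.\<close>
  moreover have "0 \<le> norm x / ?L s" if "s \<in> ?I" for s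
    using blowup_width_pos[OF \<kappa>, of s T] that by simp
  then have "(\<lambda>s. norm x / ?L s) ` ?I \<subseteq> {0..}" by (simp add: image_subset_iff)
  ultimately have "(S has_vector_derivative hl_derivs 1 S (norm x / ?L t)) (at (norm x / ?L t) within (\<lambda>s. norm x / ?L s) ` ?I)"
    by (rule has_vector_derivative_within_subset)
  from vector_diff_chain_within[OF 1 this]
  have 2: "((\<lambda>s. S (norm x / ?L s)) has_vector_derivative of_real (\<xi> / (4 * (T - t))) * hl_derivs 1 S \<xi>) (at t within ?I)"
    by (simp add: o_def \<xi> scaleR_conv_of_real)
  have 3: "((\<lambda>s. amplitude \<sigma> \<nu> \<kappa> T s * S (norm x / ?L s)) has_vector_derivative
     amplitude \<sigma> \<nu> \<kappa> T t * (of_real (\<xi> / (4 * (T - t))) * hl_derivs 1 S \<xi>)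
     + amplitude \<sigma> \<nu> \<kappa> T t * (of_real (1 / (2 * \<sigma> * (T - t))) + \<i> * of_real (\<nu> / (\<kappa> ^ 4 * (T - t)))) * S (norm x / ?L t)) (at t within ?I)"
    by (intro has_vector_derivative_mult 2 has_vector_derivative_at_within[OF amplitude_deriv[OF \<kappa> \<sigma> t(2)]])
  have 4: "psi_S \<sigma> \<nu> \<kappa> T S s x = amplitude \<sigma> \<nu> \<kappa> T s * S (norm x / ?L s)" if "s \<in> ?I" for s
    using that blowup_width_pos[OF \<kappa>, of s T] by (simp add: psi_S_eq[OF \<kappa>] divide_inverse mult.commute)
  have tI: "t \<in> ?I" using t by simp
  have alg: "A * (y * z) + A * c * s = A * (c * s + y * z)" for A y z c s :: complex
    by (simp add: algebra_simps)
  from has_vector_derivative_transform[OF tI 4 3[unfolded alg]] show ?thesis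
    unfolding \<xi> by simp
qed

lemma psi_S_classical_solution:
  fixes S :: "real \<Rightarrow> complex"
  assumes sol: "profile_solution DIM('a) \<sigma> \<nu> \<kappa> S" and \<kappa>: "0 < \<kappa>" and \<sigma>: "0 < \<sigma>"
  shows "bnls_classical_solution_on \<sigma> {0..<T} (psi_S \<sigma> \<nu> \<kappa> T S :: real \<Rightarrow> 'a::euclidean_space \<Rightarrow> complex)"
proof -
  let ?I = "{0..<T}"
  let ?L = "blowup_width \<kappa> T"
  let ?A = "amplitude \<sigma> \<nu> \<kappa> T"
  define f where "f = (\<lambda>x::'a. S (norm x))"
  define g where "g = (\<lambda>x::'a. of_real (norm x) * hl_derivs 1 S (norm x))"
  define \<psi> where "\<psi> = (psi_S \<sigma> \<nu> \<kappa> T S :: real \<Rightarrow> 'a \<Rightarrow> complex)"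
  have S: "hl_Ck 4 S" "hl_derivs 1 S 0 = 0" "hl_derivs 3 S 0 = 0"
    using sol by (auto simp: profile_solution_def)
  have f: "Ck 4 f" unfolding f_def by (rule radial_profile_Ck[OF S])
  have cf: "continuous_on UNIV f" by (rule Ck_imp_continuous[OF f])
  have "continuous_on {0..} (hl_derivs 1 S)"
    unfolding continuous_on_eq_continuous_within
    using hl_derivs_has_vector_derivative[OF S(1), of 1] by (auto intro: has_vector_derivative_continuous)
  then have "continuous_on UNIV (\<lambda>y::'a. hl_derivs 1 S (norm y))"
    by (rule continuous_on_compose2[OF _ continuous_on_norm[OF continuous_on_id]]) auto
  then have cg: "continuous_on UNIV g"
    unfolding g_def by (intro continuous_intros)
  have Lpos: "0 < ?L t" if "t \<in> ?I" for t using that by (intro blowup_width_pos[OF \<kappa>]) simp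
  then have L0: "\<And>t. t \<in> ?I \<Longrightarrow> ?L t \<noteq> 0" by force
  have cL: "continuous_on ?I ?L"
    by (intro continuous_at_imp_continuous_on ballI DERIV_isCont[OF blowup_width_deriv]) simp
  have cA: "continuous_on ?I ?A"
    by (intro continuous_at_imp_continuous_on ballI has_vector_derivative_continuous[OF amplitude_deriv[OF \<kappa> \<sigma>]]) simp
  have \<psi>: "\<psi> t = (\<lambda>x. ?A t * f (x /\<^sub>R ?L t))" if "t \<in> ?I" for t
    using that by (auto simp: \<psi>_def f_def psi_S_eq[OF \<kappa>])
  have "space_Ck_on 4 ?I \<psi> = space_Ck_on 4 ?I (\<lambda>t x. ?A t * f (x /\<^sub>R ?L t))"
    by (rule space_Ck_on_cong) (rule \<psi>)
  also have \<dots>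
    by (rule Ck_scaled_space_Ck_on[OF f cA cL L0])
  finally have 1: "space_Ck_on 4 ?I \<psi>" .
  define z where "z = (\<lambda>t. of_real (1 / (2 * \<sigma> * (T - t))) + \<i> * of_real (\<nu> / (\<kappa> ^ 4 * (T - t))))"
  have td: "((\<lambda>s. \<psi> s x) has_vector_derivative
      ?A t * z t * f (x /\<^sub>R ?L t) + ?A t * of_real (1 / (4 * (T - t))) * g (x /\<^sub>R ?L t)) (at t within ?I)"
    if "t \<in> ?I" for t x
  proof -
    have "0 \<le> t" "t < T" using that by auto
    from psi_S_time_deriv[OF S(1) \<kappa> \<sigma> this, where x = x and \<nu> = \<nu>] show ?thesis
      unfolding \<psi>_def by (rule has_vector_derivative_eq_rhs) (simp add: z_def f_def g_def algebra_simps)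
  qed
  have 2: "(\<lambda>s. \<psi> s x) differentiable (at t within ?I)" if "t \<in> ?I" for t x
    by (rule differentiableI_vector[OF td[OF that]])
  have tdv: "time_deriv ?I \<psi> t x = ?A t * z t * f (x /\<^sub>R ?L t) + ?A t * of_real (1 / (4 * (T - t))) * g (x /\<^sub>R ?L t)"
    if t: "t \<in> ?I" for t x
  proof -
    \<comment> \<open>The derivative within the interval has a unique value only at limit points;
      this shows that every t of the interval is one, including the endpoint 0.\<close>
    have "?I \<noteq> {z}" for z
    proof
      assume z: "?I = {z}"
      have "0 \<in> ?I" "T / 2 \<in> ?I" using t by auto
      then have "0 = T / 2" unfolding z by auto
      then show False using t by simp
    qed
    then have "t islimpt ?I"
      by (intro connected_imp_perfect connected_Ico t)
    then have "at t within ?I \<noteq> bot" by (simp add: trivial_limit_within)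
    then show ?thesis
      unfolding time_deriv_def by (rule vector_derivative_within[OF _ td[OF t]])
  qed
  have "continuous_on ?I (\<lambda>t. ?A t * z t)"
    unfolding z_def using \<kappa> \<sigma> by (intro continuous_intros cA) auto
  from continuous_on_time_space_scaled[OF cf this cL L0]
  have c1: "continuous_on (?I \<times> UNIV) (\<lambda>(t, x). ?A t * z t * f (x /\<^sub>R ?L t))" .
  have "continuous_on ?I (\<lambda>t. ?A t * of_real (1 / (4 * (T - t))))"
    by (intro continuous_intros cA) auto
  from continuous_on_time_space_scaled[OF cg this cL L0]
  have c2: "continuous_on (?I \<times> UNIV) (\<lambda>(t, x). ?A t * of_real (1 / (4 * (T - t))) * g (x /\<^sub>R ?L t))" .
  have "continuous_on (?I \<times> UNIV) (\<lambda>p. (case p of (t, x) \<Rightarrow> ?A t * z t * f (x /\<^sub>R ?L t))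
      + (case p of (t, x) \<Rightarrow> ?A t * of_real (1 / (4 * (T - t))) * g (x /\<^sub>R ?L t)))"
    by (rule continuous_on_add[OF c1 c2])
  moreover have "continuous_on (?I \<times> UNIV) (\<lambda>(t, x). time_deriv ?I \<psi> t x) \<longleftrightarrow>
    continuous_on (?I \<times> UNIV) (\<lambda>p. (case p of (t, x) \<Rightarrow> ?A t * z t * f (x /\<^sub>R ?L t))
      + (case p of (t, x) \<Rightarrow> ?A t * of_real (1 / (4 * (T - t))) * g (x /\<^sub>R ?L t)))"
    by (rule continuous_on_cong) (auto simp: tdv)
  ultimately have 3: "continuous_on (?I \<times> UNIV) (\<lambda>(t, x). time_deriv ?I \<psi> t x)" by simp
  have 4: "\<i> * time_deriv ?I \<psi> t x - biharmonic (\<psi> t) x + of_real (norm (\<psi> t x) powr (2 * \<sigma>)) * \<psi> t x = 0"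
    if t: "t \<in> ?I" for t x
  proof -
    define y where "y = x /\<^sub>R ?L t"
    define s where "s = T - t"
    have s: "0 < s" using t by (simp add: s_def)
    have L4: "?L t ^ 4 = \<kappa> ^ 4 * s" using t by (simp add: blowup_width_power4 s_def)
    \<comment> \<open>The amplitude exponent 2/\<sigma> is the one for which the nonlinearity scales
      as L^(-4), just like the bilaplacian and the time derivative.\<close>
    have "norm (\<psi> t x) powr (2 * \<sigma>) = (?L t powr (- (2 / \<sigma>)) * norm (f y)) powr (2 * \<sigma>)"
      by (simp add: \<psi>[OF t] norm_mult norm_amplitude y_def)
    also have "\<dots> = ?L t powr (- 4) * norm (f y) powr (2 * \<sigma>)"
      using \<sigma> by (simp add: powr_mult powr_powr)
    also have "?L t powr (- 4) = 1 / (\<kappa> ^ 4 * s)"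
      using Lpos[OF t] by (simp add: powr_minus_divide flip: L4)
    finally have nl: "norm (\<psi> t x) powr (2 * \<sigma>) = norm (f y) powr (2 * \<sigma>) / (\<kappa> ^ 4 * s)" by simp
    have bi: "biharmonic (\<psi> t) x = ?A t / of_real (\<kappa> ^ 4 * s) * biharmonic f y"
      unfolding \<psi>[OF t] biharmonic_scale[OF f] L4 y_def ..
    have eq: "- of_real \<nu> * f y
        + \<i> * of_real (\<kappa>^4 / 4) * (of_real (2 / \<sigma>) * f y + g y)
        - biharmonic f y + of_real (norm (f y) powr (2 * \<sigma>)) * f y = 0"
      using profile_equation_in_space[OF sol \<sigma>, of y] by (simp add: f_def g_def)
    have \<psi>y: "\<psi> t x = ?A t * f y" by (simp add: \<psi>[OF t] y_def)
    have K: "complex_of_real \<kappa> \<noteq> 0" "complex_of_real s \<noteq> 0" "complex_of_real \<sigma> \<noteq> 0" using \<kappa> s \<sigma> by auto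
    \<comment> \<open>With L^4 = \<kappa>^4 (T - t), every term has the common factor A/L^4, and
      what is left is the profile equation at y.\<close>
    have "\<i> * time_deriv ?I \<psi> t x - biharmonic (\<psi> t) x + of_real (norm (\<psi> t x) powr (2 * \<sigma>)) * \<psi> t x
      = ?A t / of_real (\<kappa> ^ 4 * s) * (- of_real \<nu> * f y
        + \<i> * of_real (\<kappa>^4 / 4) * (of_real (2 / \<sigma>) * f y + g y)
        - biharmonic f y + of_real (norm (f y) powr (2 * \<sigma>)) * f y)"
      unfolding tdv[OF t] nl bi unfolding \<psi>y y_def[symmetric] z_def s_def[symmetric]
      using K by (simp add: field_simps)
    then show ?thesis by (simp only: eq mult_zero_right)
  qed
  show ?thesis
    using 1 2 3 4 unfolding bnls_classical_solution_on_def \<psi>_def by blast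
qed

section \<open>Integrability and blowup\<close>

text \<open>A dyadic majorant: on the ball of radius 2^k the weight is \<open>c k\<close> = 2^(-q(k
  - 1)), so the integrals form a geometric series of ratio 2^(d - q) < 1.\<close>

lemma integrable_one_plus_norm_powr:
  assumes q: "real DIM('a) < q"
  shows "integrable lborel (\<lambda>x::'a::euclidean_space. (1 + norm x) powr (- q))"
proof -
  define B where "B = (\<lambda>k::nat. cball (0::'a) (2 ^ k))"
  define c where "c = (\<lambda>k::nat. 2 powr (q - q * real k))"
  have q0: "0 < q" using q by (simp add: le_less_trans[OF of_nat_0_le_iff])
  have [measurable]: "B k \<in> sets borel" for k by (simp add: B_def)
  have pt: "ennreal ((1 + norm x) powr (- q)) \<le> (\<Sum>k. ennreal (c k) * indicator (B k) x)" for x :: 'a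
  proof -
    obtain n where "norm x < 2 ^ n" using real_arch_pow[of 2 "norm x"] by auto
    then have ex: "\<exists>n. norm x \<le> 2 ^ n" by (auto intro: less_imp_le)
    define k where "k = (LEAST n. norm x \<le> 2 ^ n)"
    have k: "norm x \<le> 2 ^ k" unfolding k_def using ex by (rule LeastI_ex)
    have "2 powr (real k - 1) \<le> 1 + norm x"
    proof (cases k)
      \<comment> \<open>For the smallest ball minimality of k gives no lower bound on |x|; here the
        summand 1 does.\<close>
      case 0
      then have "2 powr (real k - 1) = (1 / 2 :: real)" by (simp add: powr_minus)
      then show ?thesis by (simp add: add_increasing2)
    next
      case (Suc j)
      then have "\<not> norm x \<le> 2 ^ j" unfolding k_def by (intro not_less_Least) simp
      then show ?thesis by (simp add: Suc powr_realpow)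
    qed
    then have "(1 + norm x) powr (- q) \<le> (2 powr (real k - 1)) powr (- q)"
      using q0 by (intro powr_mono2') auto
    also have "\<dots> = c k" by (simp add: c_def powr_powr algebra_simps)
    finally have "ennreal ((1 + norm x) powr (- q)) \<le> ennreal (c k) * indicator (B k) x"
      using k by (simp add: B_def ennreal_leI)
    also have "\<dots> \<le> (\<Sum>k. ennreal (c k) * indicator (B k) x)"
    proof -
      define f where "f = (\<lambda>k. ennreal (c k) * indicator (B k) x)"
      have "sum f {k} \<le> suminf f" by (rule sum_le_suminf) auto
      then have "f k \<le> suminf f" by simp
      then show ?thesis by (simp only: f_def)
    qed
    finally show ?thesis .
  qed
  have "(\<integral>\<^sup>+x. ennreal ((1 + norm (x::'a)) powr (- q)) \<partial>lborel) \<le> (\<integral>\<^sup>+x. (\<Sum>k. ennreal (c k) * indicator (B k) x) \<partial>lborel)"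
    by (intro nn_integral_mono pt)
  also have "\<dots> = (\<Sum>k. \<integral>\<^sup>+x. ennreal (c k) * indicator (B k) x \<partial>lborel)"
    by (rule nn_integral_suminf) measurable
  also have "\<dots> = (\<Sum>k. ennreal (c k) * ennreal (unit_ball_vol (real DIM('a)) * (2 ^ k) ^ DIM('a)))"
    by (rule suminf_cong) (subst nn_integral_cmult_indicator, auto simp: B_def emeasure_cball)
  also have "\<dots> = (\<Sum>k. ennreal (2 powr q * unit_ball_vol (real DIM('a)) * (2 powr (real DIM('a) - q)) ^ k))"
  proof (rule suminf_cong)
    fix k
    have "c k * (2 ^ k) ^ DIM('a) = 2 powr q * (2 powr (real DIM('a) - q)) ^ k"
      by (simp add: c_def powr_power powr_diff flip: powr_realpow)
        (simp add: powr_powr powr_add[symmetric] powr_diff[symmetric] algebra_simps powr_mult_base)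
    then show "ennreal (c k) * ennreal (unit_ball_vol (real DIM('a)) * (2 ^ k) ^ DIM('a)) =
        ennreal (2 powr q * unit_ball_vol (real DIM('a)) * (2 powr (real DIM('a) - q)) ^ k)"
      by (simp add: c_def mult_ac flip: ennreal_mult)
  qed
  also have "\<dots> < \<infinity>"
  proof -
    have "2 powr (real DIM('a) - q) < (1::real)"
      using q by (simp add: powr_less_one)
    then have "summable (\<lambda>k. 2 powr q * unit_ball_vol (real DIM('a)) * (2 powr (real DIM('a) - q)) ^ k)"
      by (intro summable_mult summable_geometric) simp
    then have "(\<Sum>k. ennreal (2 powr q * unit_ball_vol (real DIM('a)) * (2 powr (real DIM('a) - q)) ^ k)) \<noteq> top"
      by (rule ennreal_suminf_neq_top) simp
    then show ?thesis by (simp add: less_top)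
  qed
  finally have fin: "(\<integral>\<^sup>+x. ennreal ((1 + norm (x::'a)) powr (- q)) \<partial>lborel) < \<infinity>" .
  show ?thesis
    by (rule integrableI_nonneg[OF _ _ fin]) auto
qed

lemma integrable_of_polynomial_decay:
  fixes h :: "'a::euclidean_space \<Rightarrow> real"
  assumes cont: "continuous_on UNIV h" and nn: "\<And>x. 0 \<le> h x"
    and q: "real DIM('a) < q" and dec: "\<And>x. R \<le> norm x \<Longrightarrow> h x \<le> D * norm x powr (- q)"
  shows "integrable lborel h"
proof -
  have q0: "0 < q" using q by (simp add: le_less_trans[OF of_nat_0_le_iff])
  define R1 where "R1 = max R 1"
  have "compact (h ` cball 0 R1)"
    by (intro compact_continuous_image continuous_on_subset[OF cont]) auto
  then obtain C where C: "\<And>x. norm x \<le> R1 \<Longrightarrow> norm (h x) \<le> C"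
    using compact_imp_bounded[of "h ` cball 0 R1"] unfolding bounded_iff by (metis imageI mem_cball_0)
  \<comment> \<open>The first entry covers a compact ball, where h is bounded. The second covers its
    complement, where |x| \<ge> 1 and hence |x| \<ge> (1 + |x|)/2.\<close>
  define M where "M = max (C * (1 + R1) powr q) (\<bar>D\<bar> * 2 powr q)"
  have le: "norm (h x) \<le> norm (M * (1 + norm x) powr (- q))" for x
  proof -
    have "h x \<le> M * (1 + norm x) powr (- q)"
    proof (cases "norm x \<le> R1")
      case True
      have C0: "0 \<le> C" using C[OF True] by (meson norm_ge_zero order_trans)
      have "h x \<le> C * 1" using C[OF True] by simp
      also have "\<dots> \<le> C * ((1 + R1) powr q * (1 + norm x) powr (- q))"
      proof (intro mult_left_mono C0)
        have "(1 + norm x) powr q \<le> (1 + R1) powr q" using True q0 by (intro powr_mono2) auto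
        moreover have "0 < 1 + norm x" by (simp add: add_pos_nonneg)
        then have "0 < (1 + norm x) powr q" by simp
        ultimately show "1 \<le> (1 + R1) powr q * (1 + norm x) powr (- q)"
          by (simp only: powr_minus_divide mult_1_right times_divide_eq_right le_divide_eq_1_pos)
      qed
      also have "\<dots> \<le> M * (1 + norm x) powr (- q)"
        by (subst mult.assoc[symmetric], intro mult_right_mono) (auto simp: M_def)
      finally show ?thesis .
    next
      case False
      then have x: "R \<le> norm x" "1 \<le> norm x" by (auto simp: R1_def)
      have "h x \<le> D * norm x powr (- q)" by (rule dec[OF x(1)])
      also have "\<dots> \<le> \<bar>D\<bar> * ((1 + norm x) / 2) powr (- q)"
        using x q0 by (intro mult_mono powr_mono2') auto
      also have "\<dots> = \<bar>D\<bar> * 2 powr q * (1 + norm x) powr (- q)"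
        by (simp add: powr_divide powr_minus field_simps)
      also have "\<dots> \<le> M * (1 + norm x) powr (- q)"
        by (intro mult_right_mono) (auto simp: M_def)
      finally show ?thesis .
    qed
    then show ?thesis using nn[of x] by simp
  qed
  have "h \<in> borel_measurable lborel"
    using borel_measurable_continuous_onI[OF cont] by simp
  moreover have "integrable lborel (\<lambda>x::'a. M * (1 + norm x) powr (- q))"
    by (intro integrable_mult_right integrable_one_plus_norm_powr q)
  ultimately show ?thesis
    using le by (intro Bochner_Integration.integrable_bound[of lborel "\<lambda>x. M * (1 + norm x) powr (- q)" h] always_eventually allI)
qed

text \<open>A vanishing integral would make the open set where h is nonzero a null set, and nonempty
  open sets are not null.\<close>

lemma integral_continuous_pos:
  fixes h :: "'a::euclidean_space \<Rightarrow> real"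
  assumes cont: "continuous_on UNIV h" and nn: "\<And>x. 0 \<le> h x" and int: "integrable lborel h" and x: "h x \<noteq> 0"
  shows "0 < (\<integral>x. h x \<partial>lborel)"
proof (rule ccontr)
  assume "\<not> ?thesis"
  moreover have "0 \<le> (\<integral>x. h x \<partial>lborel)" by (rule Bochner_Integration.integral_nonneg) (simp add: nn)
  ultimately have "(\<integral>x. h x \<partial>lborel) = 0" by simp
  then have "AE x in lborel. h x = 0"
    using integral_nonneg_eq_0_iff_AE[OF int] nn by simp
  then have "AE x in lebesgue. h x = 0" by (rule AE_completion)
  then have "negligible {x. h x \<noteq> 0}"
    by (simp add: eventually_ae_filter_negligible) (meson negligible_subset)
  moreover have "open {x. h x \<noteq> 0}"
    using cont by (intro open_Collect_neq) auto
  ultimately show False using open_not_negligible[of "{x. h x \<noteq> 0}"] x by blast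
qed

section \<open>Scaling of integrals, choice of the exponent and blowup of the norm\<close>

lemma lborel_scaleR:
  fixes h :: "'a::euclidean_space \<Rightarrow> real"
  assumes L: "0 < L" and h: "integrable lborel h"
  shows "integrable lborel (\<lambda>x. h (x /\<^sub>R L))"
    and "(\<integral>x. h (x /\<^sub>R L) \<partial>lborel) = L ^ DIM('a) * (\<integral>x. h x \<partial>lborel)"
proof -
  let ?c = "inverse L"
  have m[measurable]: "h \<in> borel_measurable borel" using h by simp
  have eq: "lborel = density (distr lborel borel (\<lambda>x. 0 + ?c *\<^sub>R x :: 'a)) (\<lambda>_. ennreal (?c ^ DIM('a)))"
    using lborel_affine[of ?c "0::'a"] L by simp
  have "integrable (density (distr lborel borel (\<lambda>x. 0 + ?c *\<^sub>R x :: 'a)) (\<lambda>_. ennreal (?c ^ DIM('a)))) h"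
    using h eq by simp
  then have "integrable (distr lborel borel (\<lambda>x. 0 + ?c *\<^sub>R x :: 'a)) (\<lambda>x. ?c ^ DIM('a) *\<^sub>R h x)"
    using L by (subst (asm) integrable_density) auto
  then have "integrable lborel (\<lambda>x. ?c ^ DIM('a) *\<^sub>R h (0 + ?c *\<^sub>R x))"
    by (subst (asm) integrable_distr_eq) auto
  then show "integrable lborel (\<lambda>x. h (x /\<^sub>R L))"
    using L by simp
  have "(\<integral>x. h x \<partial>lborel) = (\<integral>x. h x \<partial>density (distr lborel borel (\<lambda>x. 0 + ?c *\<^sub>R x :: 'a)) (\<lambda>_. ennreal (?c ^ DIM('a))))"
    using eq by simp
  also have "\<dots> = (\<integral>x. ?c ^ DIM('a) *\<^sub>R h x \<partial>distr lborel borel (\<lambda>x. 0 + ?c *\<^sub>R x :: 'a))"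
    using L by (intro integral_density) auto
  also have "\<dots> = (\<integral>x. ?c ^ DIM('a) *\<^sub>R h (0 + ?c *\<^sub>R x) \<partial>lborel)"
    by (intro integral_distr) auto
  also have "\<dots> = ?c ^ DIM('a) * (\<integral>x. h (x /\<^sub>R L) \<partial>lborel)"
    by simp
  finally show "(\<integral>x. h (x /\<^sub>R L) \<partial>lborel) = L ^ DIM('a) * (\<integral>x. h x \<partial>lborel)"
    using L by (simp add: field_simps)
qed

text \<open>Both bounds on \<sigma> enter here. With p = 2 + 2\<sigma>, d/p < 2/\<sigma> is
  equivalent to \<sigma>(d - 4) < 4. For the other rate, (2d - 2/\<sigma>) p = 4d + 4 d \<sigma> -
  4/\<sigma> - 4, which exceeds 3d because d \<sigma> > 4 and 4/\<sigma> < d.\<close>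

lemma exists_decay_exponent:
  assumes "admissible d \<sigma>"
  obtains \<gamma> where "real d < \<gamma> * (2 + 2 * \<sigma>)" "\<gamma> < 2 / \<sigma>" "\<gamma> < (2 * real d - 2 / \<sigma>) / 3" "0 < \<sigma>" "4 / \<sigma> + 4 > real d"
proof -
  have d: "1 \<le> real d" using assms by (simp add: admissible_def)
  have s: "4 / real d < \<sigma>" using assms by (simp add: admissible_def)
  have \<sigma>: "0 < \<sigma>" using less_trans[OF _ s, of 0] d by simp
  have ds: "4 < real d * \<sigma>" using s d by (simp add: field_simps)
  have crit: "\<sigma> * (real d - 4) < 4"
  proof (cases "d > 4")
    case True
    then show ?thesis using assms by (simp add: admissible_def field_simps)
  next
    case False
    then have "\<sigma> * (real d - 4) \<le> 0" using \<sigma> by (intro mult_nonneg_nonpos) auto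
    then show ?thesis by simp
  qed
  have p: "0 < 2 + 2 * \<sigma>" using \<sigma> by simp
  have 1: "real d / (2 + 2 * \<sigma>) < 2 / \<sigma>"
    using crit \<sigma> p by (simp add: field_simps)
  have s4: "4 / \<sigma> < real d" using ds \<sigma> by (simp add: field_simps)
  have "(2 * real d - 2 / \<sigma>) * (2 + 2 * \<sigma>) = 4 * real d + 4 * (real d * \<sigma>) - 4 / \<sigma> - 4"
    using \<sigma> by (simp add: field_simps)
  then have "3 * real d < (2 * real d - 2 / \<sigma>) * (2 + 2 * \<sigma>)" using s4 ds by linarith
  then have 2: "real d / (2 + 2 * \<sigma>) < (2 * real d - 2 / \<sigma>) / 3"
    using p by (simp add: divide_less_eq less_divide_eq mult.commute)
  obtain \<gamma> where "real d / (2 + 2 * \<sigma>) < \<gamma>" "\<gamma> < min (2 / \<sigma>) ((2 * real d - 2 / \<sigma>) / 3)"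
    using dense[of "real d / (2 + 2 * \<sigma>)" "min (2 / \<sigma>) ((2 * real d - 2 / \<sigma>) / 3)"] 1 2 by auto
  moreover from this have "real d < \<gamma> * (2 + 2 * \<sigma>)" using p by (simp add: divide_less_eq)
  moreover have "4 / \<sigma> + 4 > real d" using crit \<sigma> by (simp add: field_simps)
  ultimately show ?thesis using that \<sigma> by auto
qed

lemma profile_integrable:
  assumes adm: "admissible DIM('a) \<sigma>" and \<kappa>: "0 < \<kappa>" and sol: "profile_solution DIM('a) \<sigma> \<nu> \<kappa> S"
  shows "continuous_on UNIV (\<lambda>x::'a::euclidean_space. norm (S (norm x)) powr (2 + 2 * \<sigma>))"
    and "integrable lborel (\<lambda>x::'a. norm (S (norm x)) powr (2 + 2 * \<sigma>))"
proof -
  obtain \<gamma> where \<gamma>: "real DIM('a) < \<gamma> * (2 + 2 * \<sigma>)" "\<gamma> < 2 / \<sigma>" "\<gamma> < (2 * real DIM('a) - 2 / \<sigma>) / 3"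
    and \<sigma>: "0 < \<sigma>"
    using exists_decay_exponent[OF adm] by blast
  interpret decaying_profile "DIM('a)" \<sigma> \<nu> \<kappa> S
    by unfold_locales (use sol \<kappa> \<sigma> in auto)
  obtain D where "\<forall>\<^sub>F r in at_top. norm (S r) \<le> D * r powr (- \<gamma>)"
    using algebraic_decay[OF \<gamma>(2,3)] by blast
  then obtain R where R: "\<And>r. R \<le> r \<Longrightarrow> norm (S r) \<le> D * r powr (- \<gamma>)"
    by (auto simp: eventually_at_top_linorder)
  have "Ck 4 (\<lambda>x::'a. S (norm x))"
    using sol by (intro radial_profile_Ck) (auto simp: profile_solution_def)
  then have "continuous_on UNIV (\<lambda>x::'a. S (norm x))" by (rule Ck_imp_continuous)
  then show c: "continuous_on UNIV (\<lambda>x::'a. norm (S (norm x)) powr (2 + 2 * \<sigma>))"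
    using \<sigma> by (intro continuous_on_powr' continuous_on_norm continuous_on_const) auto
  show "integrable lborel (\<lambda>x::'a. norm (S (norm x)) powr (2 + 2 * \<sigma>))"
  proof (rule integrable_of_polynomial_decay[OF c _ \<gamma>(1)])
    fix x :: 'a assume x: "max R 1 \<le> norm x"
    have "norm (S (norm x)) powr (2 + 2 * \<sigma>) \<le> (D * norm x powr (- \<gamma>)) powr (2 + 2 * \<sigma>)"
      using R[of "norm x"] x \<sigma> by (intro powr_mono2) auto
    also have "\<dots> = D powr (2 + 2 * \<sigma>) * norm x powr (- (\<gamma> * (2 + 2 * \<sigma>)))"
    proof -
      have "0 \<le> D * norm x powr (- \<gamma>)" using R[of "norm x"] x by (meson max.bounded_iff norm_ge_zero order_trans)
      moreover have "x \<noteq> 0" using x by auto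
      then have "0 < norm x powr (- \<gamma>)" by simp
      ultimately have "0 \<le> D" by (simp add: zero_le_mult_iff)
      then show ?thesis by (simp add: powr_mult powr_powr)
    qed
    finally show "norm (S (norm x)) powr (2 + 2 * \<sigma>) \<le> D powr (2 + 2 * \<sigma>) * norm x powr (- (\<gamma> * (2 + 2 * \<sigma>)))" .
  qed simp
qed

lemma filterlim_powr_neg_at_right_0:
  assumes "0 < e"
  shows "filterlim (\<lambda>s::real. s powr (- e)) at_top (at_right 0)"
proof -
  have "((\<lambda>s::real. s powr e) \<longlongrightarrow> 0) (at_right 0)"
    using assms by (intro tendsto_zero_powrI[where b = e]) (auto simp: eventually_at_right_less eventually_at_filter)
  then have "filterlim (\<lambda>s::real. inverse (s powr e)) at_top (at_right 0)"
    by (rule filterlim_inverse_at_top) (auto simp: eventually_at_filter)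
  then show ?thesis by (simp add: powr_minus)
qed

theorem lemma6:
  fixes \<sigma> \<nu> \<kappa> T\<^sub>c :: real and S :: "real \<Rightarrow> complex"
    and \<psi> :: "real \<Rightarrow> 'a::euclidean_space \<Rightarrow> complex"
  assumes "\<forall>d \<sigma>'. admissible d \<sigma>' \<longrightarrow>
             (\<exists>\<kappa>'>0. \<exists>S'. nontrivial_profile S' \<and> profile_solution d \<sigma>' 1 \<kappa>' S')"
    and "admissible DIM('a) \<sigma>"
    and "\<kappa> > 0" and "T\<^sub>c > 0"
    and "profile_solution DIM('a) \<sigma> \<nu> \<kappa> S" and "nontrivial_profile S"
  defines "\<psi> \<equiv> psi_S \<sigma> \<nu> \<kappa> T\<^sub>c S"
  shows "bnls_classical_solution_on \<sigma> {0..<T\<^sub>c} \<psi>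
    \<and> (\<forall>t\<in>{0..<T\<^sub>c}. in_Lp (2 + 2 * \<sigma>) (\<psi> t))
    \<and> filterlim (\<lambda>t. Lp_norm (2 + 2 * \<sigma>) (\<psi> t)) at_top (at_left T\<^sub>c)"
proof (intro conjI ballI)
  note adm = assms(2) and \<kappa> = assms(3) and T = assms(4) and sol = assms(5)
  let ?L = "blowup_width \<kappa> T\<^sub>c"
  obtain \<gamma> where \<sigma>: "0 < \<sigma>" and crit: "real DIM('a) < 4 / \<sigma> + 4"
    using exists_decay_exponent[OF adm] by metis
  define p where "p = 2 + 2 * \<sigma>"
  have p: "0 < p" using \<sigma> by (simp add: p_def)
  define h where "h = (\<lambda>x::'a. norm (S (norm x)) powr p)"
  define J where "J = (\<integral>x. h x \<partial>lborel)"
  have ch: "continuous_on UNIV h" and ih: "integrable lborel h"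
    using profile_integrable[OF adm \<kappa> sol] by (simp_all add: h_def p_def)
  \<comment> \<open>Nontriviality of the profile is what excludes a vanishing norm: a vector of
    length \<rho> is a point where h is nonzero.\<close>
  have J: "0 < J"
  proof -
    obtain \<rho> where \<rho>: "0 \<le> \<rho>" "S \<rho> \<noteq> 0" using assms(6) by (auto simp: nontrivial_profile_def)
    obtain b :: 'a where "norm b = \<rho>" using vector_choose_size[OF \<rho>(1)] by blast
    then have "h b \<noteq> 0" using \<rho> by (simp add: h_def)
    then show ?thesis
      unfolding J_def by (intro integral_continuous_pos[OF ch _ ih]) (simp add: h_def)
  qed
  show sol': "bnls_classical_solution_on \<sigma> {0..<T\<^sub>c} \<psi>"
    unfolding \<psi>_def by (rule psi_S_classical_solution[OF sol \<kappa> \<sigma>])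
  have n\<psi>: "norm (\<psi> t x) powr p = ?L t powr (- (2 * p / \<sigma>)) * h (x /\<^sub>R ?L t)" if "t \<in> {0..<T\<^sub>c}" for t x
    using that by (simp add: \<psi>_def psi_S_eq[OF \<kappa>] norm_mult norm_amplitude h_def powr_mult powr_powr)
  have Lpos: "0 < ?L t" if "t \<in> {0..<T\<^sub>c}" for t
    using that by (intro blowup_width_pos[OF \<kappa>]) simp
  show "in_Lp (2 + 2 * \<sigma>) (\<psi> t)" if t: "t \<in> {0..<T\<^sub>c}" for t
  proof -
    have "space_Ck_on 4 {0..<T\<^sub>c} \<psi>" using sol' by (simp add: bnls_classical_solution_on_def)
    then have "continuous_on ({0..<T\<^sub>c} \<times> UNIV) (\<lambda>(t, x). \<psi> t x)" by (simp add: numeral_eq_Suc)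
    then have "continuous_on UNIV (\<lambda>x. (\<lambda>(t, x). \<psi> t x) (t, x))"
      by (rule continuous_on_compose2) (use t in \<open>auto intro!: continuous_intros\<close>)
    then have "\<psi> t \<in> borel_measurable lborel"
      using borel_measurable_continuous_onI by simp
    moreover have "integrable lborel (\<lambda>x. norm (\<psi> t x) powr p)"
      unfolding n\<psi>[OF t] by (intro integrable_mult_right lborel_scaleR(1)[OF Lpos[OF t] ih])
    ultimately show ?thesis by (simp add: in_Lp_def p_def)
  qed
  \<comment> \<open>The p-th power of the norm is L^(d - 2p/\<sigma>) J, and 2p/\<sigma> - d =
    4/\<sigma> + 4 - d. As L is \<kappa> (T - t)^(1/4), the norm itself diverges like (T -
    t)^(-m/(4p)).\<close>
  define m where "m = 4 / \<sigma> + 4 - real DIM('a)"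
  have m: "0 < m" using crit by (simp add: m_def)
  have Lp: "Lp_norm p (\<psi> t) = (\<kappa> powr (- m) * J) powr (1 / p) * (T\<^sub>c - t) powr (- (m / (4 * p)))"
    if t: "t \<in> {0..<T\<^sub>c}" for t
  proof -
    have "(\<integral>x. norm (\<psi> t x) powr p \<partial>lborel) = ?L t powr (- (2 * p / \<sigma>)) * (?L t ^ DIM('a) * J)"
      unfolding n\<psi>[OF t] by (simp add: lborel_scaleR(2)[OF Lpos[OF t] ih] J_def)
    also have "\<dots> = ?L t powr (- m) * J"
    proof -
      have "- (2 * p / \<sigma>) + real DIM('a) = - m" using \<sigma> by (simp add: m_def p_def field_simps)
      then have "?L t powr (- (2 * p / \<sigma>)) * ?L t powr real DIM('a) = ?L t powr (- m)"
        by (simp add: powr_add[symmetric])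
      then show ?thesis using Lpos[OF t] by (simp add: powr_realpow)
    qed
    also have "?L t powr (- m) = \<kappa> powr (- m) * (T\<^sub>c - t) powr (- (m / 4))"
      using \<kappa> t by (simp add: blowup_width_def powr_mult powr_powr)
    finally have "Lp_norm p (\<psi> t) = (\<kappa> powr (- m) * J * (T\<^sub>c - t) powr (- (m / 4))) powr (1 / p)"
      by (simp add: Lp_norm_def mult_ac)
    also have "\<dots> = (\<kappa> powr (- m) * J) powr (1 / p) * ((T\<^sub>c - t) powr (- (m / 4))) powr (1 / p)"
      by (rule powr_mult)
    finally show ?thesis by (simp add: powr_powr)
  qed
  have "filterlim (\<lambda>t. T\<^sub>c - t) (at_right 0) (at_left T\<^sub>c)"
    by (auto simp: filterlim_at eventually_at_filter intro!: tendsto_eq_intros)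
  then have "filterlim (\<lambda>t. (T\<^sub>c - t) powr (- (m / (4 * p)))) at_top (at_left T\<^sub>c)"
    using m p by (intro filterlim_compose[OF filterlim_powr_neg_at_right_0]) auto
  then have "filterlim (\<lambda>t. (\<kappa> powr (- m) * J) powr (1 / p) * (T\<^sub>c - t) powr (- (m / (4 * p)))) at_top (at_left T\<^sub>c)"
    using \<kappa> J by (intro filterlim_tendsto_pos_mult_at_top[OF tendsto_const]) auto
  moreover have "\<forall>\<^sub>F t in at_left T\<^sub>c. (\<kappa> powr (- m) * J) powr (1 / p) * (T\<^sub>c - t) powr (- (m / (4 * p))) = Lp_norm p (\<psi> t)"
    using eventually_at_left_real[OF T] by eventually_elim (rule Lp[symmetric], simp)
  ultimately have "filterlim (\<lambda>t. Lp_norm p (\<psi> t)) at_top (at_left T\<^sub>c)"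
    by (rule filterlim_cong[THEN iffD1, OF refl refl, rotated])
  then show "filterlim (\<lambda>t. Lp_norm (2 + 2 * \<sigma>) (\<psi> t)) at_top (at_left T\<^sub>c)"
    by (simp add: p_def)
qed

end
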